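(* Let $0\le\theta<\pi/2$, $A,B\in\mathcal S_\theta\subseteq\mathbb M_n$, let $\sigma$ be an operator mean and $\sigma_1,\sigma_2$ operator means with $\sigma^*\le\sigma_1,\sigma_2\le\sigma$, and let $0<m\le M$, $K=\frac{(M+m)^2}{4mM}$. For $j=1,\dots,n$: (i) If $0<mI\le\Re A,\ \Re B\le MI$, then $s_j(A\sigma_1B)\le\sec^4\theta\,K\,s_j(A\sigma_2B)$. (ii) If $0<mI\le\Re(A^{-1}),\ \Re(B^{-1})\le MI$, then $s_j(A\sigma_1B)\le\sec^6\theta\,K\,s_j(A\sigma_2B)$. (iii) If $v\in[0,1]$, $\sigma$ is an operator mean with $!_v\le\sigma\le\nabla_v$, and $0<mI\le\Re A,\ \Re B\le MI$, then $s_j(A\nabla_vB)\le\sec^2\theta\,K\,s_j(A\sigma B)$.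
   Context: $s_1(X)\ge\dots\ge s_n(X)$ denote the singular values of $X\in\mathbb M_n$ in decreasing order. $\Re X=\frac{X+X^*}{2}$; for Hermitian $X,Y$, $X\le Y$ means $Y-X$ is positive semidefinite. $\mathcal S_\theta$ ($0\le\theta<\pi/2$) is the set of $A\in\mathbb M_n$ whose numerical range lies in $\{z:\Re z>0,\ |\Im z|\le(\Re z)\tan\theta\}$. An operator mean $\sigma$ has an operator monotone representing function $g:(0,\infty)\to(0,\infty)$, $g(1)=1$, and $A\sigma B=A^{1/2}g(A^{-1/2}BA^{-1/2})A^{1/2}$ (also used for accretive $A,B$ via principal square roots and holomorphic functional calculus). The adjoint $\sigma^*$ has representing function $g(t^{-1})^{-1}$. $A\nabla_vB=vA+(1-v)B$, $A!_vB=(vA^{-1}+(1-v)B^{-1})^{-1}$. For means with representing functions $g_1,g_2$, $\tau_1\le\tau_2$ means $g_1\le g_2$ on $(0,\infty)$. *)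

theory Defs
  imports "HOL-Analysis.Analysis" "Jordan_Normal_Form.Jordan_Normal_Form" "Jordan_Normal_Form.Schur_Decomposition"
begin

definition minv :: "complex mat \<Rightarrow> complex mat" where
  "minv A = (SOME B. B \<in> carrier_mat (dim_row A) (dim_row A) \<and> A * B = 1\<^sub>m (dim_row A)
                     \<and> B * A = 1\<^sub>m (dim_row A))"

definition herm_part :: "complex mat \<Rightarrow> complex mat" where
  "herm_part X = (1/2 :: complex) \<cdot>\<^sub>m (X + mat_adjoint X)"

definition hermitian :: "complex mat \<Rightarrow> bool" where
  "hermitian X \<longleftrightarrow> X \<in> carrier_mat (dim_row X) (dim_row X) \<and> mat_adjoint X = X"

definition psd :: "complex mat \<Rightarrow> bool" where
  "psd X \<longleftrightarrow> hermitian X \<and>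
     (\<forall>v \<in> carrier_vec (dim_row X). 0 \<le> Re ((X *\<^sub>v v) \<bullet>c v))"

definition pd :: "complex mat \<Rightarrow> bool" where
  "pd X \<longleftrightarrow> hermitian X \<and>
     (\<forall>v \<in> carrier_vec (dim_row X). v \<noteq> 0\<^sub>v (dim_row X) \<longrightarrow> 0 < Re ((X *\<^sub>v v) \<bullet>c v))"

definition loewner_le :: "complex mat \<Rightarrow> complex mat \<Rightarrow> bool" where
  "loewner_le X Y \<longleftrightarrow> hermitian X \<and> hermitian Y \<and> dim_row X = dim_row Y \<and> psd (Y - X)"

definition num_range :: "complex mat \<Rightarrow> complex set" where
  "num_range A = {(A *\<^sub>v x) \<bullet>c x | x. x \<in> carrier_vec (dim_row A) \<and> x \<bullet>c x = 1}"

definition sector :: "nat \<Rightarrow> real \<Rightarrow> complex mat set" where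
  "sector n \<theta> = {A. A \<in> carrier_mat n n \<and>
      (\<forall>z \<in> num_range A. 0 < Re z \<and> \<bar>Im z\<bar> \<le> Re z * tan \<theta>)}"

text \<open>Eigenvalues with algebraic multiplicity (a list whose multiset is uniquely determined).\<close>
definition eig_list :: "complex mat \<Rightarrow> complex list" where
  "eig_list X = (SOME es. char_poly X = prod_list (map (\<lambda>e. [:- e, 1:]) es))"

definition sv_list :: "complex mat \<Rightarrow> real list" where
  "sv_list X = rev (sort (map (\<lambda>e. sqrt (Re e)) (eig_list (mat_adjoint X * X))))"

definition sv :: "complex mat \<Rightarrow> nat \<Rightarrow> real" where
  "sv X j = sv_list X ! (j - 1)"

definition poly_mat :: "complex poly \<Rightarrow> complex mat \<Rightarrow> complex mat" where
  "poly_mat p X = foldr (\<lambda>i acc. coeff p i \<cdot>\<^sub>m (X ^\<^sub>m i) + acc) [0..<Suc (degree p)]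
                     (0\<^sub>m (dim_row X) (dim_row X))"

text \<open>f(X) := p(X) for any polynomial p interpolating f and its derivatives at the
  eigenvalues of X up to their algebraic multiplicities (Hermite interpolation);
  this is the standard holomorphic functional calculus.\<close>
definition mat_fun :: "(complex \<Rightarrow> complex) \<Rightarrow> complex mat \<Rightarrow> complex mat" where
  "mat_fun f X = (SOME Y. \<exists>p. (\<forall>z. \<forall>i < Polynomial.order z (char_poly X).
        (deriv ^^ i) (poly p) z = (deriv ^^ i) f z) \<and> Y = poly_mat p X)"

definition msqrt :: "complex mat \<Rightarrow> complex mat" where
  "msqrt X = mat_fun csqrt X"

definition slit_plane :: "complex set" where
  "slit_plane = - (complex_of_real ` {..0})"

definition op_monotone :: "(complex \<Rightarrow> complex) \<Rightarrow> bool" where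
  "op_monotone g \<longleftrightarrow> (\<forall>k X Y. X \<in> carrier_mat k k \<longrightarrow> Y \<in> carrier_mat k k \<longrightarrow>
       pd X \<longrightarrow> pd Y \<longrightarrow> loewner_le X Y \<longrightarrow> loewner_le (mat_fun g X) (mat_fun g Y))"

text \<open>Representing function of an operator mean: positive on (0,oo), g(1)=1, operator
  monotone on (0,oo); given by its (unique) holomorphic extension to C \ (-oo,0].\<close>
definition op_mean_fun :: "(complex \<Rightarrow> complex) \<Rightarrow> bool" where
  "op_mean_fun g \<longleftrightarrow> g holomorphic_on slit_plane \<and>
     (\<forall>t::real. t > 0 \<longrightarrow> g (of_real t) \<in> \<real> \<and> Re (g (of_real t)) > 0) \<and>
     g 1 = 1 \<and> op_monotone g"

definition mean :: "(complex \<Rightarrow> complex) \<Rightarrow> complex mat \<Rightarrow> complex mat \<Rightarrow> complex mat" where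
  "mean g A B = msqrt A * mat_fun g (minv (msqrt A) * B * minv (msqrt A)) * msqrt A"

definition adjoint_mean :: "(complex \<Rightarrow> complex) \<Rightarrow> (complex \<Rightarrow> complex)" where
  "adjoint_mean g = (\<lambda>z. inverse (g (inverse z)))"

definition mean_le :: "(complex \<Rightarrow> complex) \<Rightarrow> (complex \<Rightarrow> complex) \<Rightarrow> bool" where
  "mean_le g1 g2 \<longleftrightarrow> (\<forall>t::real. t > 0 \<longrightarrow> Re (g1 (of_real t)) \<le> Re (g2 (of_real t)))"

definition arith_fun :: "real \<Rightarrow> (complex \<Rightarrow> complex)" where
  "arith_fun v = (\<lambda>z. of_real v + of_real (1 - v) * z)"

definition harm_fun :: "real \<Rightarrow> (complex \<Rightarrow> complex)" where
  "harm_fun v = (\<lambda>z. inverse (of_real v + of_real (1 - v) * inverse z))"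

end

theory Submission
  imports Defs "HOL-Complex_Analysis.Complex_Analysis"
begin

text \<open>By Loewner's theorem, here in the form that the representing function \<open>g\<close> of an operator mean is a locally
uniform limit, on the slit plane, of convex combinations of the functions \<open>h\<^sub>s(z) = z / ((1 - s) z + s)\<close>, everything
reduces to weighted harmonic means \<open>Z = ((1 - s) A\<^sup>-\<^sup>1 + s B\<^sup>-\<^sup>1)\<^sup>-\<^sup>1\<close>. The approximation of \<open>g\<close> is a separation argument:
a linear functional of finitely many values that is nonnegative on all \<open>h\<^sub>s\<close> is given by a polynomial that is nonnegative
on a half line, hence by sums of squares, and for these the inequality for \<open>g\<close> follows from operator
monotonicity applied to a diagonal matrix and a rank one perturbation with interlacing spectrum.

For a harmonic mean \<open>Z\<close> of sectorial matrices, \<open>Re Z\<close> lies between \<open>H\<close> and \<open>sec\<^sup>2 \<theta> H\<close>, where \<open>H\<close> is the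
harmonic mean of \<open>Re A\<close> and \<open>Re B\<close>, and between \<open>cos\<^sup>2 \<theta> H'\<close> and \<open>H'\<close>, where \<open>H'\<close> is the harmonic mean of
\<open>(Re A\<^sup>-\<^sup>1)\<^sup>-\<^sup>1\<close> and \<open>(Re B\<^sup>-\<^sup>1)\<^sup>-\<^sup>1\<close>. Diagonalizing the two positive definite matrices simultaneously turns the comparison
of the two means into the scalar inequality \<open>g(t) g(1/t) \<le> (1 + t)\<^sup>2 / (4 t) \<le> K\<close>. Finally \<open>Re X \<le> C Re Y\<close> with \<open>X\<close>
sectorial gives \<open>s\<^sub>j(X) \<le> sec\<^sup>2 \<theta> C s\<^sub>j(Y)\<close> by a dimension count.\<close>

unbundle no vec_syntax
unbundle no inner_syntax
no_notation fps_nth (infixl "$" 75)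
no_notation fls_nth (infixl "$$" 75)

section \<open>Functional calculus of matrices\<close>

text \<open>Operator monotonicity speaks of positive definite matrices only, whereas for sectorial
  \<open>A\<close> and \<open>B\<close> the core \<open>minv (msqrt A) * B * minv (msqrt A)\<close>
  need not be normal, and \<open>mat_fun\<close> reads off derivatives of \<open>g\<close> at its
  eigenvalues. So information about \<open>g\<close> has to leave the positive axis: closeness at
  finitely many positive points is upgraded, by Montel's theorem and the identity theorem, to a
  convergence under which derivatives converge as well. Harmonic means are the right building blocks
  because their inverses are linear in the inverses of \<open>A\<close> and \<open>B\<close>, so
  that their forms split into forms of \<open>A\<close> and \<open>B\<close>. Only inequalities
  linear in \<open>g\<close> are transferred, so convex combinations suffice and no representing
  measure is constructed. The constant sec^2 = 1 + tan^2 has a single source, a Cauchy-Schwarz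
  inequality for sectorial forms. It is paid once for comparing the real part of a mean with a
  positive definite reference and once for passing from forms to singular values; for the arithmetic
  mean, whose real part is known exactly, the second payment alone remains.\<close>

lemma foldr_poly_mat_carrier:
  fixes X :: "complex mat"
  assumes "X \<in> carrier_mat n n"
  shows "foldr (\<lambda>i acc. c i \<cdot>\<^sub>m (X ^\<^sub>m i) + acc) xs (0\<^sub>m n n) \<in> carrier_mat n n"
  using assms by (induct xs) auto

lemma mult_pow_mat_Suc:
  fixes X :: "complex mat"
  assumes "X \<in> carrier_mat n n"
  shows "X * X ^\<^sub>m i = X ^\<^sub>m Suc i"
proof (induct i)
  case 0
  then show ?case using assms by auto
next
  case (Suc i)
  have "X * X ^\<^sub>m Suc i = (X * X ^\<^sub>m i) * X" using assms by (simp add: assoc_mult_mat[of _ n n _ n _ n])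
  then show ?case using Suc by simp
qed

lemma foldr_poly_mat_shift:
  fixes X :: "complex mat"
  assumes X: "X \<in> carrier_mat n n"
  shows "X * foldr (\<lambda>i acc. c i \<cdot>\<^sub>m (X ^\<^sub>m i) + acc) xs (0\<^sub>m n n)
    = foldr (\<lambda>i acc. c (i - 1) \<cdot>\<^sub>m (X ^\<^sub>m i) + acc) (map Suc xs) (0\<^sub>m n n)"
proof (induct xs)
  case Nil
  then show ?case using X by auto
next
  case (Cons a xs)
  have "X * (c a \<cdot>\<^sub>m X ^\<^sub>m a + foldr (\<lambda>i acc. c i \<cdot>\<^sub>m (X ^\<^sub>m i) + acc) xs (0\<^sub>m n n))
     = c a \<cdot>\<^sub>m (X * X ^\<^sub>m a) + X * foldr (\<lambda>i acc. c i \<cdot>\<^sub>m (X ^\<^sub>m i) + acc) xs (0\<^sub>m n n)"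
    using X foldr_poly_mat_carrier[OF X, of c xs]
    by (subst mult_add_distrib_mat[of _ n n _ n]) (simp_all add: mult_smult_distrib[OF X pow_carrier_mat[OF X]])
  then show ?case using Cons mult_pow_mat_Suc[OF X] by simp
qed

text \<open>\<open>poly_mat\<close> sums exactly up to the degree, which jumps unpredictably under
  polynomial operations. Trailing zero terms are harmless, so any longer range may be used
  instead.\<close>

lemma poly_mat_upt:
  assumes X: "X \<in> carrier_mat n n" and "degree p < k"
  shows "poly_mat p X = foldr (\<lambda>i acc. coeff p i \<cdot>\<^sub>m (X ^\<^sub>m i) + acc) [0..<k] (0\<^sub>m n n)"
proof -
  have "foldr (\<lambda>i acc. coeff p i \<cdot>\<^sub>m (X ^\<^sub>m i) + acc) [0..<Suc (degree p) + d] (0\<^sub>m n n)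
      = foldr (\<lambda>i acc. coeff p i \<cdot>\<^sub>m (X ^\<^sub>m i) + acc) [0..<Suc (degree p)] (0\<^sub>m n n)" for d
  proof (induct d)
    case (Suc d)
    have "0 \<cdot>\<^sub>m (X ^\<^sub>m k) = 0\<^sub>m n n" for k using X by auto
    then have "coeff p (Suc (degree p) + d) \<cdot>\<^sub>m (X ^\<^sub>m (Suc (degree p) + d)) + 0\<^sub>m n n = 0\<^sub>m n n"
      using X by (subst coeff_eq_0) (auto simp del: pow_mat.simps)
    then show ?case using Suc X by (simp del: pow_mat.simps add_Suc upt_Suc add: upt_Suc_append)
  qed simp
  from this[of "k - Suc (degree p)"] show ?thesis using assms by (simp add: poly_mat_def)
qed

lemma poly_mat_carrier [simp]:
  "X \<in> carrier_mat n n \<Longrightarrow> poly_mat p X \<in> carrier_mat n n"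
  using foldr_poly_mat_carrier[of X n] poly_mat_upt[of X n p "Suc (degree p)"] by (metis lessI)

lemma poly_mat_0: "X \<in> carrier_mat n n \<Longrightarrow> poly_mat 0 X = 0\<^sub>m n n"
  unfolding poly_mat_def by auto

text \<open>Horner's scheme. It replaces the \<open>foldr\<close> definition by a recursion along
  \<open>pCons\<close>, from which all homomorphism laws follow by induction on the
  polynomial.\<close>

lemma poly_mat_pCons:
  assumes X: "X \<in> carrier_mat n n"
  shows "poly_mat (pCons a p) X = a \<cdot>\<^sub>m 1\<^sub>m n + X * poly_mat p X"
proof -
  have "poly_mat (pCons a p) X = foldr (\<lambda>i acc. coeff (pCons a p) i \<cdot>\<^sub>m (X ^\<^sub>m i) + acc) [0..<Suc (Suc (degree p))] (0\<^sub>m n n)"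
    by (rule poly_mat_upt[OF X]) (auto simp: degree_pCons_eq_if)
  also have "[0..<Suc (Suc (degree p))] = 0 # map Suc [0..<Suc (degree p)]"
    by (subst upt_conv_Cons) (auto simp del: upt_Suc simp: map_Suc_upt)
  also have "foldr (\<lambda>i acc. coeff (pCons a p) i \<cdot>\<^sub>m (X ^\<^sub>m i) + acc) (0 # map Suc [0..<Suc (degree p)]) (0\<^sub>m n n)
     = a \<cdot>\<^sub>m 1\<^sub>m n + foldr (\<lambda>i acc. coeff (pCons a p) i \<cdot>\<^sub>m (X ^\<^sub>m i) + acc) (map Suc [0..<Suc (degree p)]) (0\<^sub>m n n)"
    using X by simp
  also have "foldr (\<lambda>i acc. coeff (pCons a p) i \<cdot>\<^sub>m (X ^\<^sub>m i) + acc) (map Suc xs) (0\<^sub>m n n)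
    = foldr (\<lambda>i acc. coeff p (i-1) \<cdot>\<^sub>m (X ^\<^sub>m i) + acc) (map Suc xs) (0\<^sub>m n n)" for xs
    by (induct xs) auto
  also have "foldr (\<lambda>i acc. coeff p (i-1) \<cdot>\<^sub>m (X ^\<^sub>m i) + acc) (map Suc [0..<Suc (degree p)]) (0\<^sub>m n n)
    = X * poly_mat p X"
    by (simp only: foldr_poly_mat_shift[OF X, symmetric] poly_mat_upt[OF X lessI])
  finally show ?thesis .
qed

lemma poly_mat_add:
  assumes X: "X \<in> carrier_mat n n"
  shows "poly_mat (p + q) X = poly_mat p X + poly_mat q X"
proof (induct p q rule: poly_induct2)
  case 0
  then show ?case using X by (simp add: poly_mat_0[OF X])
next
  case (pCons a p b q)
  let ?P = "poly_mat p X" and ?Q = "poly_mat q X"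
  have "(a + b) \<cdot>\<^sub>m 1\<^sub>m n + X * (?P + ?Q) = (a \<cdot>\<^sub>m 1\<^sub>m n + X * ?P) + (b \<cdot>\<^sub>m 1\<^sub>m n + X * ?Q)"
    using X by (subst mult_add_distrib_mat[of _ n n _ n])
      (auto intro!: eq_matI simp: algebra_simps carrier_matD[OF poly_mat_carrier[OF X]])
  then show ?case using pCons by (simp add: poly_mat_pCons[OF X])
qed

lemma poly_mat_smult:
  assumes X: "X \<in> carrier_mat n n"
  shows "poly_mat (Polynomial.smult c p) X = c \<cdot>\<^sub>m poly_mat p X"
proof (induct p)
  case 0
  then show ?case using X by (simp add: poly_mat_0[OF X])
next
  case (pCons a p)
  let ?P = "poly_mat p X"
  have "(c * a) \<cdot>\<^sub>m 1\<^sub>m n + X * (c \<cdot>\<^sub>m ?P) = c \<cdot>\<^sub>m (a \<cdot>\<^sub>m 1\<^sub>m n + X * ?P)"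
    using X by (subst mult_smult_distrib[of _ n n _ n])
      (auto intro!: eq_matI simp: algebra_simps carrier_matD[OF poly_mat_carrier[OF X]])
  then show ?case using pCons by (simp add: poly_mat_pCons[OF X])
qed

lemma poly_mat_mult:
  assumes X: "X \<in> carrier_mat n n"
  shows "poly_mat (p * q) X = poly_mat p X * poly_mat q X"
proof (induct p)
  case 0
  have "0\<^sub>m n n * poly_mat q X = 0\<^sub>m n n" using X by (intro left_mult_zero_mat) simp
  then show ?case using X by (simp add: poly_mat_0[OF X])
next
  case (pCons a p)
  let ?P = "poly_mat p X" and ?Q = "poly_mat q X"
  have [simp]: "?P \<in> carrier_mat n n" "?Q \<in> carrier_mat n n" using X by auto
  have z: "(0 :: complex) \<cdot>\<^sub>m 1\<^sub>m n = 0\<^sub>m n n" by auto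
  have XP: "X * ?P \<in> carrier_mat n n" using X by (intro mult_carrier_mat[of _ n n]) auto
  have XPQ: "X * (?P * ?Q) = X * ?P * ?Q" by (rule assoc_mult_mat[symmetric, of _ n n _ n _ n]) (use X in auto)
  have "X * (?P * ?Q) \<in> carrier_mat n n" using X by (intro mult_carrier_mat[of _ n n]) auto
  then have "0\<^sub>m n n + X * (?P * ?Q) = X * (?P * ?Q)"
    by (rule left_add_zero_mat)
  moreover have "a \<cdot>\<^sub>m 1\<^sub>m n * ?Q = a \<cdot>\<^sub>m ?Q"
    using mult_smult_assoc_mat[of "1\<^sub>m n" n n ?Q n a] left_mult_one_mat[OF poly_mat_carrier[OF X, of q]] by simp
  ultimately have "a \<cdot>\<^sub>m ?Q + (0 \<cdot>\<^sub>m 1\<^sub>m n + X * (?P * ?Q)) = (a \<cdot>\<^sub>m 1\<^sub>m n + X * ?P) * ?Q"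
    using X XP by (subst add_mult_distrib_mat[of _ n n _ _ n]) (auto simp: XPQ[symmetric] z)
  then show ?case using pCons by (simp add: poly_mat_pCons[OF X] poly_mat_add[OF X] poly_mat_smult[OF X])
qed

lemma smult_1_mat [simp]: "(1 :: 'a :: monoid_mult) \<cdot>\<^sub>m A = A"
  by (intro eq_matI) auto

lemma poly_mat_const: "X \<in> carrier_mat n n \<Longrightarrow> poly_mat [:c:] X = c \<cdot>\<^sub>m 1\<^sub>m n"
  by (simp add: poly_mat_pCons[of X n] poly_mat_0)

lemma poly_mat_1: "X \<in> carrier_mat n n \<Longrightarrow> poly_mat 1 X = 1\<^sub>m n"
  using poly_mat_const[of X n 1] by (simp add: pCons_one)

lemma poly_mat_X:
  assumes X: "X \<in> carrier_mat n n" shows "poly_mat [:c, 1:] X = c \<cdot>\<^sub>m 1\<^sub>m n + X"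
  using X by (simp add: poly_mat_pCons[OF X] poly_mat_0[OF X] mult_smult_distrib[of _ n n _ n])

lemma mult_scalar_mat_vec:
  fixes v :: "complex vec"
  assumes "v \<in> carrier_vec n" shows "(c \<cdot>\<^sub>m 1\<^sub>m n) *\<^sub>v v = c \<cdot>\<^sub>v v"
  using assms by (intro eq_vecI) (auto simp: row_smult smult_scalar_prod_distrib[of _ n])

lemma poly_mat_eigenvector:
  assumes X: "X \<in> carrier_mat n n" and v: "v \<in> carrier_vec n" and e: "X *\<^sub>v v = \<mu> \<cdot>\<^sub>v v"
  shows "poly_mat p X *\<^sub>v v = poly p \<mu> \<cdot>\<^sub>v v"
proof (induct p)
  case 0
  then show ?case using X v by (simp add: poly_mat_0[OF X]) auto
next
  case (pCons a p)
  let ?P = "poly_mat p X"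
  have "(a \<cdot>\<^sub>m 1\<^sub>m n + X * ?P) *\<^sub>v v = a \<cdot>\<^sub>v v + X *\<^sub>v (?P *\<^sub>v v)"
    using X v by (subst add_mult_distrib_mat_vec[of _ n n])
      (auto simp: mult_scalar_mat_vec assoc_mult_mat_vec[of _ n n _ n])
  also have "\<dots> = a \<cdot>\<^sub>v v + poly p \<mu> \<cdot>\<^sub>v (\<mu> \<cdot>\<^sub>v v)"
    using X v e by (simp add: pCons mult_mat_vec[of _ n n])
  also have "\<dots> = (a + \<mu> * poly p \<mu>) \<cdot>\<^sub>v v"
    using v by (auto simp: algebra_simps)
  finally show ?case by (simp add: poly_mat_pCons[OF X])
qed

lemma mat_vec_eqI:
  fixes A B :: "complex mat"
  assumes "A \<in> carrier_mat n m" "B \<in> carrier_mat n m"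
    and "\<And>v. v \<in> carrier_vec m \<Longrightarrow> A *\<^sub>v v = B *\<^sub>v v"
  shows "A = B"
proof (rule mat_col_eqI)
  fix i assume "i < dim_col B"
  then have i: "i < m" using assms by auto
  have "col A i = A *\<^sub>v unit_vec m i" "col B i = B *\<^sub>v unit_vec m i"
    using assms(1,2) i by (auto intro!: eq_vecI)
  then show "col A i = col B i" using assms(3) by simp
qed (use assms in auto)

text \<open>Each factor \<open>T - T $$ (k,k)\<close> maps vectors supported on the first
  \<open>k + 1\<close> coordinates to vectors supported on the first \<open>k\<close>; applying the
  factors from the last to the first shrinks the support to nothing.\<close>

lemma upper_triangular_poly_mat_kills:
  assumes T: "T \<in> carrier_mat n n" and ut: "upper_triangular T"
  shows "k \<le> n \<Longrightarrow> v \<in> carrier_vec n \<Longrightarrow> (\<And>i. i < n \<Longrightarrow> k \<le> i \<Longrightarrow> v $ i = 0) \<Longrightarrow>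
    poly_mat (\<Prod>i\<leftarrow>[0..<k]. [:- (T $$ (i,i)), 1:]) T *\<^sub>v v = 0\<^sub>v n"
proof (induct k arbitrary: v)
  case 0
  then have "v = 0\<^sub>v n" by auto
  then show ?case using T by (simp add: poly_mat_1[OF T])
next
  case (Suc k)
  let ?t = "T $$ (k,k)" and ?q = "\<Prod>i\<leftarrow>[0..<k]. [:- (T $$ (i,i)), 1:]"
  let ?w = "poly_mat [:-?t, 1:] T *\<^sub>v v"
  have w: "?w \<in> carrier_vec n" using T Suc.prems by (intro mult_mat_vec_carrier) auto
  have we: "?w = - ?t \<cdot>\<^sub>v v + T *\<^sub>v v"
    using T Suc.prems by (simp add: poly_mat_X[OF T] add_mult_distrib_mat_vec[of _ n n] mult_scalar_mat_vec)
  \<comment> \<open>In row \<open>i\<close> with \<open>k <= i\<close>, entries left of column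
    \<open>k\<close> lie below the diagonal and entries of \<open>v\<close> right of
    \<open>k\<close> vanish, so only \<open>v $ k\<close> contributes; subtracting the diagonal
    entry removes it when \<open>i = k\<close>.\<close>
  have "?w $ i = 0" if i: "i < n" "k \<le> i" for i
  proof -
    have "(T *\<^sub>v v) $ i = (\<Sum>j\<in>{0..<n}. T $$ (i,j) * v $ j)"
      using T Suc.prems i by (auto simp: scalar_prod_def)
    also have "\<dots> = (\<Sum>j\<in>{0..<n}. if j = k then T $$ (i,k) * v $ k else 0)"
    proof (rule sum.cong)
      fix j assume "j \<in> {0..<n}"
      then show "T $$ (i,j) * v $ j = (if j = k then T $$ (i,k) * v $ k else 0)"
        using Suc.prems(3)[of j] upper_triangularD[OF ut, of j i] T i by (cases "j < k"; cases "j = k") auto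
    qed simp
    also have "\<dots> = T $$ (i,k) * v $ k" using Suc.prems(1) by simp
    finally have "(T *\<^sub>v v) $ i = T $$ (i,k) * v $ k" .
    then have "?w $ i = (T $$ (i,k) - ?t) * v $ i \<or> i \<noteq> k \<and> ?w $ i = T $$ (i,k) * v $ k - ?t * v $ i"
      unfolding we using T Suc.prems i by (auto simp: algebra_simps)
    then show ?thesis
      using upper_triangularD[OF ut, of k i] T i Suc.prems(3)[of i] by (cases "i = k") auto
  qed
  then have "poly_mat ?q T *\<^sub>v ?w = 0\<^sub>v n" using Suc w by auto
  moreover have "poly_mat (?q * [:-?t,1:]) T *\<^sub>v v = poly_mat ?q T *\<^sub>v ?w"
    unfolding poly_mat_mult[OF T] using T Suc.prems by (intro assoc_mult_mat_vec[of _ n n]) auto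
  ultimately show ?case by simp
qed

lemma poly_mat_similar:
  assumes X: "X \<in> carrier_mat n n" and Y: "Y \<in> carrier_mat n n" and P: "P \<in> carrier_mat n n"
    and e: "X * P = P * Y"
  shows "poly_mat p X * P = P * poly_mat p Y"
proof (induct p)
  case 0
  then show ?case using assms by (simp add: poly_mat_0[OF X] poly_mat_0[OF Y])
next
  case (pCons a p)
  have [simp]: "poly_mat p X \<in> carrier_mat n n" "poly_mat p Y \<in> carrier_mat n n" using assms by auto
  have "X * poly_mat p X * P = X * (poly_mat p X * P)" using assms by (simp add: assoc_mult_mat[of _ n n _ n _ n])
  also have "\<dots> = (X * P) * poly_mat p Y" unfolding pCons
    by (rule assoc_mult_mat[symmetric, of _ n n _ n _ n]) (use assms in auto)
  also have "\<dots> = P * (Y * poly_mat p Y)" unfolding e using assms by (simp add: assoc_mult_mat[of _ n n _ n _ n])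
  finally have "X * poly_mat p X * P = P * (Y * poly_mat p Y)" .
  moreover have "a \<cdot>\<^sub>m 1\<^sub>m n * P = P * (a \<cdot>\<^sub>m 1\<^sub>m n)"
    using P by (simp add: mult_smult_assoc_mat[of _ n n _ n] mult_smult_distrib[of _ n n _ n])
  ultimately show ?case using assms
    by (simp add: poly_mat_pCons[OF X] poly_mat_pCons[OF Y] add_mult_distrib_mat[of _ n n _ _ n] mult_add_distrib_mat[of _ n n _ n])
qed

text \<open>A Schur decomposition supplies an upper triangular \<open>T\<close> whose diagonal lists
  the roots of the characteristic polynomial, so all coordinates are killed for \<open>T\<close>;
  similarity carries this back to \<open>X\<close>.\<close>

theorem cayley_hamilton:
  fixes X :: "complex mat"
  assumes X: "X \<in> carrier_mat n n"
  shows "poly_mat (char_poly X) X = 0\<^sub>m n n"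
proof -
  obtain es where es: "char_poly X = (\<Prod>e\<leftarrow>es. [:- e, 1:])" using char_poly_factorized[OF X] by blast
  obtain T P Q where "schur_decomposition X es = (T, P, Q)" by (cases "schur_decomposition X es")
  from schur_decomposition[OF X es this] have s: "similar_mat_wit X T P Q" and ut: "upper_triangular T"
    and d: "diag_mat T = es" by auto
  note s = similar_mat_witD2[OF X s]
  from s have T: "T \<in> carrier_mat n n" and P: "P \<in> carrier_mat n n" and Q: "Q \<in> carrier_mat n n"
    and PQ: "P * Q = 1\<^sub>m n" and QP: "Q * P = 1\<^sub>m n" and XT: "X = P * T * Q" by auto
  have es': "es = map (\<lambda>i. T $$ (i,i)) [0..<n]" using d T by (auto simp: diag_mat_def)
  let ?p = "char_poly X"
  have p: "?p = (\<Prod>i\<leftarrow>[0..<n]. [:- (T $$ (i,i)), 1:])" unfolding es es' by (simp add: o_def)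
  have "poly_mat ?p T = 0\<^sub>m n n"
  proof (rule mat_vec_eqI[of _ n n])
    fix v :: "complex vec" assume "v \<in> carrier_vec n"
    then show "poly_mat ?p T *\<^sub>v v = 0\<^sub>m n n *\<^sub>v v"
      unfolding p by (subst upper_triangular_poly_mat_kills[OF T ut]) auto
  qed (use T in auto)
  moreover have "X * P = P * T" unfolding XT using P Q T QP by (simp add: assoc_mult_mat[of _ n n _ n _ n])
  ultimately have "poly_mat ?p X * P = 0\<^sub>m n n"
    using poly_mat_similar[OF X T P] P by simp
  then have "poly_mat ?p X * P * Q = 0\<^sub>m n n" using Q by simp
  then have "poly_mat ?p X * 1\<^sub>m n = 0\<^sub>m n n" using X P Q PQ by (simp add: assoc_mult_mat[of _ n n _ n _ n])
  then show ?thesis using right_mult_one_mat[OF poly_mat_carrier[OF X]] by simp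
qed


section \<open>Root multiplicities, derivatives and Hermite interpolation\<close>

lemma deriv_poly: "deriv (poly p) = poly (pderiv p)" for p :: "complex poly"
  by (rule ext) (auto intro!: DERIV_imp_deriv poly_DERIV)

lemma higher_deriv_poly: "(deriv ^^ i) (poly p) = poly ((pderiv ^^ i) p)" for p :: "complex poly"
  by (induct i) (auto simp: deriv_poly)

lemma higher_pderiv_add: "(pderiv ^^ i) (p + q) = (pderiv ^^ i) p + (pderiv ^^ i) q"
  by (induct i) (auto simp: pderiv_add)

lemma higher_pderiv_smult: "(pderiv ^^ i) (Polynomial.smult c p) = Polynomial.smult c ((pderiv ^^ i) p)"
  by (induct i) (auto simp: pderiv_smult)

text \<open>The multiplicity of a root counts the vanishing derivatives. This is the bridge between
  the derivative conditions in \<open>mat_fun\<close> and divisibility by the characteristic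
  polynomial.\<close>

lemma order_higher_pderiv:
  fixes p :: "complex poly"
  assumes "p \<noteq> 0"
  shows "(\<forall>i < Polynomial.order z p. poly ((pderiv ^^ i) p) z = 0) \<and>
    poly ((pderiv ^^ Polynomial.order z p) p) z \<noteq> 0"
  using assms
proof (induct "Polynomial.order z p" arbitrary: p)
  case 0
  then show ?case using order_root[of p z] by auto
next
  case (Suc k)
  have z: "poly p z = 0" using Suc.hyps(2) Suc.prems order_root[of p z] by auto
  have p': "pderiv p \<noteq> 0"
  proof
    assume "pderiv p = 0"
    then obtain c where "p = [:c:]" using pderiv_iszero by blast
    then show False using z Suc.prems by auto
  qed
  have o: "Polynomial.order z p = Suc (Polynomial.order z (pderiv p))"
    using order_pderiv[of p z] p' z Suc by (metis order_root)
  have IH: "(\<forall>i < k. poly ((pderiv ^^ i) (pderiv p)) z = 0) \<and> poly ((pderiv ^^ k) (pderiv p)) z \<noteq> 0"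
    using Suc.hyps(1)[of "pderiv p"] p' o Suc.hyps(2) by auto
  have sh: "(pderiv ^^ Suc i) p = (pderiv ^^ i) (pderiv p)" for i by (simp add: funpow_swap1)
  show ?case
    unfolding Suc.hyps(2)[symmetric] sh
  proof (intro conjI allI impI)
    fix i assume "i < Suc k"
    then show "poly ((pderiv ^^ i) p) z = 0" using z IH sh by (cases i) (auto simp del: funpow.simps(2))
  qed (use IH in auto)
qed

lemma order_le_of_higher_pderiv:
  fixes p :: "complex poly"
  assumes "p \<noteq> 0" "\<And>i. i < m \<Longrightarrow> poly ((pderiv ^^ i) p) z = 0"
  shows "m \<le> Polynomial.order z p"
  using order_higher_pderiv[OF assms(1), of z] assms(2) by (meson not_le)

lemma dvd_of_order_le:
  fixes c d :: "complex poly"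
  assumes "c \<noteq> 0" "d \<noteq> 0" "\<And>z. Polynomial.order z c \<le> Polynomial.order z d"
  shows "c dvd d"
  using assms
proof (induct "degree c" arbitrary: c d)
  case 0
  then show ?case using is_unit_iff_degree[of c] unit_imp_dvd[of c d] by simp
next
  case (Suc k)
  have "\<not> constant (poly c)" using Suc.hyps(2)[symmetric] by (simp add: constant_degree)
  from Fundamental_Theorem_Algebra.fundamental_theorem_of_algebra[OF this] obtain z where z: "poly c z = 0" ..
  then have "Polynomial.order z c \<noteq> 0" using Suc.prems(1) order_root[of c z] by metis
  then have "Polynomial.order z d \<noteq> 0" using Suc.prems(3)[of z] by linarith
  then have "poly d z = 0" using order_root[of d z] by metis
  then obtain d' where d: "d = [:-z,1:] * d'" unfolding poly_eq_0_iff_dvd by (rule dvdE)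
  from z obtain c' where c: "c = [:-z,1:] * c'" unfolding poly_eq_0_iff_dvd by (rule dvdE)
  have nz: "c' \<noteq> 0" "d' \<noteq> 0" using c d Suc.prems by auto
  have "Polynomial.order w c' \<le> Polynomial.order w d'" for w
  proof -
    have "Polynomial.order w c = Polynomial.order w [:-z,1:] + Polynomial.order w c'"
      unfolding c by (rule order_mult) (use Suc.prems(1) c in metis)
    moreover have "Polynomial.order w d = Polynomial.order w [:-z,1:] + Polynomial.order w d'"
      unfolding d by (rule order_mult) (use Suc.prems(2) d in metis)
    ultimately show ?thesis using Suc.prems(3)[of w] by linarith
  qed
  moreover have "degree c = Suc (degree c')" unfolding c using nz(1) by (subst degree_mult_eq) auto
  ultimately have "c' dvd d'" using Suc.hyps nz by auto
  then show ?case unfolding c d by (rule mult_dvd_mono[OF dvd_refl])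
qed

lemma order_linear_power: "Polynomial.order z ([:- w, 1:] ^ k) = (if z = w then k else 0)" for z w :: complex
proof (cases "z = w")
  case False
  then have "poly ([:- w, 1:] ^ k) z \<noteq> 0" by (simp add: poly_power)
  then show ?thesis using False by (simp add: order_0I)
qed (simp add: order_power_n_n)

lemma order_prod_linear_powers:
  fixes S :: "complex set"
  assumes "finite S"
  shows "Polynomial.order z (\<Prod>w\<in>S. [:- w, 1:] ^ m w) = (if z \<in> S then m z else 0)"
  using assms
proof (induct S)
  case (insert a S)
  have nz: "(\<Prod>w\<in>S. [:- w, 1:] ^ m w) \<noteq> 0" "[:- a, 1:] ^ m a \<noteq> 0" by (auto simp: insert.hyps)
  then have "[:- a, 1:] ^ m a * (\<Prod>w\<in>S. [:- w, 1:] ^ m w) \<noteq> 0" by (simp only: mult_eq_0_iff) auto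
  then show ?case using insert by (auto simp: order_mult order_linear_power)
qed auto

text \<open>Newton's scheme: induction on the total number of conditions, where one further
  derivative at one node is corrected without disturbing the conditions already met.\<close>

lemma hermite_interpolation:
  fixes c :: "complex \<Rightarrow> nat \<Rightarrow> complex"
  assumes "finite S"
  shows "\<exists>p. \<forall>z\<in>S. \<forall>i < m z. poly ((pderiv ^^ i) p) z = c z i"
proof (induct "sum m S" arbitrary: m)
  case 0
  then show ?case using assms by auto
next
  case (Suc k)
  then obtain z0 where z0: "z0 \<in> S" "m z0 > 0" by (metis bot_nat_0.not_eq_extremum sum.neutral nat.distinct(1))
  define m' where "m' = m(z0 := m z0 - 1)"
  have "sum m S = m z0 + sum m (S - {z0})" "sum m' S = m' z0 + sum m' (S - {z0})"
    using assms z0 by (auto intro: sum.remove)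
  moreover have "sum m' (S - {z0}) = sum m (S - {z0})" by (intro sum.cong) (auto simp: m'_def)
  ultimately have "k = sum m' S" using Suc.hyps(2) z0 by (simp add: m'_def)
  from Suc.hyps(1)[OF this] obtain p where p: "\<forall>z\<in>S. \<forall>i < m' z. poly ((pderiv ^^ i) p) z = c z i" by blast
  \<comment> \<open>\<open>N\<close> vanishes to order \<open>m' z\<close> at every node
    \<open>z\<close>, so adding a multiple of it keeps all earlier conditions, while its derivative
    of order \<open>m' z0\<close> at \<open>z0\<close> is nonzero and can be scaled to the missing
    value.\<close>
  define N where "N = (\<Prod>w\<in>S. [:- w, 1:] ^ m' w)"
  have N0: "N \<noteq> 0" unfolding N_def by (simp add: assms)
  have oN: "Polynomial.order z N = m' z" if "z \<in> S" for z
    using order_prod_linear_powers[OF assms, of z m'] that by (simp add: N_def)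
  note oN' = order_higher_pderiv[OF N0]
  define e where "e = poly ((pderiv ^^ m' z0) N) z0"
  have e0: "e \<noteq> 0" using oN'[of z0] oN[OF z0(1)] by (simp add: e_def)
  define a where "a = (c z0 (m' z0) - poly ((pderiv ^^ m' z0) p) z0) / e"
  have "poly ((pderiv ^^ i) (p + Polynomial.smult a N)) z = c z i" if "z \<in> S" "i < m z" for z i
  proof (cases "i < m' z")
    case True
    then show ?thesis using p oN'[of z] oN[OF that(1)] that by (simp add: higher_pderiv_add higher_pderiv_smult)
  next
    case False
    then have "z = z0" "i = m' z0" using that by (auto simp: m'_def split: if_splits)
    then show ?thesis using e0 by (simp add: higher_pderiv_add higher_pderiv_smult a_def e_def[symmetric])
  qed
  then show ?case by blast
qed

section \<open>The functional calculus: independence of the interpolant, products, locality,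
  continuity\<close>

definition interpolates :: "(complex \<Rightarrow> complex) \<Rightarrow> complex mat \<Rightarrow> complex poly \<Rightarrow> bool" where
  "interpolates f X p \<longleftrightarrow> (\<forall>z. \<forall>i < Polynomial.order z (char_poly X). (deriv ^^ i) (poly p) z = (deriv ^^ i) f z)"

lemma char_poly_nonzero: "X \<in> carrier_mat n n \<Longrightarrow> char_poly X \<noteq> 0" for X :: "complex mat"
  using degree_monic_char_poly by force

lemma interpolates_exists:
  assumes "X \<in> carrier_mat n n" shows "\<exists>p. interpolates f X p"
proof -
  have "finite {z. poly (char_poly X) z = 0}" using char_poly_nonzero[OF assms] poly_roots_finite by blast
  from hermite_interpolation[OF this, of "\<lambda>z. Polynomial.order z (char_poly X)" "\<lambda>z i. (deriv ^^ i) f z"]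
  obtain p where "\<forall>z\<in>{z. poly (char_poly X) z = 0}. \<forall>i<Polynomial.order z (char_poly X). poly ((pderiv ^^ i) p) z = (deriv ^^ i) f z" by blast
  then have "interpolates f X p" unfolding interpolates_def higher_deriv_poly
    using order_root[of "char_poly X"] by (metis (mono_tags, lifting) mem_Collect_eq not_less0)
  then show ?thesis ..
qed

text \<open>Two interpolants agree at each eigenvalue up to its algebraic multiplicity, so their
  difference is a multiple of the characteristic polynomial and vanishes at \<open>X\<close> by
  Cayley-Hamilton. Hence the choice inside \<open>mat_fun\<close> does not matter.\<close>

lemma interpolates_unique:
  assumes X: "X \<in> carrier_mat n n" and "interpolates f X p" "interpolates f X q"
  shows "poly_mat p X = poly_mat q X"
proof -
  define d where "d = p + Polynomial.smult (-1) q"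
  have d0: "poly ((pderiv ^^ i) d) z = 0" if "i < Polynomial.order z (char_poly X)" for z i
    using assms that unfolding interpolates_def d_def higher_deriv_poly higher_pderiv_add higher_pderiv_smult
    by simp
  have "char_poly X dvd d"
  proof (cases "d = 0")
    case False
    show ?thesis
      by (rule dvd_of_order_le[OF char_poly_nonzero[OF X] False]) (rule order_le_of_higher_pderiv[OF False d0])
  qed simp
  then obtain e where "d = char_poly X * e" by (rule dvdE)
  then have "poly_mat d X = 0\<^sub>m n n"
    using X by (simp add: poly_mat_mult[OF X] cayley_hamilton[OF X] left_mult_zero_mat[OF poly_mat_carrier[OF X]])
  then have "poly_mat p X + (-1) \<cdot>\<^sub>m poly_mat q X = 0\<^sub>m n n"
    by (simp only: d_def poly_mat_add[OF X] poly_mat_smult[OF X])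
  then have e: "(poly_mat p X + (-1) \<cdot>\<^sub>m poly_mat q X) $$ (i,j) = 0" if "i < n" "j < n" for i j
    using that by simp
  have [simp]: "poly_mat p X \<in> carrier_mat n n" "poly_mat q X \<in> carrier_mat n n" using X by auto
  show ?thesis
    by (rule eq_matI) (use e carrier_matD[OF poly_mat_carrier[OF X]] in \<open>auto\<close>)
qed

lemma mat_fun_eq:
  assumes "X \<in> carrier_mat n n" "interpolates f X p"
  shows "mat_fun f X = poly_mat p X"
  unfolding mat_fun_def interpolates_def[symmetric]
  by (rule some_equality) (use assms interpolates_unique in blast)+

lemma mat_fun_carrier [simp]:
  "X \<in> carrier_mat n n \<Longrightarrow> mat_fun f X \<in> carrier_mat n n"
  using interpolates_exists mat_fun_eq poly_mat_carrier by metis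

lemma mat_fun_poly: "X \<in> carrier_mat n n \<Longrightarrow> mat_fun (poly p) X = poly_mat p X"
  by (rule mat_fun_eq) (auto simp: interpolates_def)

lemma mat_fun_eigenvector:
  assumes X: "X \<in> carrier_mat n n" and v: "v \<in> carrier_vec n" and e: "X *\<^sub>v v = \<mu> \<cdot>\<^sub>v v"
  shows "mat_fun f X *\<^sub>v v = f \<mu> \<cdot>\<^sub>v v"
proof (cases "v = 0\<^sub>v n")
  case True
  then show ?thesis using X carrier_matD[OF mat_fun_carrier[OF X]] by (auto intro!: eq_vecI)
next
  case False
  then have "eigenvalue X \<mu>" unfolding eigenvalue_def eigenvector_def using assms by auto
  then have "poly (char_poly X) \<mu> = 0" using eigenvalue_root_char_poly[OF X] by simp
  then have "0 < Polynomial.order \<mu> (char_poly X)" using order_root char_poly_nonzero[OF X] by blast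
  moreover obtain p where p: "interpolates f X p" using interpolates_exists[OF X] by blast
  ultimately have "poly p \<mu> = f \<mu>" unfolding interpolates_def by (metis funpow_0)
  then show ?thesis using mat_fun_eq[OF X p] poly_mat_eigenvector[OF X v e] by simp
qed

text \<open>Leibniz rule: the derivative of order \<open>i\<close> of a product involves only
  derivatives of order at most \<open>i\<close> of the factors, and these agree. Holomorphy on an
  open set around the spectrum makes the rule available for \<open>f\<close> and
  \<open>g\<close>.\<close>

lemma interpolates_mult:
  assumes "open S" "f holomorphic_on S" "g holomorphic_on S"
    and "\<And>z. poly (char_poly X) z = 0 \<Longrightarrow> z \<in> S"
    and p: "interpolates f X p" and q: "interpolates g X q"
  shows "interpolates (\<lambda>z. f z * g z) X (p * q)"
  unfolding interpolates_def
proof (intro allI impI)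
  fix z i assume i: "i < Polynomial.order z (char_poly X)"
  then have z: "z \<in> S" using assms(4) order_root[of "char_poly X" z] by (metis not_less0)
  have ph: "poly r holomorphic_on S" for r :: "complex poly"
    by (rule holomorphic_intros)+
  have "poly (p * q) = (\<lambda>z. poly p z * poly q z)" by auto
  moreover have "(deriv ^^ j) (poly p) z = (deriv ^^ j) f z" "(deriv ^^ j) (poly q) z = (deriv ^^ j) g z"
    if "j \<le> i" for j using p q i that unfolding interpolates_def by auto
  ultimately show "(deriv ^^ i) (poly (p * q)) z = (deriv ^^ i) (\<lambda>z. f z * g z) z"
    using higher_deriv_mult[OF ph ph assms(1) z, of i p q] higher_deriv_mult[OF assms(2,3,1) z, of i]
    by (auto intro!: sum.cong)
qed

lemma mat_fun_mult:
  assumes X: "X \<in> carrier_mat n n" and "open S" "f holomorphic_on S" "g holomorphic_on S"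
    and "\<And>z. poly (char_poly X) z = 0 \<Longrightarrow> z \<in> S"
  shows "mat_fun (\<lambda>z. f z * g z) X = mat_fun f X * mat_fun g X"
proof -
  obtain p q where pq: "interpolates f X p" "interpolates g X q" using interpolates_exists[OF X] by meson
  show ?thesis
    using mat_fun_eq[OF X interpolates_mult[OF assms(2-5) pq]] mat_fun_eq[OF X pq(1)] mat_fun_eq[OF X pq(2)]
    by (simp add: poly_mat_mult[OF X])
qed

text \<open>Equality is demanded on an open set, not just at the eigenvalues, because derivatives
  enter when an eigenvalue is repeated.\<close>

lemma mat_fun_cong:
  assumes "open S" "\<And>z. z \<in> S \<Longrightarrow> f z = g z"
    and "\<And>z. poly (char_poly X) z = 0 \<Longrightarrow> z \<in> S"
  shows "mat_fun f X = mat_fun g X"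
proof -
  have "(deriv ^^ i) f z = (deriv ^^ i) g z" if "i < Polynomial.order z (char_poly X)" for z i
  proof (rule higher_deriv_cong_ev)
    have "z \<in> S" using that assms(3) order_root[of "char_poly X" z] by (metis not_less0)
    then show "\<forall>\<^sub>F x in nhds z. f x = g x" using assms(1,2) eventually_nhds by blast
  qed simp
  then have "interpolates f X = interpolates g X" unfolding interpolates_def by (auto intro!: ext)
  then show ?thesis unfolding mat_fun_def interpolates_def[symmetric] by simp
qed

text \<open>A linear functional of \<open>f(X)\<close> sees only finitely many values and derivatives of \<open>f\<close>;
  this makes the functional calculus continuous.\<close>

lemma mat_fun_functional:
  assumes X: "X \<in> carrier_mat n n"
    and add: "\<And>Y Z. Y \<in> carrier_mat n n \<Longrightarrow> Z \<in> carrier_mat n n \<Longrightarrow> \<phi> (Y + Z) = \<phi> Y + \<phi> Z"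
    and smult: "\<And>c Y. Y \<in> carrier_mat n n \<Longrightarrow> \<phi> (c \<cdot>\<^sub>m Y) = c * \<phi> Y"
  shows "\<exists>a. \<forall>f. \<phi> (mat_fun f X) = (\<Sum>z | poly (char_poly X) z = 0.
      \<Sum>i<Polynomial.order z (char_poly X). (deriv ^^ i) f z * a z i)"
proof -
  let ?R = "{z. poly (char_poly X) z = 0}" and ?o = "\<lambda>z. Polynomial.order z (char_poly X)"
  have fin: "finite ?R" using char_poly_nonzero[OF X] poly_roots_finite by blast
  have "\<exists>p. \<forall>z\<in>?R. \<forall>i < ?o z. poly ((pderiv ^^ i) p) z = (if z = w \<and> i = k then 1 else 0)" for w k
    by (rule hermite_interpolation[OF fin])
  \<comment> \<open>The polynomials \<open>e w k\<close> are dual to the Hermite conditions, so an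
    interpolant can be written down explicitly and depends linearly on the data of
    \<open>f\<close>.\<close>
  then obtain e where e: "\<And>w k z i. z \<in> ?R \<Longrightarrow> i < ?o z \<Longrightarrow>
      poly ((pderiv ^^ i) (e w k)) z = (if z = w \<and> i = k then 1 else 0)" by metis
  have d0: "(pderiv ^^ i) (0 :: complex poly) = 0" for i by (induct i) auto
  have dsum: "(pderiv ^^ i) (sum h A) = (\<Sum>x\<in>A. (pderiv ^^ i) (h x))" for i A and h :: "'z \<Rightarrow> complex poly"
    by (induct A rule: infinite_finite_induct) (auto simp: higher_pderiv_add d0)
  have phi0: "\<phi> (0\<^sub>m n n) = 0" using smult[of "0\<^sub>m n n" 0] by simp
  have phisum: "\<phi> (poly_mat (sum h A) X) = (\<Sum>x\<in>A. \<phi> (poly_mat (h x) X))" for A and h :: "'z \<Rightarrow> complex poly"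
    by (induct A rule: infinite_finite_induct) (auto simp: poly_mat_add[OF X] poly_mat_0[OF X] phi0 add X)
  show ?thesis
  proof (intro exI allI)
    fix f
    let ?p = "\<Sum>w\<in>?R. \<Sum>k<?o w. Polynomial.smult ((deriv ^^ k) f w) (e w k)"
    have "interpolates f X ?p"
      unfolding interpolates_def higher_deriv_poly
    proof (intro allI impI)
      fix z i assume i: "i < ?o z"
      then have z: "z \<in> ?R" using order_root[of "char_poly X" z] by auto
      have "poly ((pderiv ^^ i) ?p) z = (\<Sum>w\<in>?R. \<Sum>k<?o w. (deriv ^^ k) f w * (if z = w \<and> i = k then 1 else 0))"
        using e[OF z i] by (simp add: dsum higher_pderiv_smult poly_sum)
      also have "\<dots> = (\<Sum>w\<in>?R. \<Sum>k<?o w. if k = i then (if w = z then (deriv ^^ i) f z else 0) else 0)"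
        by (intro sum.cong refl) auto
      also have "\<dots> = (\<Sum>w\<in>?R. if w = z then (deriv ^^ i) f z else 0)"
        using i by (intro sum.cong refl) auto
      also have "\<dots> = (deriv ^^ i) f z" using fin z by simp
      finally show "poly ((pderiv ^^ i) ?p) z = (deriv ^^ i) f z" .
    qed
    from mat_fun_eq[OF X this]
    show "\<phi> (mat_fun f X) = (\<Sum>z\<in>?R. \<Sum>i<?o z. (deriv ^^ i) f z * \<phi> (poly_mat (e z i) X))"
      by (simp add: phisum poly_mat_smult[OF X] smult X)
  qed
qed

section \<open>Spectral theorem and singular values\<close>

lemma cscalar_prod_sum:
  fixes v w :: "complex vec"
  assumes "w \<in> carrier_vec n"
  shows "v \<bullet>c w = (\<Sum>i<n. v $ i * cnj (w $ i))"
  using assms by (simp add: scalar_prod_def lessThan_atLeast0)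

lemma cscalar_prod_add_left:
  fixes u v w :: "complex vec"
  assumes "u \<in> carrier_vec n" "v \<in> carrier_vec n" "w \<in> carrier_vec n"
  shows "(u + v) \<bullet>c w = u \<bullet>c w + v \<bullet>c w"
  using assms by (simp add: cscalar_prod_sum[of _ n] sum.distrib distrib_left distrib_right)

lemma cscalar_prod_add_right:
  fixes u v w :: "complex vec"
  assumes "u \<in> carrier_vec n" "v \<in> carrier_vec n" "w \<in> carrier_vec n"
  shows "w \<bullet>c (u + v) = w \<bullet>c u + w \<bullet>c v"
  using assms by (simp add: cscalar_prod_sum[of _ n] sum.distrib distrib_left distrib_right)

lemma cscalar_prod_smult_left:
  fixes u w :: "complex vec"
  assumes "u \<in> carrier_vec n" "w \<in> carrier_vec n"
  shows "(c \<cdot>\<^sub>v u) \<bullet>c w = c * (u \<bullet>c w)"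
  using assms by (simp add: cscalar_prod_sum[of _ n] sum_distrib_left algebra_simps)

lemma cscalar_prod_smult_right:
  fixes u w :: "complex vec"
  assumes "u \<in> carrier_vec n" "w \<in> carrier_vec n"
  shows "u \<bullet>c (c \<cdot>\<^sub>v w) = cnj c * (u \<bullet>c w)"
  using assms by (simp add: cscalar_prod_sum[of _ n] sum_distrib_left algebra_simps)

lemma cscalar_prod_commute:
  fixes u w :: "complex vec"
  assumes "u \<in> carrier_vec n" "w \<in> carrier_vec n"
  shows "cnj (u \<bullet>c w) = w \<bullet>c u"
  using assms by (simp add: cscalar_prod_sum[of _ n] algebra_simps)

lemma cscalar_prod_zero_left: "w \<in> carrier_vec n \<Longrightarrow> 0\<^sub>v n \<bullet>c w = (0 :: complex)"
  by (simp add: cscalar_prod_sum[of _ n])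

definition vnorm2 :: "complex vec \<Rightarrow> real" where
  "vnorm2 v = Re (v \<bullet>c v)"

lemma vnorm2_sum: "v \<in> carrier_vec n \<Longrightarrow> vnorm2 v = (\<Sum>i<n. (cmod (v $ i))^2)"
  unfolding vnorm2_def by (simp add: cscalar_prod_sum[of _ n] complex_norm_square[symmetric] del: complex_mult_cnj)

lemma cscalar_prod_self: "v \<in> carrier_vec n \<Longrightarrow> v \<bullet>c v = of_real (vnorm2 v)"
  by (simp add: vnorm2_sum cscalar_prod_sum[of _ n] complex_norm_square[symmetric] del: complex_mult_cnj)

lemma vnorm2_nonneg: "v \<in> carrier_vec n \<Longrightarrow> 0 \<le> vnorm2 v"
  by (simp add: vnorm2_sum sum_nonneg)

lemma vnorm2_pos: "v \<in> carrier_vec n \<Longrightarrow> v \<noteq> 0\<^sub>v n \<Longrightarrow> 0 < vnorm2 v"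
  using cscalar_prod_self[of v n] conjugate_square_eq_0_vec[of v n] vnorm2_nonneg[of v n]
  by (metis less_eq_real_def of_real_0)

lemma cauchy_schwarz_sum_cmod:
  fixes x y :: "nat \<Rightarrow> complex"
  shows "(cmod (\<Sum>i<n. x i * y i))^2 \<le> (\<Sum>i<n. (cmod (x i))^2) * (\<Sum>i<n. (cmod (y i))^2)"
proof -
  have "cmod (\<Sum>i<n. x i * y i) \<le> (\<Sum>i<n. cmod (x i) * cmod (y i))"
    by (rule order_trans[OF norm_sum]) (simp add: norm_mult)
  then have "(cmod (\<Sum>i<n. x i * y i))^2 \<le> (\<Sum>i<n. cmod (x i) * cmod (y i))^2"
    by (intro power_mono) auto
  also have "\<dots> \<le> (\<Sum>i<n. (cmod (x i))^2) * (\<Sum>i<n. (cmod (y i))^2)"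
    by (rule Cauchy_Schwarz_ineq_sum)
  finally show ?thesis .
qed

lemma cscalar_prod_cauchy_schwarz:
  assumes "u \<in> carrier_vec n" "v \<in> carrier_vec n"
  shows "(cmod (u \<bullet>c v))^2 \<le> vnorm2 u * vnorm2 v"
  using cauchy_schwarz_sum_cmod[of "\<lambda>i. u $ i" "\<lambda>i. cnj (v $ i)" n] assms
  by (simp add: cscalar_prod_sum[of _ n] vnorm2_sum)

lemma mat_adjoint_index:
  fixes A :: "complex mat"
  assumes "A \<in> carrier_mat n n" "i < n" "j < n"
  shows "mat_adjoint A $$ (i,j) = cnj (A $$ (j,i))"
  using assms unfolding mat_adjoint_def by (simp add: mat_of_rows_index)

lemma mat_adjoint_carrier [simp]:
  "A \<in> carrier_mat n n \<Longrightarrow> mat_adjoint A \<in> carrier_mat n n"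
  unfolding mat_adjoint_def by (metis carrier_matD cols_length length_map mat_of_rows_carrier(1))

lemma mat_adjoint_dim [simp]:
  "dim_row (mat_adjoint A) = dim_col A" "dim_col (mat_adjoint A) = dim_row A"
  unfolding mat_adjoint_def by auto

lemma mat_vec_index_sum:
  fixes A :: "complex mat"
  assumes "A \<in> carrier_mat n m" "v \<in> carrier_vec m" "i < n"
  shows "(A *\<^sub>v v) $ i = (\<Sum>j<m. A $$ (i,j) * v $ j)"
  using assms by (simp add: scalar_prod_def lessThan_atLeast0)

lemma adjoint_cscalar_prod:
  fixes A :: "complex mat"
  assumes A: "A \<in> carrier_mat n n" and u: "u \<in> carrier_vec n" and v: "v \<in> carrier_vec n"
  shows "(A *\<^sub>v u) \<bullet>c v = u \<bullet>c (mat_adjoint A *\<^sub>v v)"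
proof -
  have "(A *\<^sub>v u) \<bullet>c v = (\<Sum>i<n. \<Sum>j<n. A $$ (i,j) * u $ j * cnj (v $ i))"
    using assms by (simp add: cscalar_prod_sum[OF v] mat_vec_index_sum[OF A u] sum_distrib_right del: index_mult_mat_vec)
  also have "\<dots> = (\<Sum>j<n. \<Sum>i<n. A $$ (i,j) * u $ j * cnj (v $ i))" by (rule sum.swap)
  also have "\<dots> = u \<bullet>c (mat_adjoint A *\<^sub>v v)"
    using mult_mat_vec_carrier[OF mat_adjoint_carrier[OF A] v]
    by (subst cscalar_prod_sum[of _ n])
      (simp_all add: mat_vec_index_sum[OF mat_adjoint_carrier[OF A] v] mat_adjoint_index[OF A] sum_distrib_left mult_ac del: index_mult_mat_vec)
  finally show ?thesis .
qed

lemma mult_mat_index_sum: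
  fixes A :: "complex mat"
  assumes "A \<in> carrier_mat n m" "B \<in> carrier_mat m k" "i < n" "j < k"
  shows "(A * B) $$ (i,j) = (\<Sum>l<m. A $$ (i,l) * B $$ (l,j))"
  using assms by (simp add: times_mat_def scalar_prod_def lessThan_atLeast0)

lemma mat_adjoint_adjoint:
  fixes A :: "complex mat"
  assumes "A \<in> carrier_mat n n"
  shows "mat_adjoint (mat_adjoint A) = A"
proof -
  note c = mat_adjoint_carrier[OF assms] mat_adjoint_carrier[OF mat_adjoint_carrier[OF assms]]
  show ?thesis
    by (rule eq_matI) (use c(2) assms in \<open>simp_all only: carrier_matD mat_adjoint_index[OF c(1)] mat_adjoint_index[OF assms] complex_cnj_cnj\<close>)
qed

lemma adjoint_cscalar_prod':
  fixes A :: "complex mat"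
  assumes A: "A \<in> carrier_mat n n" and u: "u \<in> carrier_vec n" and v: "v \<in> carrier_vec n"
  shows "(mat_adjoint A *\<^sub>v u) \<bullet>c v = u \<bullet>c (A *\<^sub>v v)"
  using adjoint_cscalar_prod[OF mat_adjoint_carrier[OF A] u v] mat_adjoint_adjoint[OF A] by simp

lemma mat_adjoint_mult:
  fixes A B :: "complex mat"
  assumes A: "A \<in> carrier_mat n n" and B: "B \<in> carrier_mat n n"
  shows "mat_adjoint (A * B) = mat_adjoint B * mat_adjoint A"
proof (rule eq_matI)
  have AB: "A * B \<in> carrier_mat n n" using A B by (rule mult_carrier_mat)
  note c = mat_adjoint_carrier[OF A] mat_adjoint_carrier[OF B] mat_adjoint_carrier[OF AB]
  show "dim_row (mat_adjoint (A * B)) = dim_row (mat_adjoint B * mat_adjoint A)"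
    "dim_col (mat_adjoint (A * B)) = dim_col (mat_adjoint B * mat_adjoint A)"
    using c carrier_matD by auto
  fix i j assume "i < dim_row (mat_adjoint B * mat_adjoint A)" "j < dim_col (mat_adjoint B * mat_adjoint A)"
  then have ij: "i < n" "j < n" using c by auto
  have "(mat_adjoint B * mat_adjoint A) $$ (i,j) = (\<Sum>k<n. mat_adjoint B $$ (i,k) * mat_adjoint A $$ (k,j))"
    by (rule mult_mat_index_sum[OF c(2,1) ij])
  also have "\<dots> = cnj (\<Sum>k<n. A $$ (j,k) * B $$ (k,i))"
    using ij by (simp add: mat_adjoint_index[OF A] mat_adjoint_index[OF B] mult_ac)
  also have "(\<Sum>k<n. A $$ (j,k) * B $$ (k,i)) = (A * B) $$ (j,i)"
    by (rule mult_mat_index_sum[OF A B ij(2,1), symmetric])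
  finally show "mat_adjoint (A * B) $$ (i,j) = (mat_adjoint B * mat_adjoint A) $$ (i,j)"
    by (simp add: mat_adjoint_index[OF AB ij])
qed

lemma mult_mat_zero_vec: "A \<in> carrier_mat n m \<Longrightarrow> A *\<^sub>v 0\<^sub>v m = (0\<^sub>v n :: complex vec)"
  by (intro eq_vecI) (auto simp: mat_vec_index_sum[of _ n m] simp del: index_mult_mat_vec)

lemma hermitian_cscalar_prod:
  assumes "hermitian A" "A \<in> carrier_mat n n" "u \<in> carrier_vec n" "v \<in> carrier_vec n"
  shows "(A *\<^sub>v u) \<bullet>c v = u \<bullet>c (A *\<^sub>v v)"
  using adjoint_cscalar_prod[of A n u v] assms by (simp add: hermitian_def)

section \<open>Orthonormal eigenbases and simultaneous diagonalization\<close>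

text \<open>A dimension count in disguise: \<open>n - 1\<close> linear conditions in
  \<open>n\<close> unknowns, written as the other rows of a square matrix, have a nontrivial
  solution. It serves both for orthogonal complements and for intersecting spans of singular
  vectors.\<close>

lemma zero_row_kernel:
  fixes M :: "complex mat"
  assumes M: "M \<in> carrier_mat n n" and i: "i < n" and z: "\<And>j. j < n \<Longrightarrow> M $$ (i,j) = 0"
  shows "\<exists>v \<in> carrier_vec n. v \<noteq> 0\<^sub>v n \<and> M *\<^sub>v v = 0\<^sub>v n"
proof -
  have T: "transpose_mat M \<in> carrier_mat n n" using M by simp
  have "transpose_mat M *\<^sub>v unit_vec n i = 0\<^sub>v n"
    using M i z by (intro eq_vecI) auto
  moreover have "unit_vec n i \<noteq> (0\<^sub>v n :: complex vec)" using i by (metis index_unit_vec(2) index_zero_vec(1) zero_neq_one)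
  ultimately have "det (transpose_mat M) = 0" unfolding det_0_iff_vec_prod_zero[OF T]
    by (intro exI[of _ "unit_vec n i"]) auto
  then have "det M = 0" using M by (simp add: det_transpose)
  then show ?thesis unfolding det_0_iff_vec_prod_zero[OF M] by auto
qed

text \<open>The factors \<open>A - e\<close> are applied to \<open>w\<close> one after the other.
  The last vector before the result becomes zero is an eigenvector, and it never leaves
  \<open>S\<close>.\<close>

lemma invariant_set_eigenvector:
  fixes A :: "complex mat"
  assumes A: "A \<in> carrier_mat n n" and S: "S \<subseteq> carrier_vec n"
    and inv: "\<And>x e. x \<in> S \<Longrightarrow> A *\<^sub>v x + (- e) \<cdot>\<^sub>v x \<in> S"
    and w: "w \<in> S" "w \<noteq> 0\<^sub>v n" and z: "poly_mat (\<Prod>e\<leftarrow>es. [:- e, 1:]) A *\<^sub>v w = 0\<^sub>v n"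
  shows "\<exists>e u. u \<in> S \<and> u \<noteq> 0\<^sub>v n \<and> A *\<^sub>v u = e \<cdot>\<^sub>v u"
  using w z
proof (induct es arbitrary: w)
  case Nil
  then show ?case using S A by (auto simp: poly_mat_1[OF A])
next
  case (Cons e es)
  let ?q = "\<Prod>e\<leftarrow>es. [:- e, 1:]" and ?u = "A *\<^sub>v w + (- e) \<cdot>\<^sub>v w"
  have wc: "w \<in> carrier_vec n" using Cons.prems S by auto
  have ue: "poly_mat [:- e, 1:] A *\<^sub>v w = ?u"
    using A wc unfolding poly_mat_X[OF A]
    by (subst add_mult_distrib_mat_vec[of _ n n]) (auto simp: mult_scalar_mat_vec comm_add_vec[of _ n])
  show ?case
  proof (cases "?u = 0\<^sub>v n")
    case True
    have "A *\<^sub>v w = e \<cdot>\<^sub>v w"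
    proof (rule eq_vecI)
      fix i assume "i < dim_vec (e \<cdot>\<^sub>v w)"
      then have i: "i < n" using wc by simp
      have "?u $ i = 0" using True i by simp
      then show "(A *\<^sub>v w) $ i = (e \<cdot>\<^sub>v w) $ i" using i wc A by simp
    qed (use A wc in auto)
    then show ?thesis using Cons.prems by blast
  next
    case False
    have "poly_mat ?q A *\<^sub>v ?u = poly_mat (?q * [:- e, 1:]) A *\<^sub>v w"
      unfolding poly_mat_mult[OF A] ue[symmetric] using A wc by (intro assoc_mult_mat_vec[symmetric, of _ n n _ n]) auto
    also have "\<dots> = 0\<^sub>v n" using Cons.prems(3) by (simp add: mult.commute del: mult_pCons_right mult_pCons_left)
    finally show ?thesis using Cons.hyps[OF inv[OF Cons.prems(1)] False] by blast
  qed
qed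

lemma hermitian_eigenvalue_real:
  assumes "hermitian A" "A \<in> carrier_mat n n" "u \<in> carrier_vec n" "u \<noteq> 0\<^sub>v n" "A *\<^sub>v u = e \<cdot>\<^sub>v u"
  shows "e = of_real (Re e)"
proof -
  have "e * (u \<bullet>c u) = cnj e * (u \<bullet>c u)"
    using hermitian_cscalar_prod[OF assms(1,2,3,3)] assms
    by (simp add: cscalar_prod_smult_left[of _ n] cscalar_prod_smult_right[of _ n])
  moreover have "u \<bullet>c u \<noteq> 0" using assms conjugate_square_eq_0_vec[of u n] by blast
  ultimately have "cnj e = e" by simp
  then show ?thesis by (metis Reals_cnj_iff complex_is_Real_iff of_real_Re)
qed

text \<open>The orthogonal complement of the eigenvectors found so far is nonzero while
  \<open>k < n\<close>, and it is invariant because \<open>A\<close> is Hermitian; so it contains a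
  further eigenvector, which is then normalized.\<close>

lemma spectral_partial:
  assumes H: "hermitian A" and A: "A \<in> carrier_mat n n"
  shows "k \<le> n \<Longrightarrow> \<exists>v t. (\<forall>i<k. v i \<in> carrier_vec n \<and> A *\<^sub>v v i = of_real (t i) \<cdot>\<^sub>v v i) \<and>
     (\<forall>i<k. \<forall>j<k. v i \<bullet>c v j = (if i = j then 1 else 0))"
proof (induct k)
  case (Suc k)
  have "k \<le> n" using Suc.prems by simp
  from Suc.hyps[OF this] obtain v t where vt: "(\<forall>i<k. v i \<in> carrier_vec n \<and> A *\<^sub>v v i = of_real (t i) \<cdot>\<^sub>v v i) \<and>
     (\<forall>i<k. \<forall>j<k. v i \<bullet>c v j = (if i = j then 1 else 0))" by (elim exE)
  have v: "v i \<in> carrier_vec n" and ev: "A *\<^sub>v v i = of_real (t i) \<cdot>\<^sub>v v i" if "i < k" for i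
    using vt that by blast+
  have on: "v i \<bullet>c v j = (if i = j then 1 else 0)" if "i < k" "j < k" for i j
    using vt that by blast
  define S where "S = {x \<in> carrier_vec n. \<forall>i<k. x \<bullet>c v i = 0}"
  \<comment> \<open>Rows below \<open>k\<close> express orthogonality to the known eigenvectors; the
    remaining rows are zero, and at least one remains.\<close>
  define M where "M = mat n n (\<lambda>(i,j). if i < k then cnj (v i $ j) else 0)"
  have M: "M \<in> carrier_mat n n" by (simp add: M_def)
  obtain w where w: "w \<in> carrier_vec n" "w \<noteq> 0\<^sub>v n" "M *\<^sub>v w = 0\<^sub>v n"
    using zero_row_kernel[OF M, of k] Suc.prems by (auto simp: M_def)
  have "w \<bullet>c v i = 0" if "i < k" for i
  proof -
    have "(M *\<^sub>v w) $ i = (\<Sum>j<n. M $$ (i,j) * w $ j)"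
      by (rule mat_vec_index_sum[OF M w(1)]) (use that Suc.prems in simp)
    then have "w \<bullet>c v i = (M *\<^sub>v w) $ i"
      using that Suc.prems v[OF that] by (simp add: cscalar_prod_sum[of _ n] M_def mult_ac del: index_mult_mat_vec)
    then show ?thesis using w that Suc.prems by simp
  qed
  then have wS: "w \<in> S" using w by (simp add: S_def)
  have inv: "A *\<^sub>v x + (- e) \<cdot>\<^sub>v x \<in> S" if "x \<in> S" for x e
  proof -
    have x: "x \<in> carrier_vec n" using that by (simp add: S_def)
    have "(A *\<^sub>v x + (- e) \<cdot>\<^sub>v x) \<bullet>c v i = 0" if i: "i < k" for i
    proof -
      have "(A *\<^sub>v x) \<bullet>c v i = of_real (t i) * (x \<bullet>c v i)"
        using hermitian_cscalar_prod[OF H A x v[OF i]] ev[OF i] x v[OF i]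
        by (simp add: cscalar_prod_smult_right[of _ n])
      then show ?thesis using x v[OF i] A i \<open>x \<in> S\<close>
        by (subst cscalar_prod_add_left[of _ n]) (auto simp: cscalar_prod_smult_left[of _ n] S_def)
    qed
    then show ?thesis using A x by (simp add: S_def)
  qed
  obtain es where es: "char_poly A = (\<Prod>e\<leftarrow>es. [:- e, 1:])" using char_poly_factorized[OF A] by blast
  have "poly_mat (\<Prod>e\<leftarrow>es. [:- e, 1:]) A *\<^sub>v w = 0\<^sub>v n"
    unfolding es[symmetric] cayley_hamilton[OF A] using w by auto
  from invariant_set_eigenvector[OF A _ inv wS w(2) this]
  obtain e u where u: "u \<in> S" "u \<noteq> 0\<^sub>v n" "A *\<^sub>v u = e \<cdot>\<^sub>v u" by (auto simp: S_def)
  have uc: "u \<in> carrier_vec n" and uo: "\<And>i. i < k \<Longrightarrow> u \<bullet>c v i = 0" using u by (auto simp: S_def)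
  have er: "e = of_real (Re e)" by (rule hermitian_eigenvalue_real[OF H A uc u(2,3)])
  define c where "c = complex_of_real (1 / sqrt (vnorm2 u))"
  define u' where "u' = c \<cdot>\<^sub>v u"
  have u'c: "u' \<in> carrier_vec n" using uc by (simp add: u'_def)
  have cc: "cnj c = c" by (simp add: c_def)
  have "c * c * of_real (vnorm2 u) = 1"
    using vnorm2_pos[OF uc u(2)] unfolding c_def of_real_mult[symmetric] by (simp add: field_simps)
  then have u'n: "u' \<bullet>c u' = 1" using uc
    by (simp add: u'_def cscalar_prod_smult_left[of _ n] cscalar_prod_smult_right[of _ n] cscalar_prod_self[OF uc] cc mult_ac)
  have u'o: "u' \<bullet>c v i = 0" "v i \<bullet>c u' = 0" if "i < k" for i
  proof -
    show 1: "u' \<bullet>c v i = 0" using uo[OF that] uc v[OF that] by (simp add: u'_def cscalar_prod_smult_left[of _ n])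
    show "v i \<bullet>c u' = 0" using cscalar_prod_commute[OF u'c v[OF that]] 1 by simp
  qed
  have u'e: "A *\<^sub>v u' = of_real (Re e) \<cdot>\<^sub>v u'"
  proof -
    have "A *\<^sub>v u' = c \<cdot>\<^sub>v (e \<cdot>\<^sub>v u)" using u(3) uc A by (simp add: u'_def mult_mat_vec[of _ n n])
    also have "\<dots> = e \<cdot>\<^sub>v u'" by (simp add: u'_def smult_smult_assoc mult.commute)
    finally show ?thesis using er by simp
  qed
  show ?case
    by (rule exI[of _ "v(k := u')"], rule exI[of _ "t(k := Re e)"])
      (use v ev on u'c u'n u'o u'e in \<open>auto simp: less_Suc_eq\<close>)
qed auto


lemma spectral_sorted:
  assumes H: "hermitian A" and A: "A \<in> carrier_mat n n"
  obtains v t where "\<And>i. i < n \<Longrightarrow> v i \<in> carrier_vec n" "\<And>i. i < n \<Longrightarrow> A *\<^sub>v v i = of_real (t i) \<cdot>\<^sub>v v i"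
    "\<And>i j. i < n \<Longrightarrow> j < n \<Longrightarrow> v i \<bullet>c v j = (if i = j then 1 else 0)"
    "\<And>i j. i \<le> j \<Longrightarrow> j < n \<Longrightarrow> t j \<le> (t i :: real)"
proof -
  from spectral_partial[OF H A order_refl] obtain v t where
    vt: "(\<forall>i<n. v i \<in> carrier_vec n \<and> A *\<^sub>v v i = of_real (t i) \<cdot>\<^sub>v v i) \<and>
     (\<forall>i<n. \<forall>j<n. v i \<bullet>c v j = (if i = j then 1 else 0))" by (elim exE)
  define xs where "xs = sort_key (\<lambda>i. - t i) [0..<n]"
  have len: "length xs = n" by (simp add: xs_def)
  have pin: "xs ! i < n" if "i < n" for i
    using nth_mem[of i xs] that by (simp add: xs_def)
  have inj: "xs ! i = xs ! j \<longleftrightarrow> i = j" if "i < n" "j < n" for i j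
    using nth_eq_iff_index_eq[of xs i j] that by (simp add: xs_def)
  have "sorted (map (\<lambda>i. - t i) xs)" unfolding xs_def by (rule sorted_sort_key)
  then have mono: "t (xs ! j) \<le> t (xs ! i)" if "i \<le> j" "j < n" for i j
    using sorted_nth_mono[of "map (\<lambda>i. - t i) xs" i j] that len by simp
  show ?thesis
    by (rule that[of "\<lambda>i. v (xs ! i)" "\<lambda>i. t (xs ! i)"]) (use vt pin inj mono in auto)
qed

lemma mat_diag_dims [simp]: "dim_row (mat_diag n d) = n" "dim_col (mat_diag n d) = n"
  by (simp_all add: mat_diag_def)

lemma mat_diag_vec_index:
  assumes "x \<in> carrier_vec n" "i < n"
  shows "(mat_diag n d *\<^sub>v x) $ i = d i * (x $ i :: complex)"
proof -
  have "(mat_diag n d *\<^sub>v x) $ i = (\<Sum>j<n. mat_diag n d $$ (i,j) * x $ j)"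
    by (rule mat_vec_index_sum[OF _ assms]) simp
  also have "\<dots> = (\<Sum>j<n. if j = i then d i * x $ i else 0)"
    by (rule sum.cong) (use assms in \<open>auto simp: mat_diag_def\<close>)
  finally show ?thesis using assms by simp
qed

text \<open>Phrased as an identity of forms, since the later arguments evaluate forms rather than
  multiply matrices. The characteristic polynomial is recorded because \<open>eig_list\<close>, and
  with it the singular values, is defined from it.\<close>

theorem spectral_theorem:
  assumes H: "hermitian A" and A: "A \<in> carrier_mat n n"
  obtains U t where "U \<in> carrier_mat n n" "mat_adjoint U * U = 1\<^sub>m n" "U * mat_adjoint U = 1\<^sub>m n"
    "\<And>x y. x \<in> carrier_vec n \<Longrightarrow> y \<in> carrier_vec n \<Longrightarrow> (A *\<^sub>v x) \<bullet>c y =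
       (\<Sum>i<n. of_real (t i) * (mat_adjoint U *\<^sub>v x) $ i * cnj ((mat_adjoint U *\<^sub>v y) $ i))"
    "\<And>i j. i \<le> j \<Longrightarrow> j < n \<Longrightarrow> t j \<le> (t i :: real)"
    "char_poly A = (\<Prod>e\<leftarrow>map (\<lambda>i. of_real (t i)) [0..<n]. [:- e, 1:])"
proof -
  obtain v t where v: "\<And>i. i < n \<Longrightarrow> v i \<in> carrier_vec n"
    and ev: "\<And>i. i < n \<Longrightarrow> A *\<^sub>v v i = of_real (t i) \<cdot>\<^sub>v v i"
    and on: "\<And>i j. i < n \<Longrightarrow> j < n \<Longrightarrow> v i \<bullet>c v j = (if i = j then 1 else 0)"
    and mono: "\<And>i j. i \<le> j \<Longrightarrow> j < n \<Longrightarrow> t j \<le> (t i :: real)" by (rule spectral_sorted[OF H A]) blast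
  define U where "U = mat n n (\<lambda>(i,j). v j $ i)"
  have U: "U \<in> carrier_mat n n" by (simp add: U_def)
  note U' = mat_adjoint_carrier[OF U]
  have Ui: "U $$ (k,i) = v i $ k" if "k < n" "i < n" for k i using that by (simp add: U_def)
  have U'x: "(mat_adjoint U *\<^sub>v x) $ i = x \<bullet>c v i" if "i < n" "x \<in> carrier_vec n" for i x
  proof -
    have "(mat_adjoint U *\<^sub>v x) $ i = (\<Sum>k<n. mat_adjoint U $$ (i,k) * x $ k)"
      by (rule mat_vec_index_sum[OF U' that(2,1)])
    also have "\<dots> = x \<bullet>c v i" using that v[OF that(1)]
      by (simp add: cscalar_prod_sum[of _ n] mat_adjoint_index[OF U] Ui mult.commute)
    finally show ?thesis .
  qed
  have colU: "col U j = v j" if "j < n" for j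
    using that v[OF that] by (intro eq_vecI) (auto simp: U_def)
  have UU: "mat_adjoint U * U = 1\<^sub>m n"
  proof (rule eq_matI)
    fix i j assume "i < dim_row (1\<^sub>m n)" "j < dim_col (1\<^sub>m n)"
    then have ij: "i < n" "j < n" by auto
    have "(mat_adjoint U * U) $$ (i,j) = (mat_adjoint U *\<^sub>v col U j) $ i"
      using ij U carrier_matD[OF U'] by simp
    also have "\<dots> = v j \<bullet>c v i" using U'x[OF ij(1) v[OF ij(2)]] colU[OF ij(2)] by simp
    finally show "(mat_adjoint U * U) $$ (i,j) = 1\<^sub>m n $$ (i,j)" using ij on by simp
  qed (use U U' in auto)
  have UU': "U * mat_adjoint U = 1\<^sub>m n" by (rule mat_mult_left_right_inverse[OF U' U UU])
  have form: "(A *\<^sub>v x) \<bullet>c y =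
       (\<Sum>i<n. of_real (t i) * (mat_adjoint U *\<^sub>v x) $ i * cnj ((mat_adjoint U *\<^sub>v y) $ i))"
    if x: "x \<in> carrier_vec n" and y: "y \<in> carrier_vec n" for x y
  proof -
    have Ax: "A *\<^sub>v x \<in> carrier_vec n" using A x by simp
    have "U *\<^sub>v (mat_adjoint U *\<^sub>v y) = y"
      using y by (simp add: assoc_mult_mat_vec[OF U U' y, symmetric] UU')
    then have "(A *\<^sub>v x) \<bullet>c y = (A *\<^sub>v x) \<bullet>c (U *\<^sub>v (mat_adjoint U *\<^sub>v y))" by simp
    also have "\<dots> = (mat_adjoint U *\<^sub>v (A *\<^sub>v x)) \<bullet>c (mat_adjoint U *\<^sub>v y)"
      using adjoint_cscalar_prod'[OF U Ax, of "mat_adjoint U *\<^sub>v y"] U' y by simp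
    also have "\<dots> = (\<Sum>i<n. (mat_adjoint U *\<^sub>v (A *\<^sub>v x)) $ i * cnj ((mat_adjoint U *\<^sub>v y) $ i))"
      by (rule cscalar_prod_sum) (use U' y in auto)
    also have "\<dots> = (\<Sum>i<n. of_real (t i) * (mat_adjoint U *\<^sub>v x) $ i * cnj ((mat_adjoint U *\<^sub>v y) $ i))"
    proof (rule sum.cong)
      fix i assume "i \<in> {..<n}"
      then have i: "i < n" by simp
      have "(mat_adjoint U *\<^sub>v (A *\<^sub>v x)) $ i = (A *\<^sub>v x) \<bullet>c v i" by (rule U'x[OF i Ax])
      also have "\<dots> = x \<bullet>c (of_real (t i) \<cdot>\<^sub>v v i)"
        using hermitian_cscalar_prod[OF H A x v[OF i]] ev[OF i] by simp
      also have "\<dots> = of_real (t i) * (mat_adjoint U *\<^sub>v x) $ i"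
        using U'x[OF i x] cscalar_prod_smult_right[OF x v[OF i], of "of_real (t i)"] by simp
      finally show "(mat_adjoint U *\<^sub>v (A *\<^sub>v x)) $ i * cnj ((mat_adjoint U *\<^sub>v y) $ i) =
          of_real (t i) * (mat_adjoint U *\<^sub>v x) $ i * cnj ((mat_adjoint U *\<^sub>v y) $ i)" by simp
    qed simp
    finally show ?thesis .
  qed
  let ?D = "mat_diag n (\<lambda>i. complex_of_real (t i))"
  have D: "?D \<in> carrier_mat n n" by simp
  have AU: "A * U = U * ?D"
  proof (rule eq_matI)
    fix i j assume "i < dim_row (U * ?D)" "j < dim_col (U * ?D)"
    then have ij: "i < n" "j < n" using U by auto
    have "(A * U) $$ (i,j) = (A *\<^sub>v col U j) $ i" using ij A U by simp
    also have "\<dots> = of_real (t j) * U $$ (i,j)" using ev[OF ij(2)] colU[OF ij(2)] ij v[OF ij(2)] by (simp add: Ui del: index_mult_mat_vec)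
    also have "\<dots> = (U * ?D) $$ (i,j)" using ij by (simp add: mat_diag_mult_right[OF U])
    finally show "(A * U) $$ (i,j) = (U * ?D) $$ (i,j)" .
  qed (use A U in auto)
  have "A = A * (U * mat_adjoint U)" unfolding UU' using A by simp
  also have "\<dots> = A * U * mat_adjoint U" using A U U' by (simp add: assoc_mult_mat[of _ n n _ n _ n])
  finally have "A = U * ?D * mat_adjoint U" unfolding AU .
  then have "similar_mat A ?D"
    unfolding similar_mat_def similar_mat_wit_def Let_def
    using A U U' UU UU' by (intro exI[of _ U] exI[of _ "mat_adjoint U"]) auto
  then have "char_poly A = char_poly ?D" by (rule char_poly_similar)
  also have "\<dots> = (\<Prod>a\<leftarrow>diag_mat ?D. [:- a, 1:])"
    by (rule char_poly_upper_triangular[OF D]) (auto simp: mat_diag_def)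
  also have "diag_mat ?D = map (\<lambda>i. of_real (t i)) [0..<n]"
    by (auto simp: diag_mat_def mat_diag_def)
  finally show ?thesis using that[OF U UU UU' form mono] by blast
qed

lemma isometry_vnorm2:
  assumes U: "U \<in> carrier_mat n n" and UU: "mat_adjoint U * U = 1\<^sub>m n" and x: "x \<in> carrier_vec n"
  shows "vnorm2 (U *\<^sub>v x) = vnorm2 x"
proof -
  have "(U *\<^sub>v x) \<bullet>c (U *\<^sub>v x) = x \<bullet>c (mat_adjoint U *\<^sub>v (U *\<^sub>v x))"
    by (rule adjoint_cscalar_prod[OF U x]) (use U x in simp)
  also have "mat_adjoint U *\<^sub>v (U *\<^sub>v x) = x"
    using x by (simp add: assoc_mult_mat_vec[OF mat_adjoint_carrier[OF U] U x, symmetric] UU)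
  finally show ?thesis by (simp add: vnorm2_def)
qed

text \<open>First rescale an eigenbasis of \<open>P\<close> so that \<open>P\<close> becomes the
  identity form; then diagonalize \<open>Q\<close> in these coordinates by a unitary matrix, which
  leaves the identity form unchanged.\<close>

theorem simultaneous_diagonalization:
  assumes P: "P \<in> carrier_mat n n" and Pp: "pd P" and Q: "Q \<in> carrier_mat n n" and Qh: "hermitian Q"
  obtains W V t where "W \<in> carrier_mat n n" "V \<in> carrier_mat n n" "W * V = 1\<^sub>m n" "V * W = 1\<^sub>m n"
    "\<And>x y. x \<in> carrier_vec n \<Longrightarrow> y \<in> carrier_vec n \<Longrightarrow>
       (P *\<^sub>v x) \<bullet>c y = (\<Sum>i<n. (W *\<^sub>v x) $ i * cnj ((W *\<^sub>v y) $ i))"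
    "\<And>x y. x \<in> carrier_vec n \<Longrightarrow> y \<in> carrier_vec n \<Longrightarrow>
       (Q *\<^sub>v x) \<bullet>c y = (\<Sum>i<n. of_real (t i) * (W *\<^sub>v x) $ i * cnj ((W *\<^sub>v y) $ i))"
proof -
  have Ph: "hermitian P" using Pp by (simp add: pd_def)
  obtain U p where U: "U \<in> carrier_mat n n" and UU: "mat_adjoint U * U = 1\<^sub>m n" "U * mat_adjoint U = 1\<^sub>m n"
    and Pf: "\<And>x y. x \<in> carrier_vec n \<Longrightarrow> y \<in> carrier_vec n \<Longrightarrow> (P *\<^sub>v x) \<bullet>c y =
       (\<Sum>i<n. of_real (p i) * (mat_adjoint U *\<^sub>v x) $ i * cnj ((mat_adjoint U *\<^sub>v y) $ i))"
    by (rule spectral_theorem[OF Ph P]) blast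
  note U' = mat_adjoint_carrier[OF U]
  have pp: "p i > 0" if i: "i < n" for i
  proof -
    let ?e = "unit_vec n i :: complex vec"
    have e: "mat_adjoint U *\<^sub>v (U *\<^sub>v ?e) = ?e"
      by (simp add: assoc_mult_mat_vec[OF U' U, symmetric] UU)
    have Ue: "U *\<^sub>v ?e \<in> carrier_vec n" using U by simp
    have "(P *\<^sub>v (U *\<^sub>v ?e)) \<bullet>c (U *\<^sub>v ?e) = (\<Sum>j<n. if j = i then of_real (p i) else 0)"
      unfolding Pf[OF Ue Ue] e by (rule sum.cong) (use i in auto)
    also have "\<dots> = of_real (p i)" using i by simp
    finally have 1: "(P *\<^sub>v (U *\<^sub>v ?e)) \<bullet>c (U *\<^sub>v ?e) = of_real (p i)" .
    have "U *\<^sub>v ?e \<noteq> 0\<^sub>v n"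
    proof
      assume "U *\<^sub>v ?e = 0\<^sub>v n"
      then have "?e = 0\<^sub>v n" using e mult_mat_zero_vec[OF U'] by simp
      then show False using i by (metis index_unit_vec(2) index_zero_vec(1) zero_neq_one)
    qed
    then have "0 < Re ((P *\<^sub>v (U *\<^sub>v ?e)) \<bullet>c (U *\<^sub>v ?e))"
      using Pp Ue P unfolding pd_def by auto
    then show ?thesis using 1 by simp
  qed
  define W1 where "W1 = mat_diag n (\<lambda>i. complex_of_real (sqrt (p i))) * mat_adjoint U"
  define V1 where "V1 = U * mat_diag n (\<lambda>i. complex_of_real (1 / sqrt (p i)))"
  have W1: "W1 \<in> carrier_mat n n" unfolding W1_def by (rule mult_carrier_mat[OF _ U']) simp
  have V1: "V1 \<in> carrier_mat n n" unfolding V1_def by (rule mult_carrier_mat[OF U]) simp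
  note V1' = mat_adjoint_carrier[OF V1]
  have W1x: "(W1 *\<^sub>v x) $ i = of_real (sqrt (p i)) * (mat_adjoint U *\<^sub>v x) $ i"
    if "i < n" "x \<in> carrier_vec n" for i x
  proof -
    have "W1 *\<^sub>v x = mat_diag n (\<lambda>i. complex_of_real (sqrt (p i))) *\<^sub>v (mat_adjoint U *\<^sub>v x)"
      unfolding W1_def by (rule assoc_mult_mat_vec[of _ n n _ n]) (use U' that in auto)
    then show ?thesis using mat_diag_vec_index[of "mat_adjoint U *\<^sub>v x" n i] that U' by simp
  qed
  have V1W1: "V1 * W1 = 1\<^sub>m n"
  proof -
    let ?a = "mat_diag n (\<lambda>i. complex_of_real (1 / sqrt (p i)))" and ?b = "mat_diag n (\<lambda>i. complex_of_real (sqrt (p i)))"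
    have ab: "?a * ?b = 1\<^sub>m n"
      unfolding mat_diag_diag
    proof (rule eq_matI)
      fix i j assume "i < dim_row (1\<^sub>m n :: complex mat)" "j < dim_col (1\<^sub>m n :: complex mat)"
      then show "mat_diag n (\<lambda>i. complex_of_real (1 / sqrt (p i)) * complex_of_real (sqrt (p i))) $$ (i,j) = 1\<^sub>m n $$ (i,j)"
        using pp[of i] by (auto simp: mat_diag_def of_real_mult[symmetric] simp del: of_real_mult)
    qed (auto simp: mat_diag_def)
    have "V1 * W1 = U * (?a * (?b * mat_adjoint U))"
      unfolding V1_def W1_def by (rule assoc_mult_mat[OF U _ mult_carrier_mat[OF _ U'], of _ n]) simp_all
    also have "?a * (?b * mat_adjoint U) = ?a * ?b * mat_adjoint U"
      by (rule assoc_mult_mat[symmetric, of _ n n _ n _ n]) (use U' in auto)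
    finally show ?thesis unfolding ab left_mult_one_mat[OF U'] UU .
  qed
  have W1V1: "W1 * V1 = 1\<^sub>m n" by (rule mat_mult_left_right_inverse[OF V1 W1 V1W1])
  \<comment> \<open>\<open>Q1\<close> is the form of \<open>Q\<close> expressed in the coordinates
    \<open>W1 x\<close>, in which \<open>P\<close> is the standard inner product.\<close>
  define Q1 where "Q1 = mat_adjoint V1 * (Q * V1)"
  have QV: "Q * V1 \<in> carrier_mat n n" using Q V1 by (rule mult_carrier_mat)
  have Q1: "Q1 \<in> carrier_mat n n" unfolding Q1_def using V1' QV by (rule mult_carrier_mat)
  have "mat_adjoint Q1 = mat_adjoint V1 * mat_adjoint Q * V1"
    unfolding Q1_def mat_adjoint_mult[OF V1' QV] mat_adjoint_mult[OF Q V1] mat_adjoint_adjoint[OF V1] ..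
  also have "\<dots> = Q1" using Qh Q V1 V1' unfolding Q1_def hermitian_def
    by (simp add: assoc_mult_mat[of _ n n _ n _ n])
  finally have Q1h: "hermitian Q1" using Q1 by (simp add: hermitian_def)
  obtain U2 t where U2: "U2 \<in> carrier_mat n n" and UU2: "mat_adjoint U2 * U2 = 1\<^sub>m n" "U2 * mat_adjoint U2 = 1\<^sub>m n"
    and Qf: "\<And>x y. x \<in> carrier_vec n \<Longrightarrow> y \<in> carrier_vec n \<Longrightarrow> (Q1 *\<^sub>v x) \<bullet>c y =
       (\<Sum>i<n. of_real (t i) * (mat_adjoint U2 *\<^sub>v x) $ i * cnj ((mat_adjoint U2 *\<^sub>v y) $ i))"
    by (rule spectral_theorem[OF Q1h Q1]) blast
  note U2' = mat_adjoint_carrier[OF U2]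
  define W where "W = mat_adjoint U2 * W1"
  define V where "V = V1 * U2"
  have W: "W \<in> carrier_mat n n" unfolding W_def using U2' W1 by (rule mult_carrier_mat)
  have V: "V \<in> carrier_mat n n" unfolding V_def using V1 U2 by (rule mult_carrier_mat)
  have "V * W = V1 * (U2 * (mat_adjoint U2 * W1))"
    unfolding V_def W_def by (rule assoc_mult_mat[OF V1 U2 mult_carrier_mat[OF U2' W1]])
  also have "U2 * (mat_adjoint U2 * W1) = U2 * mat_adjoint U2 * W1"
    by (rule assoc_mult_mat[OF U2 U2' W1, symmetric])
  finally have VW: "V * W = 1\<^sub>m n" using V1W1 by (simp add: UU2 left_mult_one_mat[OF W1])
  have WV: "W * V = 1\<^sub>m n" by (rule mat_mult_left_right_inverse[OF V W VW])
  have Wx: "W *\<^sub>v x = mat_adjoint U2 *\<^sub>v (W1 *\<^sub>v x)" if "x \<in> carrier_vec n" for x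
    unfolding W_def by (rule assoc_mult_mat_vec[OF U2' W1 that])
  have Pform: "(P *\<^sub>v x) \<bullet>c y = (\<Sum>i<n. (W *\<^sub>v x) $ i * cnj ((W *\<^sub>v y) $ i))"
    if x: "x \<in> carrier_vec n" and y: "y \<in> carrier_vec n" for x y
  proof -
    have c: "W1 *\<^sub>v x \<in> carrier_vec n" "W1 *\<^sub>v y \<in> carrier_vec n" using W1 x y by auto
    have "(P *\<^sub>v x) \<bullet>c y = (\<Sum>i<n. (W1 *\<^sub>v x) $ i * cnj ((W1 *\<^sub>v y) $ i))"
      unfolding Pf[OF x y]
    proof (rule sum.cong)
      fix i assume "i \<in> {..<n}"
      then have i: "i < n" by simp
      have "complex_of_real (p i) = of_real (sqrt (p i)) * of_real (sqrt (p i))"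
        using pp[OF i] unfolding of_real_mult[symmetric] by simp
      then show "of_real (p i) * (mat_adjoint U *\<^sub>v x) $ i * cnj ((mat_adjoint U *\<^sub>v y) $ i) =
          (W1 *\<^sub>v x) $ i * cnj ((W1 *\<^sub>v y) $ i)"
        by (simp add: W1x[OF i x] W1x[OF i y] del: index_mult_mat_vec)
    qed simp
    also have "\<dots> = (W1 *\<^sub>v x) \<bullet>c (W1 *\<^sub>v y)" by (rule cscalar_prod_sum[symmetric, OF c(2)])
    also have "\<dots> = (W1 *\<^sub>v x) \<bullet>c (U2 *\<^sub>v (mat_adjoint U2 *\<^sub>v (W1 *\<^sub>v y)))"
      using c by (simp add: assoc_mult_mat_vec[OF U2 U2' c(2), symmetric] UU2)
    also have "\<dots> = (mat_adjoint U2 *\<^sub>v (W1 *\<^sub>v x)) \<bullet>c (mat_adjoint U2 *\<^sub>v (W1 *\<^sub>v y))"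
      by (rule adjoint_cscalar_prod'[symmetric, OF U2 c(1)]) (use U2' c in auto)
    also have "\<dots> = (\<Sum>i<n. (W *\<^sub>v x) $ i * cnj ((W *\<^sub>v y) $ i))"
      unfolding Wx[OF x] Wx[OF y] by (rule cscalar_prod_sum) (use U2' c in auto)
    finally show ?thesis .
  qed
  have Qform: "(Q *\<^sub>v x) \<bullet>c y = (\<Sum>i<n. of_real (t i) * (W *\<^sub>v x) $ i * cnj ((W *\<^sub>v y) $ i))"
    if x: "x \<in> carrier_vec n" and y: "y \<in> carrier_vec n" for x y
  proof -
    have c: "W1 *\<^sub>v x \<in> carrier_vec n" "W1 *\<^sub>v y \<in> carrier_vec n" using W1 x y by auto
    have vw: "V1 *\<^sub>v (W1 *\<^sub>v z) = z" if "z \<in> carrier_vec n" for z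
      using that by (simp add: assoc_mult_mat_vec[OF V1 W1 that, symmetric] V1W1)
    have "Q1 *\<^sub>v (W1 *\<^sub>v x) = mat_adjoint V1 *\<^sub>v ((Q * V1) *\<^sub>v (W1 *\<^sub>v x))"
      unfolding Q1_def by (rule assoc_mult_mat_vec[OF V1' QV c(1)])
    also have "(Q * V1) *\<^sub>v (W1 *\<^sub>v x) = Q *\<^sub>v x"
      unfolding assoc_mult_mat_vec[OF Q V1 c(1)] vw[OF x] ..
    finally have "(Q1 *\<^sub>v (W1 *\<^sub>v x)) \<bullet>c (W1 *\<^sub>v y) = (Q *\<^sub>v x) \<bullet>c (V1 *\<^sub>v (W1 *\<^sub>v y))"
      using adjoint_cscalar_prod'[OF V1, of "Q *\<^sub>v x" "W1 *\<^sub>v y"] Q x c by simp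
    then show ?thesis using Qf[OF c] by (simp only: vw[OF y] Wx[OF x] Wx[OF y])
  qed
  show ?thesis by (rule that[OF W V WV VW Pform Qform])
qed


section \<open>Singular values and their comparison for sectorial matrices\<close>

lemma order_prod_linear_list:
  "Polynomial.order z (\<Prod>e\<leftarrow>xs. [:- e, 1:]) = count (mset xs) (z :: complex)"
proof (induct xs)
  case (Cons a xs)
  have nz: "(\<Prod>e\<leftarrow>xs. [:- e, 1:]) \<noteq> (0 :: complex poly)" by (auto simp: prod_list_zero_iff)
  have "[:- a, 1:] * (\<Prod>e\<leftarrow>xs. [:- e, 1:]) \<noteq> 0" using nz by (simp only: mult_eq_0_iff) auto
  from order_mult[OF this, of z] show ?case
    using Cons order_linear_power[of z a 1] by (simp del: mult_pCons_left)
qed (simp add: order_0I)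

text \<open>The choice in \<open>eig_list\<close> fixes the list only up to order; multiplicities of
  roots determine the multiset, and \<open>sv_list\<close> sorts anyway.\<close>

lemma mset_eig_list:
  assumes "char_poly X = (\<Prod>e\<leftarrow>es. [:- e, 1:])"
  shows "mset (eig_list X) = mset es"
proof (rule multiset_eqI)
  fix z
  have "char_poly X = (\<Prod>e\<leftarrow>eig_list X. [:- e, 1:])"
    unfolding eig_list_def by (rule someI[of _ es]) (rule assms)
  then show "count (mset (eig_list X)) z = count (mset es) z"
    using assms order_prod_linear_list by metis
qed

text \<open>Spectral theorem for \<open>X* X\<close>. The numbers \<open>t\<close> are the squares
  of the singular values, decreasing from index 0, whereas \<open>sv\<close> counts from 1; hence
  the shift \<open>j - 1\<close>.\<close>

lemma sv_diagonalization:
  fixes X :: "complex mat"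
  assumes X: "X \<in> carrier_mat n n"
  obtains U t where "U \<in> carrier_mat n n" "mat_adjoint U * U = 1\<^sub>m n" "U * mat_adjoint U = 1\<^sub>m n"
    "\<And>a. a \<in> carrier_vec n \<Longrightarrow> vnorm2 (X *\<^sub>v (U *\<^sub>v a)) = (\<Sum>i<n. t i * (cmod (a $ i))^2)"
    "\<And>i j. i \<le> j \<Longrightarrow> j < n \<Longrightarrow> t j \<le> (t i :: real)"
    "\<And>i. i < n \<Longrightarrow> 0 \<le> t i"
    "\<And>j. 1 \<le> j \<Longrightarrow> j \<le> n \<Longrightarrow> sv X j = sqrt (t (j - 1))"
proof -
  let ?A = "mat_adjoint X * X"
  note X' = mat_adjoint_carrier[OF X]
  have A: "?A \<in> carrier_mat n n" using X' X by (rule mult_carrier_mat)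
  have H: "hermitian ?A" unfolding hermitian_def using A X by (simp add: mat_adjoint_mult[OF X' X] mat_adjoint_adjoint[OF X])
  obtain U t where U: "U \<in> carrier_mat n n" and UU: "mat_adjoint U * U = 1\<^sub>m n" "U * mat_adjoint U = 1\<^sub>m n"
    and form: "\<And>x y. x \<in> carrier_vec n \<Longrightarrow> y \<in> carrier_vec n \<Longrightarrow> (?A *\<^sub>v x) \<bullet>c y =
       (\<Sum>i<n. of_real (t i) * (mat_adjoint U *\<^sub>v x) $ i * cnj ((mat_adjoint U *\<^sub>v y) $ i))"
    and mono: "\<And>i j. i \<le> j \<Longrightarrow> j < n \<Longrightarrow> t j \<le> (t i :: real)"
    and cp: "char_poly ?A = (\<Prod>e\<leftarrow>map (\<lambda>i. of_real (t i)) [0..<n]. [:- e, 1:])"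
    by (rule spectral_theorem[OF H A]) blast
  note U' = mat_adjoint_carrier[OF U]
  have nrm: "vnorm2 (X *\<^sub>v (U *\<^sub>v a)) = (\<Sum>i<n. t i * (cmod (a $ i))^2)" if a: "a \<in> carrier_vec n" for a
  proof -
    have Ua: "U *\<^sub>v a \<in> carrier_vec n" "X *\<^sub>v (U *\<^sub>v a) \<in> carrier_vec n" using U X a by auto
    have "mat_adjoint U *\<^sub>v (U *\<^sub>v a) = a"
      using a by (simp add: assoc_mult_mat_vec[OF U' U a, symmetric] UU)
    then have "(?A *\<^sub>v (U *\<^sub>v a)) \<bullet>c (U *\<^sub>v a) = (\<Sum>i<n. of_real (t i) * a $ i * cnj (a $ i))"
      by (simp only: form[OF Ua(1) Ua(1)])
    also have "\<dots> = of_real (\<Sum>i<n. t i * (cmod (a $ i))^2)"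
      by (simp add: complex_norm_square[symmetric] mult.assoc del: complex_mult_cnj)
    finally have "(?A *\<^sub>v (U *\<^sub>v a)) \<bullet>c (U *\<^sub>v a) = of_real (\<Sum>i<n. t i * (cmod (a $ i))^2)" .
    moreover have "(?A *\<^sub>v (U *\<^sub>v a)) \<bullet>c (U *\<^sub>v a) = (X *\<^sub>v (U *\<^sub>v a)) \<bullet>c (X *\<^sub>v (U *\<^sub>v a))"
      unfolding assoc_mult_mat_vec[OF X' X Ua(1)] by (rule adjoint_cscalar_prod'[OF X Ua(2,1)])
    ultimately show ?thesis by (simp add: vnorm2_def)
  qed
  have pos: "0 \<le> t i" if i: "i < n" for i
  proof -
    have e: "unit_vec n i \<in> carrier_vec n" by simp
    have "vnorm2 (X *\<^sub>v (U *\<^sub>v unit_vec n i)) = (\<Sum>j<n. if j = i then t i else 0)"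
      unfolding nrm[OF e] by (rule sum.cong) (use i in auto)
    moreover have "0 \<le> vnorm2 (X *\<^sub>v (U *\<^sub>v unit_vec n i))" by (rule vnorm2_nonneg[of _ n]) (use X U in auto)
    ultimately show ?thesis using i by simp
  qed
  let ?ys = "rev (map (\<lambda>i. sqrt (t i)) [0..<n])"
  have "mset (map (\<lambda>e. sqrt (Re e)) (eig_list ?A)) = mset ?ys"
    using mset_eig_list[OF cp] by (simp add: image_mset.compositionality o_def flip: mset_map) (simp add: image_mset.compositionality o_def)
  moreover have "sorted ?ys"
    unfolding sorted_rev_iff_nth_mono using mono by (auto simp: sorted_rev_iff_nth_mono)
  ultimately have "sort (map (\<lambda>e. sqrt (Re e)) (eig_list ?A)) = ?ys"
    by (intro properties_for_sort) auto
  then have "sv_list X = map (\<lambda>i. sqrt (t i)) [0..<n]" by (simp add: sv_list_def)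
  then have "sv X j = sqrt (t (j - 1))" if "1 \<le> j" "j \<le> n" for j
    using that nth_map_upt[of "j - 1" n 0 "\<lambda>i. sqrt (t i)"] by (simp add: sv_def del: nth_map)
  then show ?thesis using that[OF U UU nrm mono pos] by blast
qed

text \<open>The vector \<open>w\<close> with \<open>X w = y\<close> below lies in the span of the top \<open>j\<close> right singular vectors
  of \<open>X\<close> while \<open>y\<close> lies in the span of the bottom \<open>n - j + 1\<close> right singular vectors of \<open>Y\<close>.\<close>

theorem sv_le_of_sectorial:
  fixes X Y :: "complex mat"
  assumes X: "X \<in> carrier_mat n n" and Y: "Y \<in> carrier_mat n n"
    and sect: "\<And>u v. u \<in> carrier_vec n \<Longrightarrow> v \<in> carrier_vec n \<Longrightarrow>
       (cmod ((X *\<^sub>v u) \<bullet>c v))^2 \<le> \<kappa> * Re ((X *\<^sub>v u) \<bullet>c u) * Re ((X *\<^sub>v v) \<bullet>c v)"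
    and nonneg: "\<And>u. u \<in> carrier_vec n \<Longrightarrow> 0 \<le> Re ((X *\<^sub>v u) \<bullet>c u)"
    and le: "\<And>u. u \<in> carrier_vec n \<Longrightarrow> Re ((X *\<^sub>v u) \<bullet>c u) \<le> C * Re ((Y *\<^sub>v u) \<bullet>c u)"
    and C: "0 \<le> C" and \<kappa>: "0 \<le> \<kappa>" and j: "1 \<le> j" "j \<le> n"
  shows "sv X j \<le> \<kappa> * C * sv Y j"
proof -
  obtain U t where U: "U \<in> carrier_mat n n" and UU: "mat_adjoint U * U = 1\<^sub>m n" "U * mat_adjoint U = 1\<^sub>m n"
    and XU: "\<And>a. a \<in> carrier_vec n \<Longrightarrow> vnorm2 (X *\<^sub>v (U *\<^sub>v a)) = (\<Sum>i<n. t i * (cmod (a $ i))^2)"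
    and tm: "\<And>i j. i \<le> j \<Longrightarrow> j < n \<Longrightarrow> t j \<le> (t i :: real)" and t0: "\<And>i. i < n \<Longrightarrow> 0 \<le> t i"
    and svX: "\<And>j. 1 \<le> j \<Longrightarrow> j \<le> n \<Longrightarrow> sv X j = sqrt (t (j - 1))"
    by (rule sv_diagonalization[OF X]) blast
  obtain V r where V: "V \<in> carrier_mat n n" and VV: "mat_adjoint V * V = 1\<^sub>m n" "V * mat_adjoint V = 1\<^sub>m n"
    and YV: "\<And>a. a \<in> carrier_vec n \<Longrightarrow> vnorm2 (Y *\<^sub>v (V *\<^sub>v a)) = (\<Sum>i<n. r i * (cmod (a $ i))^2)"
    and rm: "\<And>i j. i \<le> j \<Longrightarrow> j < n \<Longrightarrow> r j \<le> (r i :: real)" and r0: "\<And>i. i < n \<Longrightarrow> 0 \<le> r i"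
    and svY: "\<And>j. 1 \<le> j \<Longrightarrow> j \<le> n \<Longrightarrow> sv Y j = sqrt (r (j - 1))"
    by (rule sv_diagonalization[OF Y]) blast
  note V' = mat_adjoint_carrier[OF V]
  define N where "N = mat_adjoint V * (X * U)"
  have XUc: "X * U \<in> carrier_mat n n" using X U by (rule mult_carrier_mat)
  have N: "N \<in> carrier_mat n n" unfolding N_def using V' XUc by (rule mult_carrier_mat)
  \<comment> \<open>Rows before \<open>j - 1\<close> force \<open>y\<close> to have no component
    along the first \<open>j - 1\<close> singular vectors of \<open>Y\<close>, rows after it force
    \<open>a\<close> to vanish from index \<open>j\<close> on, and row \<open>j - 1\<close> is left
    zero so that a nonzero \<open>a\<close> exists.\<close>
  define M where "M = mat n n (\<lambda>(i,k). if i < j - 1 then N $$ (i,k) else if i = j - 1 then 0 else if i = k then 1 else 0)"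
  have M: "M \<in> carrier_mat n n" by (simp add: M_def)
  have "j - 1 < n" using j by simp
  from zero_row_kernel[OF M this] obtain a where a: "a \<in> carrier_vec n" "a \<noteq> 0\<^sub>v n" "M *\<^sub>v a = 0\<^sub>v n"
    using j by (auto simp: M_def)
  define b where "b = N *\<^sub>v a"
  have b: "b \<in> carrier_vec n" using N a by (simp add: b_def)
  have Ma: "(\<Sum>k<n. M $$ (i,k) * a $ k) = 0" if "i < n" for i
    using mat_vec_index_sum[OF M a(1) that] a(3) that by simp
  have b0: "b $ i = 0" if "i < j - 1" for i
  proof -
    have "b $ i = (\<Sum>k<n. N $$ (i,k) * a $ k)" unfolding b_def
      by (rule mat_vec_index_sum[OF N a(1)]) (use that j in simp)
    also have "\<dots> = (\<Sum>k<n. M $$ (i,k) * a $ k)" by (rule sum.cong) (use that j in \<open>auto simp: M_def\<close>)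
    finally show ?thesis using Ma[of i] that j by simp
  qed
  have a0: "a $ i = 0" if "j \<le> i" "i < n" for i
  proof -
    have "(\<Sum>k<n. M $$ (i,k) * a $ k) = (\<Sum>k<n. if k = i then a $ i else 0)"
      by (rule sum.cong) (use that j in \<open>auto simp: M_def\<close>)
    then show ?thesis using Ma[OF that(2)] that by simp
  qed
  define w where "w = U *\<^sub>v a"
  define y where "y = X *\<^sub>v w"
  have w: "w \<in> carrier_vec n" using U a by (simp add: w_def)
  have y: "y \<in> carrier_vec n" using X w by (simp add: y_def)
  have yV: "y = V *\<^sub>v b"
  proof -
    have "b = mat_adjoint V *\<^sub>v y"
      unfolding b_def N_def y_def w_def assoc_mult_mat_vec[OF V' XUc a(1)] assoc_mult_mat_vec[OF X U a(1)] ..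
    then show ?thesis using y by (simp add: assoc_mult_mat_vec[OF V V' y, symmetric] VV)
  qed
  have nw: "vnorm2 w = vnorm2 a" unfolding w_def by (rule isometry_vnorm2[OF U UU(1) a(1)])
  have ny: "vnorm2 y = vnorm2 b" unfolding yV by (rule isometry_vnorm2[OF V VV(1) b])
  have w0: "0 < vnorm2 w" unfolding nw by (rule vnorm2_pos[OF a(1,2)])
  have 1: "t (j - 1) * vnorm2 w \<le> vnorm2 y"
    unfolding y_def w_def XU[OF a(1)] nw[unfolded w_def] vnorm2_sum[OF a(1)] sum_distrib_left
  proof (rule sum_mono)
    fix i assume "i \<in> {..<n}"
    then show "t (j - 1) * (cmod (a $ i))^2 \<le> t i * (cmod (a $ i))^2"
      using a0[of i] tm[of i "j - 1"] j by (cases "i < j") (auto intro: mult_right_mono)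
  qed
  have 2: "vnorm2 (Y *\<^sub>v y) \<le> r (j - 1) * vnorm2 y"
    unfolding ny unfolding yV YV[OF b] vnorm2_sum[OF b] sum_distrib_left
  proof (rule sum_mono)
    fix i assume "i \<in> {..<n}"
    then show "r i * (cmod (b $ i))^2 \<le> r (j - 1) * (cmod (b $ i))^2"
      using b0[of i] rm[of "j - 1" i] j by (cases "i < j - 1") (auto intro: mult_right_mono)
  qed
  define \<beta> where "\<beta> = sqrt (vnorm2 y)"
  define \<alpha> where "\<alpha> = sqrt (vnorm2 w)"
  define s where "s = sv Y j"
  have s: "s = sqrt (r (j - 1))" "0 \<le> s" using svY[OF j] r0[of "j - 1"] j by (auto simp: s_def)
  have ab: "0 < \<alpha>" "0 \<le> \<beta>" "vnorm2 y = \<beta>^2" "vnorm2 w = \<alpha>^2"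
    using w0 vnorm2_nonneg[OF y] by (auto simp: \<alpha>_def \<beta>_def)
  have cs: "Re (u \<bullet>c v) \<le> sqrt (vnorm2 u) * sqrt (vnorm2 v)" if "u \<in> carrier_vec n" "v \<in> carrier_vec n" for u v
  proof -
    have "Re (u \<bullet>c v) \<le> cmod (u \<bullet>c v)" by (rule complex_Re_le_cmod)
    also have "\<dots> \<le> sqrt (vnorm2 u * vnorm2 v)"
      by (rule real_le_rsqrt) (rule cscalar_prod_cauchy_schwarz[OF that])
    finally show ?thesis by (simp add: real_sqrt_mult)
  qed
  have 3: "Re ((Y *\<^sub>v y) \<bullet>c y) \<le> s * \<beta>^2"
  proof -
    have "sqrt (vnorm2 (Y *\<^sub>v y)) \<le> s * \<beta>"
      using 2 unfolding s(1) \<beta>_def real_sqrt_mult[symmetric] by simp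
    then have "sqrt (vnorm2 (Y *\<^sub>v y)) * \<beta> \<le> s * \<beta> * \<beta>" using ab by (intro mult_right_mono) auto
    then show ?thesis using cs[of "Y *\<^sub>v y" y] Y y unfolding \<beta>_def[symmetric] by (simp add: power2_eq_square mult.assoc)
  qed
  have 4: "Re ((X *\<^sub>v w) \<bullet>c w) \<le> \<beta> * \<alpha>" using cs[OF y w] by (simp add: y_def \<alpha>_def \<beta>_def)
  have 5: "Re ((X *\<^sub>v y) \<bullet>c y) \<le> C * (s * \<beta>^2)"
    using le[OF y] mult_left_mono[OF 3 C] by linarith
  \<comment> \<open>Since \<open>y = X w\<close>, the pairing of \<open>X w\<close> with
    \<open>y\<close> is the squared norm of \<open>y\<close>. The sectorial Cauchy-Schwarz
    inequality at \<open>w\<close> and \<open>y\<close> then bounds the fourth power of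
    \<open>\<beta>\<close> by a multiple of its third power.\<close>
  have "(cmod ((X *\<^sub>v w) \<bullet>c y))^2 = (\<beta>^2)^2"
    using cscalar_prod_self[OF y] ab(3) by (simp add: y_def[symmetric] norm_power)
  then have "(\<beta>^2)^2 \<le> \<kappa> * Re ((X *\<^sub>v w) \<bullet>c w) * Re ((X *\<^sub>v y) \<bullet>c y)" using sect[OF w y] by simp
  also have "\<dots> \<le> \<kappa> * (\<beta> * \<alpha>) * (C * (s * \<beta>^2))"
    using 4 5 nonneg[OF w] nonneg[OF y] \<kappa> ab by (intro mult_mono mult_left_mono) (auto intro!: mult_nonneg_nonneg)
  finally have "\<beta>^3 * \<beta> \<le> \<beta>^3 * (\<kappa> * C * s * \<alpha>)" by (simp add: power2_eq_square power3_eq_cube mult_ac)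
  then have "\<beta> \<le> \<kappa> * C * s * \<alpha>" 
    using ab C \<kappa> s(2) by (cases "\<beta> = 0") (auto simp: mult_le_cancel_left intro!: mult_nonneg_nonneg)
  moreover have "sqrt (t (j - 1)) * \<alpha> \<le> \<beta>"
    using 1 unfolding \<alpha>_def \<beta>_def real_sqrt_mult[symmetric] by simp
  ultimately have "sqrt (t (j - 1)) * \<alpha> \<le> (\<kappa> * C * s) * \<alpha>" by linarith
  then show ?thesis using ab(1) svX[OF j] by (simp add: s_def)
qed

section \<open>Operator monotone functions\<close>

lemma lagrange_interpolation:
  fixes a :: "'i \<Rightarrow> real"
  assumes I: "finite I" and inj: "inj_on a I" and deg: "degree p < card I"
  shows "poly p t = (\<Sum>i\<in>I. poly p (a i) * ((\<Prod>k\<in>I-{i}. t - a k) / (\<Prod>k\<in>I-{i}. a i - a k)))"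
proof -
  define q where "q = (\<Sum>i\<in>I. Polynomial.smult (poly p (a i) / (\<Prod>k\<in>I-{i}. a i - a k)) (\<Prod>k\<in>I-{i}. [:- a k, 1:]))"
  have poly_q: "poly q t = (\<Sum>i\<in>I. poly p (a i) * ((\<Prod>k\<in>I-{i}. t - a k) / (\<Prod>k\<in>I-{i}. a i - a k)))" for t
    by (simp add: q_def poly_sum poly_prod)
  have "p = q"
  proof (rule poly_eqI_degree[of "a ` I"])
    have c: "card (a ` I) = card I" by (rule card_image[OF inj])
    show "degree p < card (a ` I)" using deg c by simp
    have "degree (Polynomial.smult (poly p (a i) / (\<Prod>k\<in>I-{i}. a i - a k)) (\<Prod>k\<in>I-{i}. [:- a k, 1:])) \<le> card I - 1"
      if "i \<in> I" for i
    proof -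
      have "degree (\<Prod>k\<in>I-{i}. [:- a k, 1:]) \<le> sum (degree \<circ> (\<lambda>k. [:- a k, 1:])) (I-{i})"
        by (rule degree_prod_sum_le) (use I in simp)
      also have "\<dots> = card I - 1" using I that by simp
      finally show ?thesis using degree_smult_le order_trans by blast
    qed
    then have "degree q \<le> card I - 1" unfolding q_def by (intro degree_sum_le I)
    then show "degree q < card (a ` I)" using c deg by linarith
    fix x assume "x \<in> a ` I"
    then obtain j where j: "j \<in> I" "x = a j" by blast
    have nz: "(\<Prod>k\<in>I-{j}. a j - a k) \<noteq> 0" using I inj j by (auto simp: inj_on_def)
    have "poly q x = (\<Sum>i\<in>I. if i = j then poly p (a j) else 0)"
      unfolding poly_q j(2)
    proof (rule sum.cong)
      fix i assume i: "i \<in> I"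
      show "poly p (a i) * ((\<Prod>k\<in>I-{i}. a j - a k) / (\<Prod>k\<in>I-{i}. a i - a k)) = (if i = j then poly p (a j) else 0)"
      proof (cases "i = j")
        case False
        then have "(\<Prod>k\<in>I-{i}. a j - a k) = 0" using I j i by (intro prod_zero) auto
        then show ?thesis using False by simp
      qed (use nz in simp)
    qed simp
    then show "poly p x = poly q x" using I j by simp
  qed
  then have "poly p t = poly q t" by (rule arg_cong)
  then show ?thesis unfolding poly_q .
qed

text \<open>Compare the diagonal matrix \<open>D\<close> with entries \<open>\<alpha>\<close> with its rank one perturbation \<open>D + v v\<^sup>T\<close>, where
  \<open>v\<close> is chosen such that the perturbed matrix has the interlacing eigenvalues \<open>\<beta>\<close>.\<close>

lemma op_monotone_interlacing:
  fixes g :: "complex \<Rightarrow> complex" and \<alpha> \<beta> :: "nat \<Rightarrow> real" and r :: "real poly"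
  assumes op: "op_monotone g" and real: "\<And>t. 0 < t \<Longrightarrow> g (of_real t) = of_real (G t)"
    and pos: "\<And>i. i < n \<Longrightarrow> 0 < \<alpha> i"
    and lt: "\<And>i k. k < n \<Longrightarrow> i \<le> k \<Longrightarrow> \<alpha> i < \<beta> k" "\<And>i k. k < n \<Longrightarrow> i < k \<Longrightarrow> \<beta> i < \<alpha> k"
    and deg: "degree r < n"
  shows "0 \<le> (\<Sum>i<n. (poly r (\<alpha> i))^2 * G (\<alpha> i) / ((\<Prod>k\<in>{..<n}-{i}. \<alpha> i - \<alpha> k) * (\<Prod>k<n. \<alpha> i - \<beta> k)))
    + (\<Sum>j<n. (poly r (\<beta> j))^2 * G (\<beta> j) / ((\<Prod>k\<in>{..<n}-{j}. \<beta> j - \<beta> k) * (\<Prod>k<n. \<beta> j - \<alpha> k)))"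
proof -
  have ll: "\<alpha> i < \<alpha> k" if "i < k" "k < n" for i k
    using lt(1)[of i i] lt(2)[of k i] that by linarith
  have mm: "\<beta> i < \<beta> k" if "i < k" "k < n" for i k
    using lt(1)[of k k] lt(2)[of k i] that by linarith
  have lne: "\<alpha> i \<noteq> \<alpha> k" "\<beta> i \<noteq> \<beta> k" if "i \<noteq> k" "i < n" "k < n" for i k
    using ll[of i k] ll[of k i] mm[of i k] mm[of k i] that by (metis less_irrefl nat_neq_iff)+
  have lm: "\<alpha> i \<noteq> \<beta> k" if "i < n" "k < n" for i k
    using lt(1)[of k i] lt(2)[of i k] that by (cases "i \<le> k") auto
  have mpos: "0 < \<beta> i" if "i < n" for i using pos[OF that] lt(1)[OF that, of i] by linarith
  define PL where "PL = (\<lambda>i. \<Prod>k\<in>{..<n}-{i}. \<alpha> i - \<alpha> k)"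
  define PM where "PM = (\<lambda>j. \<Prod>k\<in>{..<n}-{j}. \<beta> j - \<beta> k)"
  define QL where "QL = (\<lambda>i. \<Prod>k<n. \<alpha> i - \<beta> k)"
  define QM where "QM = (\<lambda>j. \<Prod>k<n. \<beta> j - \<alpha> k)"
  have PL0: "PL i \<noteq> 0" and PM0: "PM i \<noteq> 0" and QL0: "QL i \<noteq> 0" and QM0: "QM i \<noteq> 0" if "i < n" for i
    using that lne lm lm[symmetric] unfolding PL_def PM_def QL_def QM_def by (auto simp: prod_zero_iff)
  \<comment> \<open>These will be the squares of the entries of \<open>v\<close>. Each is minus the
    residue at \<open>\<alpha> i\<close> of the quotient of the monic polynomials with roots
    \<open>\<beta>\<close> and \<open>\<alpha>\<close>; the interlacing makes them positive.\<close>
  define \<omega> where "\<omega> = (\<lambda>i. - QL i / PL i)"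
  have \<omega>: "0 < \<omega> i" if i: "i < n" for i
  proof -
    have "QL i = (\<alpha> i - \<beta> i) * (\<Prod>k\<in>{..<n}-{i}. \<alpha> i - \<beta> k)"
      unfolding QL_def using i by (intro prod.remove) auto
    then have "- QL i = (\<beta> i - \<alpha> i) * (\<Prod>k\<in>{..<n}-{i}. \<alpha> i - \<beta> k)" by (simp add: algebra_simps)
    then have "\<omega> i = (\<beta> i - \<alpha> i) * (\<Prod>k\<in>{..<n}-{i}. (\<alpha> i - \<beta> k) / (\<alpha> i - \<alpha> k))"
      by (simp only: \<omega>_def PL_def prod_dividef times_divide_eq_right)
    also have "\<dots> > 0"
    proof (intro mult_pos_pos prod_pos ballI)
      fix k assume k: "k \<in> {..<n}-{i}"
      show "0 < (\<alpha> i - \<beta> k) / (\<alpha> i - \<alpha> k)"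
      proof (cases "k < i")
        case True
        then show ?thesis using lt(2)[OF i True] ll[OF True i] by simp
      next
        case False
        then have "i < k" "k < n" using k by auto
        then show ?thesis using lt(1)[of k i] ll[of i k] by (intro divide_neg_neg) auto
      qed
    qed (use lt(1)[OF i, of i] in simp)
    finally show ?thesis .
  qed
  have injl: "inj_on \<alpha> {..<n}" and injm: "inj_on \<beta> {..<n}" using lne by (auto simp: inj_on_def)
  have prod_rem: "(\<Prod>k\<in>{..<n}-{i}. t - a k) = (\<Prod>k<n. t - a k) / (t - a i)" if "i < n" "t \<noteq> a i" for i t and a :: "nat \<Rightarrow> real"
    using that prod.remove[of "{..<n}" i "\<lambda>k. t - a k"] by simp
  \<comment> \<open>The secular equation: it says that \<open>\<beta> j\<close> is an eigenvalue of
    the perturbed matrix. The two monic polynomials have equal leading terms, so \<open>p\<close>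
    has degree less than \<open>n\<close> and is recovered from its values at the
    \<open>\<alpha> i\<close>.\<close>
  have A1: "(\<Sum>i<n. \<omega> i / (\<beta> j - \<alpha> i)) = 1" if j: "j < n" for j
  proof -
    define p where "p = (\<Prod>k<n. [:- \<beta> k, 1:]) - (\<Prod>k<n. [:- \<alpha> k, 1:])"
    have dg: "degree (\<Prod>k<n. [:- a k, 1:]) = n" "lead_coeff (\<Prod>k<n. [:- a k, 1:]) = 1" for a :: "nat \<Rightarrow> real"
      by (subst degree_prod_eq_sum_degree) (auto simp: lead_coeff_prod)
    have "coeff p n = 0" using dg[of \<beta>] dg[of \<alpha>] by (simp add: p_def)
    moreover have "degree p \<le> n" unfolding p_def using dg by (intro degree_diff_le) auto
    ultimately have "degree p < n" using j by (metis le_neq_implies_less leading_coeff_0_iff degree_0 not_less_zero)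
    then have "poly p (\<beta> j) = (\<Sum>i<n. poly p (\<alpha> i) * ((\<Prod>k\<in>{..<n}-{i}. \<beta> j - \<alpha> k) / (\<Prod>k\<in>{..<n}-{i}. \<alpha> i - \<alpha> k)))"
      by (intro lagrange_interpolation injl) auto
    also have "\<dots> = (\<Sum>i<n. - QM j * (\<omega> i / (\<beta> j - \<alpha> i)))"
    proof (rule sum.cong)
      fix i assume "i \<in> {..<n}"
      then have i: "i < n" by simp
      have "(\<Prod>k<n. \<alpha> i - \<alpha> k) = 0" using i by (intro prod_zero) auto
      then have "poly p (\<alpha> i) = QL i" by (simp add: p_def poly_prod QL_def)
      then show "poly p (\<alpha> i) * ((\<Prod>k\<in>{..<n}-{i}. \<beta> j - \<alpha> k) / (\<Prod>k\<in>{..<n}-{i}. \<alpha> i - \<alpha> k)) = - QM j * (\<omega> i / (\<beta> j - \<alpha> i))"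
        using prod_rem[of i "\<beta> j" \<alpha>] i lm[OF i j] by (simp add: \<omega>_def PL_def QM_def mult_ac)
    qed simp
    also have "\<dots> = - QM j * (\<Sum>i<n. \<omega> i / (\<beta> j - \<alpha> i))" by (simp add: sum_distrib_left)
    finally have "poly p (\<beta> j) = - QM j * (\<Sum>i<n. \<omega> i / (\<beta> j - \<alpha> i))" .
    moreover have "(\<Prod>k<n. \<beta> j - \<beta> k) = 0" using j by (intro prod_zero) auto
    then have "poly p (\<beta> j) = - QM j" by (simp add: p_def poly_prod QM_def)
    ultimately show ?thesis using QM0[OF j] by simp
  qed
  \<comment> \<open>\<open>c\<close> and \<open>d\<close> are the partial fraction coefficients of
    \<open>r\<close> over the monic polynomials with roots \<open>\<beta>\<close> and
    \<open>\<alpha>\<close> respectively.\<close>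
  define c where "c = (\<lambda>j. poly r (\<beta> j) / PM j)"
  define d where "d = (\<lambda>i. poly r (\<alpha> i) / PL i)"
  have A2: "(\<Sum>j<n. c j / (\<alpha> i - \<beta> j)) = poly r (\<alpha> i) / QL i" if i: "i < n" for i
  proof -
    have "poly r (\<alpha> i) = (\<Sum>j<n. poly r (\<beta> j) * ((\<Prod>k\<in>{..<n}-{j}. \<alpha> i - \<beta> k) / (\<Prod>k\<in>{..<n}-{j}. \<beta> j - \<beta> k)))"
      using deg by (intro lagrange_interpolation injm) auto
    also have "\<dots> = (\<Sum>j<n. QL i * (c j / (\<alpha> i - \<beta> j)))"
      by (rule sum.cong) (use prod_rem[of _ "\<alpha> i" \<beta>] lm[OF i] in \<open>auto simp: c_def PM_def QL_def mult_ac\<close>)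
    also have "\<dots> = QL i * (\<Sum>j<n. c j / (\<alpha> i - \<beta> j))" by (simp only: sum_distrib_left)
    finally show ?thesis using QL0[OF i] by simp
  qed
  have A3: "(\<Sum>i<n. d i / (\<beta> j - \<alpha> i)) = poly r (\<beta> j) / QM j" if j: "j < n" for j
  proof -
    have "poly r (\<beta> j) = (\<Sum>i<n. poly r (\<alpha> i) * ((\<Prod>k\<in>{..<n}-{i}. \<beta> j - \<alpha> k) / (\<Prod>k\<in>{..<n}-{i}. \<alpha> i - \<alpha> k)))"
      using deg by (intro lagrange_interpolation injl) auto
    also have "\<dots> = (\<Sum>i<n. QM j * (d i / (\<beta> j - \<alpha> i)))"
      by (rule sum.cong) (use prod_rem[of _ "\<beta> j" \<alpha>] lm[OF _ j, THEN not_sym] in \<open>auto simp: d_def PL_def QM_def mult_ac\<close>)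
    also have "\<dots> = QM j * (\<Sum>i<n. d i / (\<beta> j - \<alpha> i))" by (simp only: sum_distrib_left)
    finally show ?thesis using QM0[OF j] by simp
  qed
  define v where "v = (\<lambda>i. sqrt (\<omega> i))"
  have v: "0 < v i" "v i * v i = \<omega> i" if "i < n" for i using \<omega>[OF that] by (auto simp: v_def)
  define D where "D = mat n n (\<lambda>(i,k). if i = k then complex_of_real (\<alpha> i) else 0)"
  define E where "E = mat n n (\<lambda>(i,k). complex_of_real (v i * v k))"
  define M where "M = D + E"
  have D: "D \<in> carrier_mat n n" and E: "E \<in> carrier_mat n n" and M: "M \<in> carrier_mat n n"
    by (auto simp: D_def E_def M_def)
  have Dx: "(D *\<^sub>v x) $ i = of_real (\<alpha> i) * x $ i" if "i < n" "x \<in> carrier_vec n" for i x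
  proof -
    have "(D *\<^sub>v x) $ i = (\<Sum>k<n. if k = i then of_real (\<alpha> i) * x $ i else 0)"
      unfolding mat_vec_index_sum[OF D that(2,1)] by (rule sum.cong) (use that in \<open>auto simp: D_def\<close>)
    then show ?thesis using that by simp
  qed
  have Ex: "(E *\<^sub>v x) $ i = of_real (v i) * (\<Sum>k<n. of_real (v k) * x $ k)" if "i < n" "x \<in> carrier_vec n" for i x
    unfolding mat_vec_index_sum[OF E that(2,1)] sum_distrib_left
    by (rule sum.cong) (use that in \<open>auto simp: E_def\<close>)
  have DE: "(M *\<^sub>v x) \<bullet>c x = (D *\<^sub>v x) \<bullet>c x + (E *\<^sub>v x) \<bullet>c x" if "x \<in> carrier_vec n" for x
    unfolding M_def using that D E
    by (simp add: add_mult_distrib_mat_vec[of _ n n] cscalar_prod_add_left[of _ n])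
  have Dq: "Re ((D *\<^sub>v x) \<bullet>c x) = (\<Sum>i<n. \<alpha> i * (cmod (x $ i))^2)" if "x \<in> carrier_vec n" for x
  proof -
    have "(D *\<^sub>v x) \<bullet>c x = of_real (\<Sum>i<n. \<alpha> i * (cmod (x $ i))^2)"
      using that by (simp add: cscalar_prod_sum[of _ n] Dx complex_norm_square[symmetric] mult.assoc
        del: complex_mult_cnj index_mult_mat_vec)
    then show ?thesis by simp
  qed
  have Eq: "Re ((E *\<^sub>v x) \<bullet>c x) = (cmod (\<Sum>k<n. of_real (v k) * x $ k))^2" if "x \<in> carrier_vec n" for x
  proof -
    have "(E *\<^sub>v x) \<bullet>c x = (\<Sum>k<n. of_real (v k) * x $ k) * cnj (\<Sum>k<n. of_real (v k) * x $ k)"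
      using that by (simp add: cscalar_prod_sum[of _ n] Ex sum_distrib_left mult_ac del: index_mult_mat_vec)
    then show ?thesis by (simp add: complex_norm_square[symmetric] del: complex_mult_cnj cnj_sum)
  qed
  have hD: "hermitian D" and hE: "hermitian E" and hM: "hermitian M"
    unfolding hermitian_def using D E M
    by (auto intro!: eq_matI simp: mat_adjoint_index[of _ n] simp del: M_def) (auto simp: D_def E_def M_def)
  have posD: "0 < Re ((D *\<^sub>v x) \<bullet>c x)" if x: "x \<in> carrier_vec n" "x \<noteq> 0\<^sub>v n" for x
  proof -
    obtain i where i: "i < n" "x $ i \<noteq> 0" using x by (metis carrier_vecD eq_vecI index_zero_vec(1,2))
    show ?thesis unfolding Dq[OF x(1)]
      by (rule sum_pos2[of _ i]) (use i pos in \<open>auto intro!: mult_nonneg_nonneg simp: less_imp_le\<close>)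
  qed
  have pdD: "pd D" unfolding pd_def using hD posD D by auto
  have pdM: "pd M" unfolding pd_def using hM posD M DE Eq by (auto intro!: add_pos_nonneg)
  have MD: "M - D = E" unfolding M_def using D E by (intro eq_matI) auto
  have "loewner_le D M" unfolding loewner_le_def psd_def MD using hD hM hE D M E Eq by auto
  then have "loewner_le (mat_fun g D) (mat_fun g M)" using op pdD pdM D M unfolding op_monotone_def by blast
  then have psd: "psd (mat_fun g M - mat_fun g D)" by (simp add: loewner_le_def)
  define q where "q = (\<lambda>j. vec n (\<lambda>i. complex_of_real (v i / (\<beta> j - \<alpha> i))))"
  have q: "q j \<in> carrier_vec n" for j by (simp add: q_def)
  have qe: "M *\<^sub>v q j = of_real (\<beta> j) \<cdot>\<^sub>v q j" if j: "j < n" for j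
  proof (rule eq_vecI)
    fix i assume "i < dim_vec (of_real (\<beta> j) \<cdot>\<^sub>v q j)"
    then have i: "i < n" by (simp add: q_def)
    have "(\<Sum>k<n. of_real (v k) * q j $ k) = complex_of_real (\<Sum>k<n. \<omega> k / (\<beta> j - \<alpha> k))"
      unfolding of_real_sum by (rule sum.cong) (auto simp: q_def v(2)[symmetric])
    then have s1: "(\<Sum>k<n. of_real (v k) * q j $ k) = 1" using A1[OF j] by simp
    have "(M *\<^sub>v q j) $ i = (D *\<^sub>v q j) $ i + (E *\<^sub>v q j) $ i"
      unfolding M_def using D E q i by (simp add: add_mult_distrib_mat_vec[of _ n n] del: index_mult_mat_vec)
    also have "\<dots> = of_real (\<alpha> i) * q j $ i + of_real (v i)" using i q by (simp add: Dx Ex s1 del: index_mult_mat_vec)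
    also have "\<dots> = of_real (\<alpha> i * (v i / (\<beta> j - \<alpha> i)) + v i)" using i by (simp add: q_def)
    also have "\<alpha> i * (v i / (\<beta> j - \<alpha> i)) + v i = \<beta> j * (v i / (\<beta> j - \<alpha> i))"
      using lm[OF i j] by (simp add: field_simps)
    finally show "(M *\<^sub>v q j) $ i = (of_real (\<beta> j) \<cdot>\<^sub>v q j) $ i" using i by (simp add: q_def)
  qed (use M in \<open>simp add: q_def\<close>)
  \<comment> \<open>The test vector is chosen to be explicit in both eigenbases: it has coefficients
    \<open>c j\<close> with respect to the eigenvectors \<open>q j\<close> of \<open>M\<close>, and
    the standard basis is an eigenbasis of \<open>D\<close>.\<close>
  define w where "w = vec n (\<lambda>i. complex_of_real (d i / v i))"
  have w: "w \<in> carrier_vec n" by (simp add: w_def)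
  have wi: "w $ i = (\<Sum>j<n. of_real (c j) * q j $ i)" if i: "i < n" for i
  proof -
    have "(\<Sum>j<n. of_real (c j) * q j $ i) = complex_of_real (\<Sum>j<n. c j * (v i / (\<beta> j - \<alpha> i)))"
      using i by (simp add: q_def)
    also have "(\<Sum>j<n. c j * (v i / (\<beta> j - \<alpha> i))) = - v i * (\<Sum>j<n. c j / (\<alpha> i - \<beta> j))"
      unfolding sum_distrib_left
    proof (rule sum.cong)
      fix j
      have "c j / (\<alpha> i - \<beta> j) = - (c j / (\<beta> j - \<alpha> i))" by (metis minus_diff_eq minus_divide_right)
      then show "c j * (v i / (\<beta> j - \<alpha> i)) = - v i * (c j / (\<alpha> i - \<beta> j))" by simp
    qed simp
    also have "\<dots> = d i / v i"
    proof -
      have "d i = - (v i * v i) * (poly r (\<alpha> i) / QL i)" using v(2)[OF i] QL0[OF i] by (simp add: d_def \<omega>_def)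
      then show ?thesis unfolding A2[OF i] using v(1)[OF i] by simp
    qed
    finally show ?thesis using i by (simp add: w_def)
  qed
  define GM where "GM = mat_fun g M"
  define GD where "GD = mat_fun g D"
  have GM: "GM \<in> carrier_mat n n" and GD: "GD \<in> carrier_mat n n" using M D by (auto simp: GM_def GD_def)
  have GMw: "(GM *\<^sub>v w) $ i = (\<Sum>j<n. of_real (c j * G (\<beta> j)) * q j $ i)" if i: "i < n" for i
  proof -
    have "(GM *\<^sub>v w) $ i = (\<Sum>l<n. GM $$ (i,l) * (\<Sum>j<n. of_real (c j) * q j $ l))"
      unfolding mat_vec_index_sum[OF GM w i] by (rule sum.cong) (auto simp: wi)
    also have "\<dots> = (\<Sum>l<n. \<Sum>j<n. of_real (c j) * (GM $$ (i,l) * q j $ l))"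
      by (simp add: sum_distrib_left mult_ac)
    also have "\<dots> = (\<Sum>j<n. \<Sum>l<n. of_real (c j) * (GM $$ (i,l) * q j $ l))" by (rule sum.swap)
    also have "\<dots> = (\<Sum>j<n. of_real (c j) * (GM *\<^sub>v q j) $ i)"
      by (simp add: sum_distrib_left mat_vec_index_sum[OF GM q i] del: index_mult_mat_vec)
    also have "\<dots> = (\<Sum>j<n. of_real (c j * G (\<beta> j)) * q j $ i)"
    proof (rule sum.cong)
      fix j assume "j \<in> {..<n}"
      then have j: "j < n" by simp
      have "GM *\<^sub>v q j = of_real (G (\<beta> j)) \<cdot>\<^sub>v q j"
        unfolding GM_def mat_fun_eigenvector[OF M q qe[OF j]] real[OF mpos[OF j]] ..
      then show "of_real (c j) * (GM *\<^sub>v q j) $ i = of_real (c j * G (\<beta> j)) * q j $ i"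
        using i q[of j] by (simp del: index_mult_mat_vec)
    qed simp
    finally show ?thesis .
  qed
  have "(GM *\<^sub>v w) \<bullet>c w = (\<Sum>i<n. (\<Sum>j<n. of_real (c j * G (\<beta> j)) * q j $ i) * cnj (w $ i))"
    unfolding cscalar_prod_sum[OF w] by (rule sum.cong) (auto simp: GMw simp del: index_mult_mat_vec)
  also have "\<dots> = of_real (\<Sum>i<n. \<Sum>j<n. c j * G (\<beta> j) * (d i / (\<beta> j - \<alpha> i)))"
    unfolding of_real_sum sum_distrib_right
  proof (intro sum.cong refl)
    fix i j assume "i \<in> {..<n}" "j \<in> {..<n}"
    then have ij: "i < n" "j < n" by auto
    have "v i \<noteq> 0" using v(1)[OF ij(1)] by simp
    then have "(c j * G (\<beta> j)) * (v i / (\<beta> j - \<alpha> i)) * (d i / v i) = c j * G (\<beta> j) * (d i / (\<beta> j - \<alpha> i))" by simp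
    then show "of_real (c j * G (\<beta> j)) * q j $ i * cnj (w $ i) = complex_of_real (c j * G (\<beta> j) * (d i / (\<beta> j - \<alpha> i)))"
      using ij by (simp add: q_def w_def flip: of_real_mult of_real_divide)
  qed
  also have "(\<Sum>i<n. \<Sum>j<n. c j * G (\<beta> j) * (d i / (\<beta> j - \<alpha> i))) = (\<Sum>j<n. c j * G (\<beta> j) * (poly r (\<beta> j) / QM j))"
    by (subst sum.swap) (rule sum.cong, auto simp: A3[symmetric] sum_distrib_left)
  finally have M1: "Re ((GM *\<^sub>v w) \<bullet>c w) = (\<Sum>j<n. c j * G (\<beta> j) * (poly r (\<beta> j) / QM j))" by simp
  have GDw: "(GD *\<^sub>v w) $ i = of_real (G (\<alpha> i)) * w $ i" if i: "i < n" for i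
  proof -
    have e: "D *\<^sub>v unit_vec n k = of_real (\<alpha> k) \<cdot>\<^sub>v unit_vec n k" if "k < n" for k
      by (rule eq_vecI) (use that D Dx[of _ "unit_vec n k"] in \<open>auto simp: unit_vec_def simp del: index_mult_mat_vec\<close>)
    have GDik: "GD $$ (i,k) = (if i = k then of_real (G (\<alpha> i)) else 0)" if k: "k < n" for k
    proof -
      have "GD *\<^sub>v unit_vec n k = of_real (G (\<alpha> k)) \<cdot>\<^sub>v unit_vec n k"
        unfolding GD_def mat_fun_eigenvector[OF D _ e[OF k], simplified] real[OF pos[OF k]] ..
      then have "(GD *\<^sub>v unit_vec n k) $ i = (of_real (G (\<alpha> k)) \<cdot>\<^sub>v unit_vec n k) $ i" by simp
      then show ?thesis using GD i k by auto
    qed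
    have "(GD *\<^sub>v w) $ i = (\<Sum>k<n. if k = i then of_real (G (\<alpha> i)) * w $ i else 0)"
      unfolding mat_vec_index_sum[OF GD w i] by (rule sum.cong) (auto simp: GDik)
    then show ?thesis using i by simp
  qed
  have "(GD *\<^sub>v w) \<bullet>c w = of_real (\<Sum>i<n. G (\<alpha> i) * (d i / v i)^2)"
    unfolding cscalar_prod_sum[OF w] of_real_sum
  proof (rule sum.cong)
    fix i assume "i \<in> {..<n}"
    then have i: "i < n" by simp
    have "w $ i = of_real (d i / v i)" using i by (simp add: w_def)
    then show "(GD *\<^sub>v w) $ i * cnj (w $ i) = of_real (G (\<alpha> i) * (d i / v i)^2)"
      unfolding GDw[OF i] by (simp add: power2_eq_square)
  qed simp
  then have D1: "Re ((GD *\<^sub>v w) \<bullet>c w) = (\<Sum>i<n. G (\<alpha> i) * (d i / v i)^2)" by simp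
  have "Re (((GM - GD) *\<^sub>v w) \<bullet>c w) = Re ((GM *\<^sub>v w) \<bullet>c w) - Re ((GD *\<^sub>v w) \<bullet>c w)"
  proof -
    have "((GM - GD) *\<^sub>v w) \<bullet>c w = (\<Sum>i<n. ((GM *\<^sub>v w) $ i - (GD *\<^sub>v w) $ i) * cnj (w $ i))"
      unfolding cscalar_prod_sum[OF w]
      by (rule sum.cong) (use GM GD w in \<open>auto simp: minus_mult_distrib_mat_vec[of _ n n] simp del: index_mult_mat_vec\<close>)
    then show ?thesis by (simp add: cscalar_prod_sum[OF w] left_diff_distrib sum_subtractf)
  qed
  moreover have "0 \<le> Re (((GM - GD) *\<^sub>v w) \<bullet>c w)"
    using psd w GM GD unfolding psd_def GM_def[symmetric] GD_def[symmetric] by auto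
  ultimately have "0 \<le> (\<Sum>j<n. c j * G (\<beta> j) * (poly r (\<beta> j) / QM j)) - (\<Sum>i<n. G (\<alpha> i) * (d i / v i)^2)"
    using M1 D1 by simp
  also have "(\<Sum>j<n. c j * G (\<beta> j) * (poly r (\<beta> j) / QM j)) = (\<Sum>j<n. (poly r (\<beta> j))^2 * G (\<beta> j) / (PM j * QM j))"
    by (rule sum.cong) (auto simp: c_def power2_eq_square)
  also have "(\<Sum>i<n. G (\<alpha> i) * (d i / v i)^2) = - (\<Sum>i<n. (poly r (\<alpha> i))^2 * G (\<alpha> i) / (PL i * QL i))"
    unfolding sum_negf[symmetric]
  proof (rule sum.cong)
    fix i assume "i \<in> {..<n}"
    then have i: "i < n" by simp
    have "(d i / v i)^2 = (poly r (\<alpha> i))^2 / (PL i)^2 / \<omega> i"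
      using v(2)[OF i] by (simp add: d_def power_divide power2_eq_square)
    also have "\<dots> = - ((poly r (\<alpha> i))^2 / (PL i * QL i))"
      using PL0[OF i] QL0[OF i] by (simp add: \<omega>_def field_simps power2_eq_square)
    finally show "G (\<alpha> i) * (d i / v i)^2 = - ((poly r (\<alpha> i))^2 * G (\<alpha> i) / (PL i * QL i))" by simp
  qed simp
  finally show ?thesis unfolding PL_def PM_def QL_def QM_def by simp
qed

text \<open>The sum is the divided difference of \<open>r^2 G\<close> over \<open>S\<close>. Sorting
  the nodes and taking them alternately as \<open>\<alpha>\<close> and \<open>\<beta>\<close>
  produces interlacing spectra.\<close>

lemma op_monotone_even:
  fixes S :: "real set"
  assumes op: "op_monotone g" and real: "\<And>t. 0 < t \<Longrightarrow> g (of_real t) = of_real (G t)"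
    and S: "finite S" "\<And>x. x \<in> S \<Longrightarrow> 0 < x" and card: "card S = 2 * n" and deg: "degree r < n"
  shows "0 \<le> (\<Sum>x\<in>S. (poly r x)^2 * G x / (\<Prod>y\<in>S-{x}. x - y))"
proof -
  define xs where "xs = sorted_list_of_set S"
  have len: "length xs = 2 * n" and set: "set xs = S" and ss: "sorted_wrt (<) xs"
    using S card by (auto simp: xs_def)
  define \<alpha> where "\<alpha> = (\<lambda>i. xs ! (2 * i))"
  define \<beta> where "\<beta> = (\<lambda>i. xs ! (2 * i + 1))"
  have xl: "xs ! i < xs ! k" if "i < k" "k < 2 * n" for i k
    using sorted_wrt_nth_less[OF ss that(1)] that len by simp
  have lt1: "\<alpha> i < \<beta> k" if "k < n" "i \<le> k" for i k unfolding \<alpha>_def \<beta>_def by (rule xl) (use that in auto)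
  have lt2: "\<beta> i < \<alpha> k" if "k < n" "i < k" for i k unfolding \<alpha>_def \<beta>_def by (rule xl) (use that in auto)
  have ll: "\<alpha> i < \<alpha> k" "\<beta> i < \<beta> k" if "k < n" "i < k" for i k
    unfolding \<alpha>_def \<beta>_def by (rule xl; use that in auto)+
  define A where "A = \<alpha> ` {..<n}"
  define B where "B = \<beta> ` {..<n}"
  have inj: "inj_on \<alpha> {..<n}" "inj_on \<beta> {..<n}"
    using ll by (auto simp: inj_on_def) (metis less_irrefl nat_neq_iff)+
  have dis: "A \<inter> B = {}"
  proof -
    have "\<alpha> i \<noteq> \<beta> k" if "i < n" "k < n" for i k using lt1[of k i] lt2[of i k] that by (cases "i \<le> k") auto
    then show ?thesis unfolding A_def B_def by auto
  qed
  have SAB: "S = A \<union> B"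
  proof
    show "S \<subseteq> A \<union> B"
    proof
      fix x assume "x \<in> S"
      then obtain m where m: "m < 2 * n" "x = xs ! m" using set len by (metis in_set_conv_nth)
      show "x \<in> A \<union> B"
      proof (cases "even m")
        case True
        then have "x = \<alpha> (m div 2)" "m div 2 < n" using m by (auto simp: \<alpha>_def)
        then show ?thesis by (auto simp: A_def)
      next
        case False
        then have "x = \<beta> (m div 2)" "m div 2 < n" using m by (auto simp: \<beta>_def)
        then show ?thesis by (auto simp: B_def)
      qed
    qed
    show "A \<union> B \<subseteq> S" using set len by (auto simp: A_def B_def \<alpha>_def \<beta>_def intro!: nth_mem)
  qed
  have fin: "finite A" "finite B" by (auto simp: A_def B_def)
  have PA: "(\<Prod>y\<in>S-{\<alpha> i}. \<alpha> i - y) = (\<Prod>k\<in>{..<n}-{i}. \<alpha> i - \<alpha> k) * (\<Prod>k<n. \<alpha> i - \<beta> k)" if i: "i < n" for i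
  proof -
    have "S - {\<alpha> i} = (A - {\<alpha> i}) \<union> B" using SAB dis i by (auto simp: A_def)
    also have "A - {\<alpha> i} = \<alpha> ` ({..<n}-{i})" unfolding A_def using inj(1) i by (auto simp: inj_on_def)
    finally have e: "S - {\<alpha> i} = \<alpha> ` ({..<n}-{i}) \<union> B" .
    have "(\<Prod>y\<in>S-{\<alpha> i}. \<alpha> i - y) = (\<Prod>y\<in>\<alpha> ` ({..<n}-{i}). \<alpha> i - y) * (\<Prod>y\<in>B. \<alpha> i - y)"
      unfolding e by (rule prod.union_disjoint) (use fin dis in \<open>auto simp: A_def\<close>)
    then show ?thesis unfolding B_def
      using inj by (simp add: prod.reindex inj_on_diff)
  qed
  have PB: "(\<Prod>y\<in>S-{\<beta> i}. \<beta> i - y) = (\<Prod>k\<in>{..<n}-{i}. \<beta> i - \<beta> k) * (\<Prod>k<n. \<beta> i - \<alpha> k)" if i: "i < n" for i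
  proof -
    have "S - {\<beta> i} = (B - {\<beta> i}) \<union> A" using SAB dis i by (auto simp: B_def)
    also have "B - {\<beta> i} = \<beta> ` ({..<n}-{i})" unfolding B_def using inj(2) i by (auto simp: inj_on_def)
    finally have e: "S - {\<beta> i} = \<beta> ` ({..<n}-{i}) \<union> A" .
    have "(\<Prod>y\<in>S-{\<beta> i}. \<beta> i - y) = (\<Prod>y\<in>\<beta> ` ({..<n}-{i}). \<beta> i - y) * (\<Prod>y\<in>A. \<beta> i - y)"
      unfolding e by (rule prod.union_disjoint) (use fin dis in \<open>auto simp: B_def\<close>)
    then show ?thesis unfolding A_def
      using inj by (simp add: prod.reindex inj_on_diff)
  qed
  have split: "sum F S = sum F A + sum F B" for F :: "real \<Rightarrow> real"
    using sum.union_disjoint[OF fin dis, of F] by (simp only: SAB)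
  have "(\<Sum>x\<in>S. (poly r x)^2 * G x / (\<Prod>y\<in>S-{x}. x - y)) =
     (\<Sum>x\<in>A. (poly r x)^2 * G x / (\<Prod>y\<in>S-{x}. x - y)) + (\<Sum>x\<in>B. (poly r x)^2 * G x / (\<Prod>y\<in>S-{x}. x - y))"
    by (rule split)
  also have "\<dots> = (\<Sum>i<n. (poly r (\<alpha> i))^2 * G (\<alpha> i) / ((\<Prod>k\<in>{..<n}-{i}. \<alpha> i - \<alpha> k) * (\<Prod>k<n. \<alpha> i - \<beta> k)))
    + (\<Sum>j<n. (poly r (\<beta> j))^2 * G (\<beta> j) / ((\<Prod>k\<in>{..<n}-{j}. \<beta> j - \<beta> k) * (\<Prod>k<n. \<beta> j - \<alpha> k)))"
    unfolding A_def B_def sum.reindex[OF inj(1)] sum.reindex[OF inj(2)] o_def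
    using PA PB by (intro arg_cong2[where f = "(+)"] sum.cong) auto
  also have "0 \<le> \<dots>"
    by (rule op_monotone_interlacing[OF op real _ lt1 lt2 deg]) (use S SAB in \<open>auto simp: A_def\<close>)
  finally show ?thesis .
qed

text \<open>Writing the products with \<open>y - x\<close> makes the sign of the inequality
  independent of the parity of the number of nodes. An odd node set is completed by one more node,
  which is then sent to infinity.\<close>

lemma op_monotone_divided_difference:
  fixes S :: "real set"
  assumes op: "op_monotone g" and real: "\<And>t. 0 < t \<Longrightarrow> g (of_real t) = of_real (G t)"
    and S: "finite S" "\<And>x. x \<in> S \<Longrightarrow> 0 < x" and deg: "2 * degree r + 2 \<le> card S"
  shows "(\<Sum>x\<in>S. (poly r x)^2 * G x / (\<Prod>y\<in>S-{x}. y - x)) \<le> 0"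
proof -
  have flip: "(\<Prod>y\<in>S-{x}. y - x) = (-1)^(card S - 1) * (\<Prod>y\<in>S-{x}. x - y)" if "x \<in> S" for x
  proof -
    have "(\<Prod>y\<in>S-{x}. y - x) = (\<Prod>y\<in>S-{x}. (-1) * (x - y))" by simp
    also have "\<dots> = (-1)^(card (S-{x})) * (\<Prod>y\<in>S-{x}. x - y)" unfolding prod.distrib by simp
    finally show ?thesis using S that by simp
  qed
  let ?F = "\<lambda>x. (poly r x)^2 * G x / (\<Prod>y\<in>S-{x}. x - y)"
  show ?thesis
  proof (cases "even (card S)")
    case True
    then obtain n where n: "card S = 2 * n" by blast
    have "odd (card S - 1)" using True deg by simp
    then have "(\<Sum>x\<in>S. (poly r x)^2 * G x / (\<Prod>y\<in>S-{x}. y - x)) = (\<Sum>x\<in>S. - ?F x)"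
      by (intro sum.cong) (auto simp: flip)
    moreover have "0 \<le> (\<Sum>x\<in>S. ?F x)" by (rule op_monotone_even[OF op real S n]) (use deg n in auto)
    ultimately show ?thesis by (simp add: sum_negf)
  next
    case False
    then obtain n where n: "card S = 2 * n + 1" using oddE by blast
    have eq: "(\<Sum>x\<in>S. (poly r x)^2 * G x / (\<Prod>y\<in>S-{x}. y - x)) = (\<Sum>x\<in>S. ?F x)"
      by (intro sum.cong) (auto simp: flip n)
    define a where "a = (\<Sum>x\<in>S. x * ?F x)"
    define b where "b = (\<Sum>x\<in>S. ?F x)"
    define Y where "Y = Max (insert 0 S)"
    \<comment> \<open>The extra node \<open>y\<close> is made a root of \<open>?r\<close>, so it
      contributes no term of its own, and every other term merely gains the factor
      \<open>x - y\<close>. An inequality affine in \<open>y\<close> for all large \<open>y\<close>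
      forces the sign of its slope.\<close>
    have big: "b * y \<le> a" if y: "Y < y" for y
    proof -
      have yS: "y \<notin> S" "0 < y" "\<And>x. x \<in> S \<Longrightarrow> x < y" using y S unfolding Y_def
        by (auto simp: Max_less_iff)
      let ?r = "r * [:- y, 1:]"
      have dr: "degree ?r < n + 1"
      proof -
        have "degree ?r \<le> degree r + degree [:- y, 1:]" by (rule degree_mult_le)
        then show ?thesis using deg n by simp
      qed
      have "0 \<le> (\<Sum>x\<in>insert y S. (poly ?r x)^2 * G x / (\<Prod>z\<in>insert y S-{x}. x - z))"
        by (rule op_monotone_even[OF op real _ _ _ dr]) (use S yS n in auto)
      also have "\<dots> = (\<Sum>x\<in>S. (poly ?r x)^2 * G x / (\<Prod>z\<in>insert y S-{x}. x - z))"
        using S yS by simp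
      also have "\<dots> = (\<Sum>x\<in>S. (x - y) * ?F x)"
      proof (rule sum.cong)
        fix x assume x: "x \<in> S"
        then have u0: "x - y \<noteq> 0" using yS by auto
        have alg: "(v * u)^2 * h / (u * w) = u * (v^2 * h / w)" if "u \<noteq> 0" for u v w h :: real
          using that by (simp add: power2_eq_square)
        have "insert y S - {x} = insert y (S - {x})" using x yS by auto
        then have "(\<Prod>z\<in>insert y S-{x}. x - z) = (x - y) * (\<Prod>z\<in>S-{x}. x - z)" using S yS by simp
        moreover have "poly ?r x = poly r x * (x - y)" by (simp add: algebra_simps)
        ultimately show "(poly ?r x)^2 * G x / (\<Prod>z\<in>insert y S-{x}. x - z) = (x - y) * ?F x"
          by (simp only: alg[OF u0])
      qed simp
      also have "\<dots> = (\<Sum>x\<in>S. x * ?F x - y * ?F x)" by (simp only: left_diff_distrib)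
      also have "\<dots> = a - y * b" by (simp only: a_def b_def sum_subtractf sum_distrib_left)
      finally show ?thesis by (simp add: mult.commute)
    qed
    have "b \<le> 0"
    proof (rule ccontr)
      assume b: "\<not> b \<le> 0"
      define y where "y = max (Y + 1) (a / b + 1)"
      have "b * (a / b + 1) \<le> b * y" using b by (intro mult_left_mono) (auto simp: y_def)
      moreover have "b * y \<le> a" by (rule big) (simp add: y_def less_max_iff_disj)
      moreover have "b * (a / b + 1) = a + b" using b by (simp add: field_simps)
      ultimately show False using b by linarith
    qed
    then show ?thesis by (simp add: eq b_def)
  qed
qed

text \<open>The factor \<open>1 / x\<close> comes from an additional node \<open>e\<close> that
  tends to 0 from the right. The term at \<open>e\<close> is nonnegative, as \<open>e\<close> lies
  to the left of \<open>S\<close>, and is discarded before the limit, so nothing about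
  \<open>G\<close> near 0 enters.\<close>

lemma op_monotone_divided_difference_over_id:
  fixes S :: "real set"
  assumes op: "op_monotone g" and real: "\<And>t. 0 < t \<Longrightarrow> g (of_real t) = of_real (G t)"
    and Gpos: "\<And>t. 0 < t \<Longrightarrow> 0 \<le> G t"
    and S: "finite S" "\<And>x. x \<in> S \<Longrightarrow> 0 < x" and deg: "2 * degree p + 1 \<le> card S"
  shows "0 \<le> (\<Sum>x\<in>S. (poly p x)^2 * G x / (x * (\<Prod>y\<in>S-{x}. y - x)))"
proof -
  define f where "f = (\<lambda>e. \<Sum>x\<in>S. (poly p x)^2 * G x / ((e - x) * (\<Prod>y\<in>S-{x}. y - x)))"
  have "S \<noteq> {}" using deg by auto
  then have m: "0 < Min S" using S by simp
  have neg: "f e \<le> 0" if e: "0 < e" "e < Min S" for e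
  proof -
    have eS1: "e < x" if "x \<in> S" for x using Min_le[OF S(1) that] e by linarith
    then have eS: "\<And>x. x \<in> S \<Longrightarrow> e < x" "e \<notin> S" by blast+
    have "(\<Sum>x\<in>insert e S. (poly p x)^2 * G x / (\<Prod>y\<in>insert e S-{x}. y - x)) \<le> 0"
      by (rule op_monotone_divided_difference[OF op real]) (use S eS e deg in auto)
    also have "(\<Sum>x\<in>insert e S. (poly p x)^2 * G x / (\<Prod>y\<in>insert e S-{x}. y - x)) =
        (poly p e)^2 * G e / (\<Prod>y\<in>S. y - e) + (\<Sum>x\<in>S. (poly p x)^2 * G x / (\<Prod>y\<in>insert e S-{x}. y - x))"
      using S eS by simp
    also have "(\<Sum>x\<in>S. (poly p x)^2 * G x / (\<Prod>y\<in>insert e S-{x}. y - x)) = f e"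
      unfolding f_def
    proof (rule sum.cong)
      fix x assume x: "x \<in> S"
      have "insert e S - {x} = insert e (S - {x})" using x eS by auto
      then have "(\<Prod>y\<in>insert e S-{x}. y - x) = (e - x) * (\<Prod>y\<in>S-{x}. y - x)" using S eS by simp
      then show "(poly p x)^2 * G x / (\<Prod>y\<in>insert e S-{x}. y - x) = (poly p x)^2 * G x / ((e - x) * (\<Prod>y\<in>S-{x}. y - x))"
        by simp
    qed simp
    finally have "(poly p e)^2 * G e / (\<Prod>y\<in>S. y - e) + f e \<le> 0" .
    moreover have "0 \<le> (poly p e)^2 * G e / (\<Prod>y\<in>S. y - e)"
      using Gpos[OF e(1)] eS by (intro divide_nonneg_nonneg mult_nonneg_nonneg prod_nonneg) (auto intro: less_imp_le)
    ultimately show ?thesis by linarith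
  qed
  have "(f \<longlongrightarrow> f 0) (at_right 0)"
    unfolding f_def
  proof (intro tendsto_intros)
    fix x assume x: "x \<in> S"
    show "(0 - x) * (\<Prod>y\<in>S-{x}. y - x) \<noteq> 0" using S(2)[OF x] S(1) by auto
  qed
  moreover have "\<forall>\<^sub>F e in at_right 0. f e \<le> 0"
    using eventually_at_right_less[of 0] eventually_at_right_real[OF m]
    by eventually_elim (rule neg, auto)
  ultimately have "f 0 \<le> 0" by (intro tendsto_upperbound[of f "f 0" "at_right 0" 0]) auto
  moreover have "f 0 = - (\<Sum>x\<in>S. (poly p x)^2 * G x / (x * (\<Prod>y\<in>S-{x}. y - x)))"
    unfolding f_def sum_negf[symmetric] by (rule sum.cong) auto
  ultimately show ?thesis by simp
qed

text \<open>Certificates for polynomials of degree at most \<open>d\<close> that are nonnegative on \<open>(-\<infinity>, 0]\<close>.\<close>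

inductive sos_neg :: "nat \<Rightarrow> real poly \<Rightarrow> bool" where
  square: "2 * degree p \<le> d \<Longrightarrow> sos_neg d (p * p)"
| neg_square: "2 * degree r + 1 \<le> d \<Longrightarrow> sos_neg d ([:0, -1:] * (r * r))"
| add: "sos_neg d p \<Longrightarrow> sos_neg d q \<Longrightarrow> sos_neg d (p + q)"

lemma sos_neg_mult_square:
  assumes "sos_neg e q" "2 * degree p \<le> d"
  shows "sos_neg (d + e) (p * p * q)"
  using assms
proof (induct rule: sos_neg.induct)
  case (square q e)
  have "degree (p * q) \<le> degree p + degree q" by (rule degree_mult_le)
  then have "sos_neg (d + e) ((p * q) * (p * q))" using square by (intro sos_neg.square) auto
  then show ?case by (simp add: mult_ac)
next
  case (neg_square r e)
  have "degree (p * r) \<le> degree p + degree r" by (rule degree_mult_le)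
  then have "sos_neg (d + e) ([:0, -1:] * ((p * r) * (p * r)))" using neg_square by (intro sos_neg.neg_square) auto
  moreover have eq: "[:0, -1:] * ((p * r) * (p * r)) = p * p * ([:0, -1:] * (r * r))" by (simp only: mult_ac)
  ultimately show ?case unfolding eq by (elim asm_rl)
next
  case (add e q q')
  then show ?case by (simp only: distrib_left sos_neg.add)
qed

lemma sos_neg_mult_neg_square:
  assumes "sos_neg e q" "2 * degree p + 1 \<le> d"
  shows "sos_neg (d + e) ([:0, -1:] * (p * p) * q)"
  using assms
proof (induct rule: sos_neg.induct)
  case (square q e)
  have "degree (p * q) \<le> degree p + degree q" by (rule degree_mult_le)
  then have "sos_neg (d + e) ([:0, -1:] * ((p * q) * (p * q)))" using square by (intro sos_neg.neg_square) auto
  moreover have eq: "[:0, -1:] * ((p * q) * (p * q)) = [:0, -1:] * (p * p) * (q * q)" by (simp only: mult_ac)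
  ultimately show ?case unfolding eq by (elim asm_rl)
next
  case (neg_square r e)
  \<comment> \<open>Two factors \<open>-x\<close> combine into the square of \<open>-x p r\<close>;
    the two extra units in the degree bounds pay exactly for the additional degree.\<close>
  have "degree ([:0, -1:] * (p * r)) \<le> degree [:0, -1 :: real:] + degree (p * r)" by (rule degree_mult_le)
  also have "\<dots> \<le> 1 + (degree p + degree r)" using degree_mult_le[of p r] by simp
  finally have "sos_neg (d + e) (([:0, -1:] * (p * r)) * ([:0, -1:] * (p * r)))"
    using neg_square by (intro sos_neg.square) auto
  moreover have eq: "([:0, -1:] * (p * r)) * ([:0, -1:] * (p * r)) = [:0, -1:] * (p * p) * ([:0, -1:] * (r * r))"
    by (simp only: mult_ac)
  ultimately show ?case unfolding eq by (elim asm_rl)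
next
  case (add e q q')
  then show ?case by (simp only: distrib_left sos_neg.add)
qed

lemma sos_neg_mult:
  assumes "sos_neg d p" "sos_neg e q"
  shows "sos_neg (d + e) (p * q)"
  using assms(1)
proof (induct rule: sos_neg.induct)
  case (square p d)
  then show ?case by (rule sos_neg_mult_square[OF assms(2)])
next
  case (neg_square r d)
  then show ?case by (rule sos_neg_mult_neg_square[OF assms(2)])
next
  case (add d p p')
  then show ?case by (simp only: distrib_right sos_neg.add)
qed

lemma poly_nonneg_at_limit:
  fixes p :: "real poly"
  assumes "\<And>x. x < a \<Longrightarrow> 0 \<le> poly p x"
  shows "0 \<le> poly p a"
proof (rule tendsto_lowerbound[of "poly p" _ "at_left a"])
  show "(poly p \<longlongrightarrow> poly p a) (at_left a)" by (intro tendsto_intros tendsto_ident_at)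
  show "\<forall>\<^sub>F x in at_left a. 0 \<le> poly p x" 
    using eventually_at_left_real[of "a - 1" a] by (auto elim!: eventually_mono intro: assms)
qed simp

lemma poly_map_of_real_pCons:
  "poly (map_poly complex_of_real (pCons a u)) w = of_real a + w * poly (map_poly complex_of_real u) w"
  by (simp add: Polynomial.map_poly_pCons)

lemma poly_map_of_real: "poly (map_poly complex_of_real u) (of_real a) = of_real (poly u a)"
  by (induct u) (simp_all add: poly_map_of_real_pCons)

lemma poly_map_of_real_add:
  "poly (map_poly complex_of_real (u + v)) w = poly (map_poly complex_of_real u) w + poly (map_poly complex_of_real v) w"
  by (induct u v rule: poly_induct2) (simp_all add: poly_map_of_real_pCons algebra_simps)

lemma poly_map_of_real_smult:
  "poly (map_poly complex_of_real (Polynomial.smult c u)) w = of_real c * poly (map_poly complex_of_real u) w"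
  by (induct u) (simp_all add: poly_map_of_real_pCons algebra_simps)

lemma poly_map_of_real_mult:
  "poly (map_poly complex_of_real (u * v)) w = poly (map_poly complex_of_real u) w * poly (map_poly complex_of_real v) w"
  by (induct u) (simp_all add: poly_map_of_real_pCons poly_map_of_real_add poly_map_of_real_smult algebra_simps)

text \<open>The remainder is a real polynomial of degree at most 1 that vanishes at a nonreal point,
  hence it is zero.\<close>

lemma real_quadratic_dvd:
  fixes p :: "real poly"
  assumes z: "poly (map_poly complex_of_real p) (Complex a b) = 0" and b: "b \<noteq> 0"
  shows "([:- a, 1:] * [:- a, 1:] + [:b:] * [:b:]) dvd p"
proof -
  define q where "q = [:- a, 1:] * [:- a, 1:] + [:b:] * [:b:]"
  let ?c = "map_poly complex_of_real" and ?r = "p mod q"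
  have dq: "degree q = 2" by (simp add: q_def algebra_simps)
  then have "q \<noteq> 0" by force
  then have "degree ?r < 2" using degree_mod_less'[of q p] dq by (cases "?r = 0") auto
  then have "coeff ?r i = coeff [:coeff ?r 0, coeff ?r 1:] i" for i
    using coeff_eq_0[of ?r i] by (cases "i < 2") (auto simp: less_2_cases_iff coeff_pCons split: nat.splits)
  then have "?r = [:coeff ?r 0, coeff ?r 1:]" by (rule poly_eqI)
  then obtain c0 c1 where r: "?r = [:c0, c1:]" by blast
  note ev = poly_map_of_real_add poly_map_of_real_mult poly_map_of_real_pCons map_poly_0 poly_0
  have q0: "poly (?c q) (Complex a b) = 0"
    unfolding q_def ev by (simp add: complex_eq_iff)
  have "poly (?c (p div q * q + ?r)) (Complex a b) = 0" using z by (simp only: div_mult_mod_eq)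
  then have "poly (?c ?r) (Complex a b) = 0"
    unfolding poly_map_of_real_add poly_map_of_real_mult q0 by simp
  then have "c1 * b = 0" "c0 + c1 * a = 0" unfolding r ev by (auto simp: complex_eq_iff mult.commute)
  then have "?r = 0" using b r by simp
  then show ?thesis unfolding q_def[symmetric] by (simp add: dvd_eq_mod_eq_0)
qed

text \<open>Strong induction on the degree: a complex root splits off a factor that is itself a
  certificate, and the cofactor stays nonnegative on the half line. The cases are a nonreal root, a
  root on \<open>[0, \<infinity>)\<close> and a negative root.\<close>

theorem nonneg_imp_sos_neg:
  fixes p :: "real poly"
  assumes "degree p \<le> d" "\<And>x. x \<le> 0 \<Longrightarrow> 0 \<le> poly p x"
  shows "sos_neg d p"
  using assms
proof (induct "degree p" arbitrary: p d rule: less_induct)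
  case less
  show ?case
  proof (cases "degree p = 0")
    case True
    then obtain c where c: "p = [:c:]" by (rule degree_eq_zeroE)
    then have "0 \<le> c" using less.prems(2)[of 0] by simp
    then have "p = [:sqrt c:] * [:sqrt c:]" using c by simp
    then show ?thesis using sos_neg.square[of "[:sqrt c:]" d] by simp
  next
    case False
    then have p0: "p \<noteq> 0" by auto
    have "degree (map_poly complex_of_real p) \<noteq> 0" using False by (simp add: degree_map_poly)
    then have "\<not> constant (poly (map_poly complex_of_real p))" by (simp add: constant_degree)
    from Fundamental_Theorem_Algebra.fundamental_theorem_of_algebra[OF this]
    obtain z where z: "poly (map_poly complex_of_real p) z = 0" by blast
    define a where "a = Re z"
    show ?thesis
    proof (cases "Im z = 0")
      case False
      let ?q = "[:- a, 1:] * [:- a, 1:] + [:Im z:] * [:Im z:]"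
      have "?q dvd p" by (rule real_quadratic_dvd) (use z False in \<open>auto simp: a_def\<close>)
      then obtain k where k: "p = ?q * k" by (rule dvdE)
      have dq: "degree ?q = 2" by (simp add: algebra_simps)
      have k0: "k \<noteq> 0" using k p0 by auto
      have dp: "degree p = 2 + degree k" using k p0 dq degree_mult_eq[of ?q k] by (metis mult_eq_0_iff)
      have "0 \<le> poly k x" if "x \<le> 0" for x
      proof -
        have "poly ?q x = (x - a)^2 + (Im z)^2" by (simp add: power2_eq_square algebra_simps)
        then have "0 < poly ?q x" using False by (simp add: add_nonneg_pos)
        moreover have "0 \<le> poly ?q x * poly k x" using less.prems(2)[OF that] unfolding k by (simp only: poly_mult)
        ultimately show ?thesis by (simp only: zero_le_mult_iff) linarith
      qed
      then have "sos_neg (d - 2) k" using less.hyps[of k "d - 2"] dp less.prems(1) by auto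
      moreover have "sos_neg 2 ?q" by (intro sos_neg.add sos_neg.square) auto
      ultimately have "sos_neg (2 + (d - 2)) p" unfolding k by (intro sos_neg_mult) auto
      moreover have "2 + (d - 2) = d" using dp less.prems(1) by simp
      ultimately show ?thesis by (simp only:)
    next
      case True
      then have "z = of_real a" by (simp add: a_def complex_eq_iff)
      then have pa: "poly p a = 0" using z poly_map_of_real[of p a] by simp
      then obtain k where k: "p = [:- a, 1:] * k" unfolding poly_eq_0_iff_dvd by (rule dvdE)
      have k0: "k \<noteq> 0" using k p0 by auto
      have dp: "degree p = 1 + degree k" unfolding k using k0 by (subst degree_mult_eq) auto
      have px: "poly p x = (x - a) * poly k x" for x unfolding k by (simp add: algebra_simps)
      show ?thesis
      proof (cases "0 \<le> a")
        case a: True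
        have kneg: "0 \<le> poly (- k) x" if "x < 0" for x
        proof -
          have "0 \<le> (x - a) * poly k x" using less.prems(2)[of x] that px by simp
          then show ?thesis using that a by (simp add: zero_le_mult_iff)
        qed
        then have "0 \<le> poly (- k) x" if "x \<le> 0" for x
          using poly_nonneg_at_limit[of x "- k"] that by force
        then have sk: "sos_neg (d - 1) (- k)" using less.hyps[of "- k" "d - 1"] dp less.prems(1) by auto
        \<comment> \<open>The factor \<open>a - x\<close> is the certificate
          \<open>(sqrt a)^2 + (-x)\<close> of degree 1, and the sign of the cofactor is switched
          accordingly.\<close>
        have "sos_neg 1 ([:sqrt a:] * [:sqrt a:] + [:0, -1:] * (1 * 1))"
          by (intro sos_neg.add sos_neg.square sos_neg.neg_square) auto
        also have "[:sqrt a:] * [:sqrt a:] + [:0, -1:] * (1 * 1) = [:a, -1:]" using a by simp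
        finally have "sos_neg (1 + (d - 1)) ([:a, -1:] * - k)" using sk by (rule sos_neg_mult)
        moreover have "[:a, -1:] * - k = p" unfolding k by (simp add: minus_mult_left[symmetric])
        ultimately show ?thesis using dp less.prems(1) by simp
      next
        case a: False
        \<comment> \<open>A negative root is interior to the half line, so \<open>p\<close> cannot
          change sign there: \<open>k\<close> is nonpositive to its left and nonnegative to its
          right, hence vanishes at \<open>a\<close>, and the root is double.\<close>
        have "0 \<le> poly (- k) a"
        proof (rule poly_nonneg_at_limit)
          fix x assume x: "x < a"
          then have "0 \<le> (x - a) * poly k x" using less.prems(2)[of x] a px by simp
          then show "0 \<le> poly (- k) x" using x by (simp add: zero_le_mult_iff)
        qed
        moreover have "0 \<le> poly k a"
        proof (rule tendsto_lowerbound[of "poly k" _ "at_right a"])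
          show "(poly k \<longlongrightarrow> poly k a) (at_right a)" by (intro tendsto_intros tendsto_ident_at)
          have "a < 0" using a by simp
          show "\<forall>\<^sub>F x in at_right a. 0 \<le> poly k x"
            using eventually_at_right_less[of a] eventually_at_right_real[OF \<open>a < 0\<close>]
          proof eventually_elim
            case (elim x)
            then have "0 \<le> (x - a) * poly k x" using less.prems(2)[of x] px by simp
            then show ?case using elim by (simp add: zero_le_mult_iff)
          qed
        qed simp
        ultimately have "poly k a = 0" by simp
        then obtain l where l: "k = [:- a, 1:] * l" unfolding poly_eq_0_iff_dvd by (rule dvdE)
        have l0: "l \<noteq> 0" using l k0 by auto
        have dk: "degree k = 1 + degree l" unfolding l using l0 by (subst degree_mult_eq) auto
        have px': "poly p x = (x - a)^2 * poly l x" for x unfolding px unfolding l by (simp add: power2_eq_square algebra_simps)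
        have ln: "0 \<le> poly l x" if "x \<le> 0" "x \<noteq> a" for x
          using less.prems(2)[OF that(1)] that(2) unfolding px' by (simp add: zero_le_mult_iff)
        have "0 \<le> poly l a" by (rule poly_nonneg_at_limit) (use ln a in auto)
        then have "0 \<le> poly l x" if "x \<le> 0" for x using ln that by (cases "x = a") auto
        then have "sos_neg (d - 2) l" using less.hyps[of l "d - 2"] dp dk less.prems(1) by auto
        then have "sos_neg (2 + (d - 2)) ([:- a, 1:] * [:- a, 1:] * l)" by (rule sos_neg_mult_square) auto
        moreover have "[:- a, 1:] * [:- a, 1:] * l = p" unfolding k l by (simp only: mult.assoc)
        moreover have "2 + (d - 2) = d" using dp dk less.prems(1) by simp
        ultimately show ?thesis by (simp only:)
      qed
    qed
  qed
qed

section \<open>Duality between harmonic functions and nonnegative polynomials\<close>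

text \<open>Clearing denominators turns the hypothesis into nonnegativity of one polynomial
  \<open>Q\<close> on \<open>(-\<infinity>, 0]\<close>, and the conclusion is the value at
  \<open>Q\<close> of a functional \<open>L\<close>. The two kinds of certificates for
  \<open>Q\<close> match the two divided difference inequalities, including their degree
  bounds.\<close>

theorem op_monotone_dual:
  fixes S :: "real set" and c :: "real \<Rightarrow> real"
  assumes op: "op_monotone g" and real: "\<And>t. 0 < t \<Longrightarrow> g (of_real t) = of_real (G t)"
    and Gpos: "\<And>t. 0 < t \<Longrightarrow> 0 \<le> G t"
    and S: "finite S" "\<And>x. x \<in> S \<Longrightarrow> 0 < x" "S \<noteq> {}"
    and c: "\<And>s. 0 \<le> s \<Longrightarrow> s < 1 \<Longrightarrow> 0 \<le> (\<Sum>x\<in>S. c x * (x / ((1 - s) * x + s)))"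
  shows "0 \<le> (\<Sum>x\<in>S. c x * G x)"
proof -
  define Q where "Q = (\<Sum>x\<in>S. Polynomial.smult (c x * x) (\<Prod>y\<in>S-{x}. [:y, -1:]))"
  have Qp: "poly Q t = (\<Sum>x\<in>S. c x * x * (\<Prod>y\<in>S-{x}. y - t))" for t
    by (simp add: Q_def poly_sum poly_prod)
  have c1: "1 \<le> card S" using S by (simp add: Suc_le_eq card_gt_0_iff)
  have "degree (Polynomial.smult (c x * x) (\<Prod>y\<in>S-{x}. [:y, -1:])) \<le> card S - 1" if "x \<in> S" for x
  proof -
    have "degree (\<Prod>y\<in>S-{x}. [:y, -1:]) \<le> sum (degree \<circ> (\<lambda>y. [:y, -1:])) (S-{x})"
      by (rule degree_prod_sum_le) (use S in simp)
    also have "\<dots> = card S - 1" using S that by simp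
    finally show ?thesis using degree_smult_le order_trans by blast
  qed
  then have dQ: "degree Q \<le> card S - 1" unfolding Q_def by (intro degree_sum_le S)
  have Qpos: "0 \<le> poly Q t" if t: "t \<le> 0" for t
  proof -
    \<comment> \<open>Inverse of the substitution \<open>t = - s / (1 - s)\<close>, which maps
      \<open>[0, 1)\<close> onto \<open>(-\<infinity>, 0]\<close> and turns
      \<open>(1 - s) * x + s\<close> into \<open>(x - t) / (1 - t)\<close>.\<close>
    define s where "s = - t / (1 - t)"
    have s: "0 \<le> s" "s < 1" "1 - s = 1 / (1 - t)" using t by (auto simp: s_def field_simps)
    have pos: "0 < y - t" if "y \<in> S" for y using S(2)[OF that] t by simp
    have "poly Q t = (\<Prod>y\<in>S. y - t) / (1 - t) * (\<Sum>x\<in>S. c x * (x / ((1 - s) * x + s)))"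
      unfolding Qp sum_distrib_left
    proof (rule sum.cong)
      fix x assume x: "x \<in> S"
      have "(1 - s) * x + s = (x - t) / (1 - t)" unfolding s(3) by (simp add: s_def diff_divide_distrib)
      moreover have "(\<Prod>y\<in>S. y - t) = (x - t) * (\<Prod>y\<in>S-{x}. y - t)" using S x by (intro prod.remove) auto
      ultimately show "c x * x * (\<Prod>y\<in>S-{x}. y - t) = (\<Prod>y\<in>S. y - t) / (1 - t) * (c x * (x / ((1 - s) * x + s)))"
        using pos[OF x] t by simp
    qed simp
    moreover have "0 \<le> (\<Prod>y\<in>S. y - t) / (1 - t)" using pos t by (intro divide_nonneg_pos prod_nonneg) (auto intro: less_imp_le)
    ultimately show ?thesis by (simp only: mult_nonneg_nonneg c[OF s(1,2)])
  qed
  \<comment> \<open>Up to sign, the divided difference over \<open>S\<close> of \<open>P G\<close>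
    divided by the identity. At a node \<open>x\<close> all summands of \<open>Q\<close> but one
    vanish, so the weights cancel and \<open>c x * G x\<close> is left.\<close>
  define L where "L = (\<lambda>P. \<Sum>x\<in>S. poly P x * G x / (x * (\<Prod>y\<in>S-{x}. y - x)))"
  have "0 \<le> L P" if "sos_neg (card S - 1) P" for P
    using that
  proof (induct "card S - 1" P rule: sos_neg.induct)
    case (square p)
    then show ?case using op_monotone_divided_difference_over_id[OF op real Gpos S(1,2), of p] c1
      by (simp add: L_def power2_eq_square)
  next
    case (neg_square r)
    have "(\<Sum>x\<in>S. (poly r x)^2 * G x / (\<Prod>y\<in>S-{x}. y - x)) \<le> 0"
      using op_monotone_divided_difference[OF op real S(1,2), of r] neg_square c1 by simp
    moreover have "L ([:0, -1:] * (r * r)) = - (\<Sum>x\<in>S. (poly r x)^2 * G x / (\<Prod>y\<in>S-{x}. y - x))"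
      unfolding L_def sum_negf[symmetric]
    proof (rule sum.cong)
      fix x assume "x \<in> S"
      then have "x \<noteq> 0" using S(2) by force
      then show "poly ([:0, -1:] * (r * r)) x * G x / (x * (\<Prod>y\<in>S-{x}. y - x)) = - ((poly r x)^2 * G x / (\<Prod>y\<in>S-{x}. y - x))"
        by (simp add: power2_eq_square)
    qed simp
    ultimately show ?case by simp
  next
    case (add p q)
    then show ?case by (simp add: L_def distrib_right add_divide_distrib sum.distrib)
  qed
  from this[OF nonneg_imp_sos_neg[OF dQ Qpos]] have "0 \<le> L Q" .
  also have "L Q = (\<Sum>x\<in>S. c x * G x)"
    unfolding L_def
  proof (rule sum.cong)
    fix x assume x: "x \<in> S"
    have "poly Q x = (\<Sum>z\<in>S. if z = x then c x * x * (\<Prod>y\<in>S-{x}. y - x) else 0)"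
      unfolding Qp
    proof (rule sum.cong)
      fix z assume z: "z \<in> S"
      show "c z * z * (\<Prod>y\<in>S-{z}. y - x) = (if z = x then c x * x * (\<Prod>y\<in>S-{x}. y - x) else 0)"
      proof (cases "z = x")
        case False
        then have "(\<Prod>y\<in>S-{z}. y - x) = 0" using x S(1) by (intro prod_zero) auto
        then show ?thesis using False by simp
      qed simp
    qed simp
    then have "poly Q x = c x * x * (\<Prod>y\<in>S-{x}. y - x)" using x S(1) by simp
    moreover have "x \<noteq> 0" "(\<Prod>y\<in>S-{x}. y - x) \<noteq> 0" using S(2)[OF x] S(1) by auto
    ultimately show "poly Q x * G x / (x * (\<Prod>y\<in>S-{x}. y - x)) = c x * G x" by simp
  qed simp
  finally show ?thesis .
qed

section \<open>Convex combinations of harmonic functions and their limits on the slit plane\<close>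

lemma open_slit_plane: "open slit_plane"
proof -
  have "slit_plane = - \<real>\<^sub>\<le>\<^sub>0" unfolding slit_plane_def nonpos_Reals_def by auto
  moreover have "open (- \<real>\<^sub>\<le>\<^sub>0 :: complex set)"
    using closed_nonpos_Reals_complex by (rule open_Compl)
  ultimately show ?thesis by metis
qed

lemma connected_slit_plane: "connected slit_plane"
  unfolding slit_plane_def by (rule starlike_imp_connected[OF starlike_slotted_complex_plane_left])

lemma of_real_in_slit_plane: "0 < x \<Longrightarrow> of_real x \<in> slit_plane"
  by (auto simp: slit_plane_def)

text \<open>The weighted harmonic mean of 1 and \<open>z\<close>, i.e. the inverse of
  \<open>(1 - s) + s / z\<close>; the values \<open>s = 0\<close> and \<open>s = 1\<close> give 1
  and \<open>z\<close>. These are the extreme points in Loewner's integral representation.\<close>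

definition harm_rep :: "real \<Rightarrow> complex \<Rightarrow> complex" where
  "harm_rep s z = z / ((1 - of_real s) * z + of_real s)"

inductive_set harm_hull :: "(complex \<Rightarrow> complex) set" where
  harm_rep: "0 \<le> s \<Longrightarrow> s \<le> 1 \<Longrightarrow> harm_rep s \<in> harm_hull"
| mix: "f \<in> harm_hull \<Longrightarrow> g \<in> harm_hull \<Longrightarrow> 0 \<le> t \<Longrightarrow> t \<le> 1 \<Longrightarrow>
    (\<lambda>z. of_real (1 - t) * f z + of_real t * g z) \<in> harm_hull"

text \<open>A zero with \<open>s < 1\<close> would be the point \<open>- s / (1 - s)\<close>, which
  lies on the removed half line.\<close>

lemma harm_denom_nonzero:
  assumes "z \<in> slit_plane" "0 \<le> s" "s \<le> 1"
  shows "(1 - of_real s) * z + of_real s \<noteq> 0"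
proof
  assume e: "(1 - of_real s) * z + of_real s = 0"
  show False
  proof (cases "s = 1")
    case False
    then have s: "s < 1" using assms by simp
    then have "1 - complex_of_real s \<noteq> 0" by (metis diff_eq_diff_eq eq_iff_diff_eq_0 less_irrefl of_real_1 of_real_eq_iff)
    then have "z = - of_real s / (1 - of_real s)" using e by (simp add: field_simps add_eq_0_iff2)
    also have "\<dots> = of_real (- s / (1 - s))" by simp
    finally have "z = of_real (- s / (1 - s))" .
    moreover have "- s / (1 - s) \<le> 0" using s assms by (simp add: divide_nonpos_pos)
    ultimately show False using assms(1) unfolding slit_plane_def by blast
  qed (use e in simp)
qed

lemma harm_of_real: "harm_rep s (of_real x) = of_real (x / ((1 - s) * x + s))"
  by (simp add: harm_rep_def)

lemma harm_pos: "0 < x \<Longrightarrow> 0 \<le> s \<Longrightarrow> s \<le> 1 \<Longrightarrow> 0 < (1 - s) * x + s" for x s :: real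
  by (cases "s = 0") (auto intro: add_nonneg_pos)

lemma harm_le_arith:
  fixes x s :: real
  assumes "0 < x" "0 \<le> s" "s \<le> 1"
  shows "x / ((1 - s) * x + s) \<le> (1 - s) + s * x"
proof -
  have "((1 - s) + s * x) * ((1 - s) * x + s) - x = s * (1 - s) * (x - 1)^2"
    by (simp add: power2_eq_square algebra_simps)
  also have "\<dots> \<ge> 0" using assms by simp
  finally show ?thesis using harm_pos[OF assms] by (simp add: divide_le_eq)
qed

lemma harm_hull_real: "f \<in> harm_hull \<Longrightarrow> f (of_real x) \<in> \<real>"
  by (induct rule: harm_hull.induct) (auto simp: harm_of_real)

lemma harm_hull_of_real: "f \<in> harm_hull \<Longrightarrow> f (of_real x) = of_real (Re (f (of_real x)))"
  using harm_hull_real of_real_Re by metis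

text \<open>The line is the tangent at 1, and \<open>a\<close> is the slope there: it equals
  \<open>s\<close> for \<open>harm_rep s\<close> and averages under mixing. That one
  \<open>a\<close> serves all \<open>x\<close> matters later, when the points \<open>t\<close> and
  \<open>1 / t\<close> are used together.\<close>

lemma harm_hull_bounds:
  assumes "f \<in> harm_hull"
  shows "\<exists>a. 0 \<le> a \<and> a \<le> 1 \<and> (\<forall>x>0. 0 < Re (f (of_real x)) \<and> Re (f (of_real x)) \<le> (1 - a) + a * x)"
  using assms
proof (induct rule: harm_hull.induct)
  case (harm_rep s)
  then show ?case using harm_le_arith[of _ s] harm_pos[of _ s]
    by (intro exI[of _ s]) (auto simp: harm_of_real)
next
  case (mix f g t)
  then obtain a b where a: "0 \<le> a" "a \<le> 1" "\<forall>x>0. 0 < Re (f (of_real x)) \<and> Re (f (of_real x)) \<le> (1 - a) + a * x"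
    and b: "0 \<le> b" "b \<le> 1" "\<forall>x>0. 0 < Re (g (of_real x)) \<and> Re (g (of_real x)) \<le> (1 - b) + b * x" by blast
  show ?case
  proof (intro exI[of _ "(1 - t) * a + t * b"] conjI allI impI)
    show "0 \<le> (1 - t) * a + t * b" using mix a b by simp
    show "(1 - t) * a + t * b \<le> 1" using mix a b convex_bound_le[of a 1 b "1 - t" t] by simp
    fix x :: real assume x: "0 < x"
    have f: "0 < Re (f (of_real x))" "Re (f (of_real x)) \<le> (1 - a) + a * x" using a x by auto
    have g: "0 < Re (g (of_real x))" "Re (g (of_real x)) \<le> (1 - b) + b * x" using b x by auto
    have e: "Re (of_real (1 - t) * f (of_real x) + of_real t * g (of_real x)) = (1 - t) * Re (f (of_real x)) + t * Re (g (of_real x))"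
      by simp
    show "0 < Re (of_real (1 - t) * f (of_real x) + of_real t * g (of_real x))"
      unfolding e using f g mix by (cases "t = 0") (simp_all add: add_nonneg_pos)
    have "(1 - t) * Re (f (of_real x)) + t * Re (g (of_real x)) \<le> (1 - t) * ((1 - a) + a * x) + t * ((1 - b) + b * x)"
      using f g mix by (intro add_mono mult_left_mono) auto
    also have "\<dots> = (1 - ((1 - t) * a + t * b)) + ((1 - t) * a + t * b) * x" by (simp add: algebra_simps)
    finally show "Re (of_real (1 - t) * f (of_real x) + of_real t * g (of_real x)) \<le> (1 - ((1 - t) * a + t * b)) + ((1 - t) * a + t * b) * x"
      unfolding e .
  qed
qed

lemma harm_hull_range:
  assumes "f \<in> harm_hull" "0 < x"
  shows "0 \<le> Re (f (of_real x))" "Re (f (of_real x)) \<le> 1 + x"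
proof -
  obtain a where a: "0 \<le> a" "a \<le> 1" "0 < Re (f (of_real x))" "Re (f (of_real x)) \<le> (1 - a) + a * x"
    using harm_hull_bounds[OF assms(1)] assms(2) by blast
  show "0 \<le> Re (f (of_real x))" using a by simp
  have "a * x \<le> x" using a assms by (simp add: mult_left_le_one_le)
  then show "Re (f (of_real x)) \<le> 1 + x" using a by linarith
qed

lemma harm_hull_holomorphic: "f \<in> harm_hull \<Longrightarrow> f holomorphic_on slit_plane"
proof (induct rule: harm_hull.induct)
  case (harm_rep s)
  then show ?case unfolding harm_rep_def using harm_denom_nonzero by (intro holomorphic_intros) auto
next
  case (mix f g t)
  then show ?case by (intro holomorphic_intros)
qed

text \<open>The boundedness required by Montel's theorem. The denominators are continuous and
  nonzero on the compact set of pairs \<open>(s, z)\<close>, hence bounded away from 0, and mixing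
  preserves a bound on the norm.\<close>

lemma harm_hull_bounded:
  assumes K: "compact K" "K \<subseteq> slit_plane"
  shows "\<exists>B. \<forall>f\<in>harm_hull. \<forall>z\<in>K. norm (f z) \<le> B"
proof (cases "K = {}")
  case False
  let ?P = "{0..1::real} \<times> K"
  let ?d = "\<lambda>p. norm ((1 - of_real (fst p)) * snd p + complex_of_real (fst p))"
  have "continuous_on ?P ?d" by (intro continuous_intros)
  moreover have "compact ?P" using K by (intro compact_Times) auto
  moreover have "?P \<noteq> {}" using False by auto
  ultimately obtain p0 where p0: "p0 \<in> ?P" "\<And>p. p \<in> ?P \<Longrightarrow> ?d p0 \<le> ?d p"
    using continuous_attains_inf[of ?P ?d] by blast
  have d0: "0 < ?d p0" using harm_denom_nonzero[of "snd p0" "fst p0"] p0(1) K(2) by auto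
  obtain C where C: "\<And>z. z \<in> K \<Longrightarrow> norm z \<le> C" using compact_imp_bounded[OF K(1)] by (auto simp: bounded_iff)
  define B where "B = C / ?d p0"
  have "norm (f z) \<le> B" if "f \<in> harm_hull" "z \<in> K" for f z
    using that(1)
  proof (induct rule: harm_hull.induct)
    case (harm_rep s)
    have "?d p0 \<le> ?d (s, z)" using p0(2)[of "(s, z)"] harm_rep that(2) by auto
    then have "norm z / ?d (s, z) \<le> C / ?d p0"
      using d0 C[OF that(2)] by (intro frac_le) (auto intro: order_trans[OF norm_ge_zero])
    then show ?case by (simp add: harm_rep_def norm_divide B_def)
  next
    case (mix f g t)
    have "norm (of_real (1 - t) * f z + of_real t * g z) \<le> (1 - t) * norm (f z) + t * norm (g z)"
      using mix norm_triangle_ineq[of "of_real (1 - t) * f z" "of_real t * g z"]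
      by (simp only: norm_mult norm_of_real)
    also have "\<dots> \<le> B" using mix by (intro convex_bound_le) auto
    finally show ?case .
  qed
  then show ?thesis by blast
qed auto

text \<open>Separation in the finite dimensional space of values on \<open>S\<close>: if
  \<open>G\<close> had positive distance from the hull, the direction from \<open>G\<close> to a
  nearly closest member would give a functional that contradicts
  \<open>op_monotone_dual\<close>.\<close>

lemma harm_hull_approx:
  fixes S :: "real set"
  assumes op: "op_monotone g" and real: "\<And>t. 0 < t \<Longrightarrow> g (of_real t) = of_real (G t)"
    and Gpos: "\<And>t. 0 < t \<Longrightarrow> 0 \<le> G t" and G1: "G 1 = 1"
    and S: "finite S" "\<And>x. x \<in> S \<Longrightarrow> 0 < x" "1 \<in> S" and e: "0 < e"
  shows "\<exists>f\<in>harm_hull. (\<Sum>x\<in>S. (Re (f (of_real x)) - G x)^2) < e"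
proof (rule ccontr)
  assume neg: "\<not> ?thesis"
  define E where "E = (\<lambda>f :: complex \<Rightarrow> complex. \<Sum>x\<in>S. (Re (f (of_real x)) - G x)^2)"
  have low: "e \<le> E f" if "f \<in> harm_hull" for f using neg that by (force simp: E_def)
  define d where "d = Inf (E ` harm_hull)"
  have ne: "E ` harm_hull \<noteq> {}" using harm_hull.harm_rep[of 0] by auto
  have bdd: "bdd_below (E ` harm_hull)" using low by (intro bdd_belowI[of _ e]) auto
  have dE: "d \<le> E f" if "f \<in> harm_hull" for f unfolding d_def by (rule cInf_lower) (use that bdd in auto)
  have d0: "0 < d"
  proof -
    have "e \<le> d" unfolding d_def by (rule cInf_greatest[OF ne]) (use low in auto)
    then show ?thesis using e by linarith
  qed
  define B where "B = (\<Sum>x\<in>S. (1 + x)^2)"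
  have B0: "0 \<le> B" unfolding B_def by (intro sum_nonneg) auto
  \<comment> \<open>Step length for moving from \<open>y\<close> towards a harmonic function.
    \<open>B\<close> bounds the squared distance moved, so the second order term
    \<open>t^2 * B\<close> is at most \<open>t * d / 2\<close>.\<close>
  define t where "t = min 1 (d / (2 * (B + 1)))"
  have t: "0 < t" "t \<le> 1" "t * B \<le> d / 2"
  proof -
    show "0 < t" using d0 B0 by (simp add: t_def)
    show "t \<le> 1" by (simp add: t_def)
    have "t * B \<le> d / (2 * (B + 1)) * B" using B0 by (intro mult_right_mono) (auto simp: t_def)
    also have "\<dots> \<le> d / 2" using d0 B0 by (simp add: field_simps)
    finally show "t * B \<le> d / 2" .
  qed
  have "d < d + t * d / 2" using t d0 by simp
  \<comment> \<open>The infimum is not known to be attained. A slack proportional to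
    \<open>t\<close> is affordable, since it is divided out together with the first order
    term.\<close>
  then obtain y where y: "y \<in> harm_hull" "E y < d + t * d / 2"
    using cInf_lessD[OF ne, of "d + t * d / 2"] unfolding d_def by auto
  define u where "u = (\<lambda>x. Re (y (complex_of_real x)))"
  have Ey: "E y = (\<Sum>x\<in>S. (u x - G x)^2)" by (simp add: E_def u_def)
  have key: "(\<Sum>x\<in>S. (u x - G x) * G x) + d / 2 < (\<Sum>x\<in>S. (u x - G x) * (x / ((1 - s) * x + s)))"
    if s: "0 \<le> s" "s \<le> 1" for s
  proof -
    define k where "k = (\<lambda>x. x / ((1 - s) * x + s))"
    have kh: "Re (harm_rep s (of_real x)) = k x" for x unfolding harm_of_real k_def by simp
    define X where "X = (\<Sum>x\<in>S. (k x - u x) * (u x - G x))"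
    let ?z = "\<lambda>z. of_real (1 - t) * y z + of_real t * harm_rep s z"
    have "?z \<in> harm_hull" using y(1) s t by (intro harm_hull.mix harm_hull.harm_rep) auto
    then have "d \<le> E ?z" by (rule dE)
    also have "E ?z = (\<Sum>x\<in>S. (u x - G x)^2 + 2 * t * ((k x - u x) * (u x - G x)) + t^2 * (k x - u x)^2)"
      unfolding E_def
    proof (rule sum.cong)
      fix x
      have "Re (?z (of_real x)) = (1 - t) * u x + t * k x" by (simp add: u_def kh)
      then show "(Re (?z (of_real x)) - G x)^2 = (u x - G x)^2 + 2 * t * ((k x - u x) * (u x - G x)) + t^2 * (k x - u x)^2"
        by (simp only:) (simp add: power2_eq_square algebra_simps)
    qed simp
    also have "\<dots> = E y + 2 * t * X + t^2 * (\<Sum>x\<in>S. (k x - u x)^2)"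
      by (simp add: sum.distrib sum_distrib_left X_def E_def u_def)
    also have "(\<Sum>x\<in>S. (k x - u x)^2) \<le> B"
      unfolding B_def
    proof (rule sum_mono)
      fix x assume "x \<in> S"
      then have x: "0 < x" by (rule S(2))
      have "0 \<le> k x" "k x \<le> 1 + x" "0 \<le> u x" "u x \<le> 1 + x"
        using harm_hull_range[OF harm_hull.harm_rep[OF s] x] harm_hull_range[OF y(1) x] by (auto simp: kh u_def)
      then have "\<bar>k x - u x\<bar> \<le> \<bar>1 + x\<bar>" using x by linarith
      then show "(k x - u x)^2 \<le> (1 + x)^2" by (simp only: abs_le_square_iff)
    qed
    then have "E y + 2 * t * X + t^2 * (\<Sum>x\<in>S. (k x - u x)^2) \<le> E y + 2 * t * X + t^2 * B"
      by (intro add_left_mono mult_left_mono) auto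
    finally have "d \<le> E y + 2 * t * X + t^2 * B" .
    moreover have "t^2 * B \<le> t * (d / 2)" unfolding power2_eq_square mult.assoc using t by (intro mult_left_mono) auto
    ultimately have "0 < t * (2 * X + d)" using y(2) by (simp add: algebra_simps)
    then have "- (d / 2) < X" using t by (simp add: zero_less_mult_iff)
    moreover have "(\<Sum>x\<in>S. (u x - G x) * k x) - (\<Sum>x\<in>S. (u x - G x) * G x) = X + E y"
      unfolding X_def Ey sum.distrib[symmetric] sum_subtractf[symmetric]
      by (rule sum.cong) (auto simp: power2_eq_square algebra_simps)
    moreover have "d \<le> E y" by (rule dE[OF y(1)])
    ultimately show ?thesis by (simp add: k_def)
  qed
  \<comment> \<open>Every harmonic function, and \<open>G\<close> itself, equals 1 at the node 1.
    Lowering the coefficient there by \<open>\<delta>\<close> therefore subtracts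
    \<open>\<delta>\<close> from all these values of the functional; it stays positive on the
    harmonic functions and becomes \<open>- d / 2\<close> on \<open>G\<close>.\<close>
  define \<delta> where "\<delta> = (\<Sum>x\<in>S. (u x - G x) * G x) + d / 2"
  define c where "c = (\<lambda>x. (u x - G x) - (if x = 1 then \<delta> else 0))"
  have cs: "(\<Sum>x\<in>S. c x * k x) = (\<Sum>x\<in>S. (u x - G x) * k x) - \<delta> * k 1" for k
  proof -
    have "(\<Sum>x\<in>S. c x * k x) = (\<Sum>x\<in>S. (u x - G x) * k x - (if x = 1 then \<delta> * k 1 else 0))"
      by (rule sum.cong) (auto simp: c_def left_diff_distrib)
    then show ?thesis using S by (simp add: sum_subtractf)
  qed
  have "0 \<le> (\<Sum>x\<in>S. c x * G x)"
  proof (rule op_monotone_dual[OF op real Gpos S(1,2)])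
    fix s :: real assume s: "0 \<le> s" "s < 1"
    then show "0 \<le> (\<Sum>x\<in>S. c x * (x / ((1 - s) * x + s)))"
      unfolding cs using key[of s] by (simp add: \<delta>_def)
  qed (use S in auto)
  then show False unfolding cs using d0 G1 by (simp add: \<delta>_def)
qed

text \<open>Approximation on ever more nodes, a locally uniformly convergent subsequence by Montel,
  and identification of its limit with \<open>g\<close> by the identity theorem.\<close>

theorem op_mean_fun_approx:
  assumes g: "op_mean_fun g"
  obtains F where "\<And>k :: nat. F k \<in> harm_hull"
    "\<And>K. compact K \<Longrightarrow> K \<subseteq> slit_plane \<Longrightarrow> uniform_limit K F g sequentially"
proof -
  define G where "G = (\<lambda>t. Re (g (complex_of_real t)))"
  have hol: "g holomorphic_on slit_plane" and op: "op_monotone g" using g by (auto simp: op_mean_fun_def)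
  have real: "g (of_real t) = of_real (G t)" and Gpos: "0 \<le> G t" if "0 < t" for t
    using g that unfolding op_mean_fun_def G_def by (auto simp: less_imp_le)
  have G1: "G 1 = 1" using g by (simp add: op_mean_fun_def G_def)
  \<comment> \<open>Infinitely many positive nodes accumulating at 1, a point of the slit plane, as
    the identity theorem demands.\<close>
  define p where "p = (\<lambda>i::nat. 1 + 1 / (real i + 1))"
  have p1: "1 < p i" and p0: "0 < p i" for i by (simp_all add: p_def add_pos_pos)
  have "\<exists>f\<in>harm_hull. (\<Sum>x\<in>insert 1 (p ` {..<k}). (Re (f (of_real x)) - G x)^2) < (1 / (real k + 1))^2" for k
    by (rule harm_hull_approx[OF op real Gpos G1]) (use p0 in auto)
  then have "\<forall>k. \<exists>f. f \<in> harm_hull \<and> (\<Sum>x\<in>insert 1 (p ` {..<k}). (Re (f (of_real x)) - G x)^2) < (1 / (real k + 1))^2"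
    by blast
  from choice[OF this] obtain F where
    FF: "\<forall>k. F k \<in> harm_hull \<and> (\<Sum>x\<in>insert 1 (p ` {..<k}). (Re (F k (of_real x)) - G x)^2) < (1 / (real k + 1))^2" ..
  then have F: "F k \<in> harm_hull"
    and Fs: "(\<Sum>x\<in>insert 1 (p ` {..<k}). (Re (F k (of_real x)) - G x)^2) < (1 / (real k + 1))^2" for k by blast+
  have close: "norm (F k (of_real (p i)) - g (of_real (p i))) \<le> 1 / (real k + 1)" if "i < k" for i k
  proof -
    have pp: "0 < p i" using p1[of i] by simp
    have "(Re (F k (of_real (p i))) - G (p i))^2 \<le> (\<Sum>x\<in>insert 1 (p ` {..<k}). (Re (F k (of_real x)) - G x)^2)"
    proof (rule member_le_sum[of "p i" _ "\<lambda>x. (Re (F k (of_real x)) - G x)^2"])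
      show "p i \<in> insert 1 (p ` {..<k})" using that by blast
    qed simp_all
    then have "(Re (F k (of_real (p i))) - G (p i))^2 \<le> (1 / (real k + 1))^2"
      using Fs[of k] by linarith
    then have "\<bar>Re (F k (of_real (p i))) - G (p i)\<bar> \<le> \<bar>1 / (real k + 1)\<bar>"
      by (simp only: abs_le_square_iff)
    then have "\<bar>Re (F k (of_real (p i))) - G (p i)\<bar> \<le> 1 / (real k + 1)" by simp
    moreover have "F k (of_real (p i)) - g (of_real (p i)) = of_real (Re (F k (of_real (p i))) - G (p i))"
      using harm_hull_of_real[OF F, of k "p i"] real[OF pp] by simp
    ultimately show ?thesis by (simp only: norm_of_real)
  qed
  obtain h r where h: "h holomorphic_on slit_plane" and r: "strict_mono (r :: nat \<Rightarrow> nat)"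
    and lim: "\<And>x. x \<in> slit_plane \<Longrightarrow> ((\<lambda>n. F (r n) x) \<longlongrightarrow> h x) sequentially"
    and unif: "\<And>K. compact K \<Longrightarrow> K \<subseteq> slit_plane \<Longrightarrow> uniform_limit K (F \<circ> r) h sequentially"
    by (rule Montel[OF open_slit_plane harm_hull_holomorphic harm_hull_bounded, of F]) (use F in auto)
  have hp: "h (of_real (p i)) = g (of_real (p i))" for i
  proof (rule LIMSEQ_unique)
    have "0 < p i" using p1[of i] by simp
    then show "(\<lambda>n. F (r n) (of_real (p i))) \<longlonglongrightarrow> h (of_real (p i))"
      by (intro lim of_real_in_slit_plane)
    have "(\<lambda>n. F (r n) (of_real (p i)) - g (of_real (p i))) \<longlonglongrightarrow> 0"
    proof (rule Lim_null_comparison)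
      show "\<forall>\<^sub>F n in sequentially. norm (F (r n) (of_real (p i)) - g (of_real (p i))) \<le> inverse (real (Suc n))"
        using eventually_gt_at_top[of i]
      proof eventually_elim
        case (elim n)
        have rn: "n \<le> r n" using r by (rule strict_mono_imp_increasing)
        have "norm (F (r n) (of_real (p i)) - g (of_real (p i))) \<le> 1 / (real (r n) + 1)"
          by (rule close) (use elim rn in simp)
        also have "\<dots> \<le> 1 / (real n + 1)" using rn by (intro frac_le) auto
        finally show ?case by (simp add: inverse_eq_divide add.commute)
      qed
      show "(\<lambda>n. inverse (real (Suc n))) \<longlonglongrightarrow> 0" by (rule LIMSEQ_inverse_real_of_nat)
    qed
    then show "(\<lambda>n. F (r n) (of_real (p i))) \<longlonglongrightarrow> g (of_real (p i))" by (rule LIM_zero_cancel)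
  qed
  have hg: "h z = g z" if "z \<in> slit_plane" for z
  proof -
    have "h z - g z = 0"
    proof (rule analytic_continuation[of "\<lambda>z. h z - g z" slit_plane "range (\<lambda>i. complex_of_real (p i))" 1 z])
      show "range (\<lambda>i. complex_of_real (p i)) \<subseteq> slit_plane"
        using p0 by (auto intro!: of_real_in_slit_plane)
      show "1 \<in> slit_plane" using of_real_in_slit_plane[of 1] by simp
      show "1 islimpt range (\<lambda>i. complex_of_real (p i))"
        unfolding islimpt_approachable
      proof (intro allI impI)
        fix e :: real assume "0 < e"
        then obtain n where n: "1 / of_nat (Suc n) < e" by (rule nat_approx_posE)
        have "complex_of_real (p n) - 1 = of_real (1 / (real n + 1))" by (simp add: p_def)
        then have "dist (complex_of_real (p n)) 1 = 1 / (real n + 1)" unfolding dist_norm by (simp only: norm_of_real) simp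
        moreover have "complex_of_real (p n) \<noteq> 1" using p1[of n] by (metis less_irrefl of_real_eq_1_iff)
        ultimately show "\<exists>x'\<in>range (\<lambda>i. complex_of_real (p i)). x' \<noteq> 1 \<and> dist x' 1 < e"
          using n by (intro bexI[of _ "complex_of_real (p n)"]) (auto simp: add.commute)
      qed
    qed (use hp h hol that open_slit_plane connected_slit_plane in \<open>auto intro: holomorphic_intros\<close>)
    then show ?thesis by simp
  qed
  show ?thesis
  proof (rule that[of "F \<circ> r"])
    show "(F \<circ> r) k \<in> harm_hull" for k using F by simp
    fix K assume K: "compact K" "K \<subseteq> slit_plane"
    show "uniform_limit K (F \<circ> r) g sequentially"
      using unif[OF K] by (rule uniform_limit_cong'[THEN iffD1, rotated 2]) (use hg K in auto)
  qed
qed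

section \<open>Sectorial matrices and their means\<close>

lemma smult_mat_vec:
  fixes A :: "complex mat"
  assumes "A \<in> carrier_mat n m" "v \<in> carrier_vec m"
  shows "(c \<cdot>\<^sub>m A) *\<^sub>v v = c \<cdot>\<^sub>v (A *\<^sub>v v)"
proof (rule eq_vecI)
  fix i assume "i < dim_vec (c \<cdot>\<^sub>v (A *\<^sub>v v))"
  then have i: "i < n" using assms by simp
  have "c \<cdot>\<^sub>m A \<in> carrier_mat n m" using assms by simp
  from mat_vec_index_sum[OF this assms(2) i] mat_vec_index_sum[OF assms i]
  show "((c \<cdot>\<^sub>m A) *\<^sub>v v) $ i = (c \<cdot>\<^sub>v (A *\<^sub>v v)) $ i"
    using i assms by (simp add: sum_distrib_left mult.assoc del: index_mult_mat_vec)
qed (use assms in simp)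

lemma lincomb_mat_vec:
  fixes A B :: "complex mat"
  assumes "A \<in> carrier_mat n n" "B \<in> carrier_mat n n" "v \<in> carrier_vec n"
  shows "(a \<cdot>\<^sub>m A + b \<cdot>\<^sub>m B) *\<^sub>v v = a \<cdot>\<^sub>v (A *\<^sub>v v) + b \<cdot>\<^sub>v (B *\<^sub>v v)"
  using assms by (simp add: add_mult_distrib_mat_vec[of _ n n] smult_mat_vec[of _ n n])

lemma lincomb_cscalar_prod:
  fixes u v w :: "complex vec"
  assumes "u \<in> carrier_vec n" "v \<in> carrier_vec n" "w \<in> carrier_vec n"
  shows "(a \<cdot>\<^sub>v u + b \<cdot>\<^sub>v v) \<bullet>c w = a * (u \<bullet>c w) + b * (v \<bullet>c w)"
    and "w \<bullet>c (a \<cdot>\<^sub>v u + b \<cdot>\<^sub>v v) = cnj a * (w \<bullet>c u) + cnj b * (w \<bullet>c v)"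
  using assms by (simp_all add: cscalar_prod_add_left[of _ n] cscalar_prod_add_right[of _ n]
    cscalar_prod_smult_left[of _ n] cscalar_prod_smult_right[of _ n])

lemma minv_inverse:
  fixes X :: "complex mat"
  assumes X: "X \<in> carrier_mat n n" and inj: "\<And>x. x \<in> carrier_vec n \<Longrightarrow> X *\<^sub>v x = 0\<^sub>v n \<Longrightarrow> x = 0\<^sub>v n"
  shows "minv X \<in> carrier_mat n n" "X * minv X = 1\<^sub>m n" "minv X * X = 1\<^sub>m n"
proof -
  have "det X \<noteq> 0" using det_0_iff_vec_prod_zero[OF X] inj by blast
  then have "(1 / det X) \<cdot>\<^sub>m (det X \<cdot>\<^sub>m 1\<^sub>m n) = 1\<^sub>m n" by (intro eq_matI) auto
  then have "X * ((1 / det X) \<cdot>\<^sub>m adj_mat X) = 1\<^sub>m n" "((1 / det X) \<cdot>\<^sub>m adj_mat X) * X = 1\<^sub>m n"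
    using mult_smult_distrib[OF X adj_mat(1)[OF X], of "1 / det X"] adj_mat(2,3)[OF X]
      mult_smult_assoc_mat[OF adj_mat(1)[OF X] X, of "1 / det X"] by auto
  moreover have "(1 / det X) \<cdot>\<^sub>m adj_mat X \<in> carrier_mat n n" using adj_mat(1)[OF X] by simp
  ultimately have "\<exists>B. B \<in> carrier_mat n n \<and> X * B = 1\<^sub>m n \<and> B * X = 1\<^sub>m n" by blast
  from someI_ex[OF this] show "minv X \<in> carrier_mat n n" "X * minv X = 1\<^sub>m n" "minv X * X = 1\<^sub>m n"
    using X unfolding minv_def by auto
qed

text \<open>The homogeneous version of \<open>sector\<close>: all vectors instead of unit vectors,
  with \<open>T\<close> in the role of \<open>tan \<theta>\<close>. The bound on the imaginary part
  is also asserted at the zero vector, so that case distinctions are confined to strict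
  positivity.\<close>

definition sectorial :: "nat \<Rightarrow> real \<Rightarrow> complex mat \<Rightarrow> bool" where
  "sectorial n T X \<longleftrightarrow> X \<in> carrier_mat n n \<and> (\<forall>x \<in> carrier_vec n.
     \<bar>Im ((X *\<^sub>v x) \<bullet>c x)\<bar> \<le> T * Re ((X *\<^sub>v x) \<bullet>c x) \<and> (x \<noteq> 0\<^sub>v n \<longrightarrow> 0 < Re ((X *\<^sub>v x) \<bullet>c x)))"

lemma sectorialD:
  assumes "sectorial n T X"
  shows "X \<in> carrier_mat n n"
    "\<And>x. x \<in> carrier_vec n \<Longrightarrow> \<bar>Im ((X *\<^sub>v x) \<bullet>c x)\<bar> \<le> T * Re ((X *\<^sub>v x) \<bullet>c x)"
    "\<And>x. x \<in> carrier_vec n \<Longrightarrow> x \<noteq> 0\<^sub>v n \<Longrightarrow> 0 < Re ((X *\<^sub>v x) \<bullet>c x)"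
  using assms unfolding sectorial_def by auto

lemma sectorial_nonneg:
  assumes X: "sectorial n T X" and x: "x \<in> carrier_vec n"
  shows "0 \<le> Re ((X *\<^sub>v x) \<bullet>c x)"
proof (cases "x = 0\<^sub>v n")
  case True
  then show ?thesis using mult_mat_zero_vec[OF sectorialD(1)[OF X]] by (simp add: cscalar_prod_zero_left[of _ n])
qed (use sectorialD(3)[OF X x] in simp)

lemma sector_imp_sectorial:
  assumes "A \<in> sector n \<theta>"
  shows "sectorial n (tan \<theta>) A"
  unfolding sectorial_def
proof (intro conjI ballI)
  show A: "A \<in> carrier_mat n n" using assms by (simp add: sector_def)
  fix x :: "complex vec" assume x: "x \<in> carrier_vec n"
  have "\<bar>Im ((A *\<^sub>v x) \<bullet>c x)\<bar> \<le> tan \<theta> * Re ((A *\<^sub>v x) \<bullet>c x) \<and> 0 < Re ((A *\<^sub>v x) \<bullet>c x)" if x0: "x \<noteq> 0\<^sub>v n"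
  proof -
    define r where "r = 1 / sqrt (vnorm2 x)"
    have p: "0 < vnorm2 x" by (rule vnorm2_pos[OF x x0])
    have r: "0 < r" "r^2 * vnorm2 x = 1" using p by (auto simp: r_def power_divide)
    define y where "y = complex_of_real r \<cdot>\<^sub>v x"
    have y: "y \<in> carrier_vec n" using x by (simp add: y_def)
    have sc: "(complex_of_real r \<cdot>\<^sub>v u) \<bullet>c (complex_of_real r \<cdot>\<^sub>v v) = of_real (r^2) * (u \<bullet>c v)"
      if "u \<in> carrier_vec n" "v \<in> carrier_vec n" for u v
      using that by (simp add: cscalar_prod_smult_left[of _ n] cscalar_prod_smult_right[of _ n] power2_eq_square)
    have "y \<bullet>c y = of_real (r^2 * vnorm2 x)" unfolding y_def sc[OF x x] cscalar_prod_self[OF x] by simp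
    then have "y \<bullet>c y = 1" using r by simp
    then have "(A *\<^sub>v y) \<bullet>c y \<in> num_range A" using y A unfolding num_range_def by blast
    then have "0 < Re ((A *\<^sub>v y) \<bullet>c y)" "\<bar>Im ((A *\<^sub>v y) \<bullet>c y)\<bar> \<le> Re ((A *\<^sub>v y) \<bullet>c y) * tan \<theta>"
      using assms by (auto simp: sector_def)
    moreover have "(A *\<^sub>v y) \<bullet>c y = of_real (r^2) * ((A *\<^sub>v x) \<bullet>c x)"
    proof -
      have "A *\<^sub>v y = complex_of_real r \<cdot>\<^sub>v (A *\<^sub>v x)" unfolding y_def by (rule mult_mat_vec[OF A x])
      then show ?thesis unfolding y_def using sc[of "A *\<^sub>v x" x] A x by simp
    qed
    ultimately have *: "0 < r^2 * Re ((A *\<^sub>v x) \<bullet>c x)"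
      "\<bar>r^2 * Im ((A *\<^sub>v x) \<bullet>c x)\<bar> \<le> (r^2 * Re ((A *\<^sub>v x) \<bullet>c x)) * tan \<theta>" by simp_all
    have r2: "0 < r^2" using r by simp
    have "r^2 * \<bar>Im ((A *\<^sub>v x) \<bullet>c x)\<bar> \<le> r^2 * (tan \<theta> * Re ((A *\<^sub>v x) \<bullet>c x))"
      using *(2) r2 by (simp add: abs_mult mult_ac)
    then show ?thesis using *(1) r2 by (simp add: zero_less_mult_iff)
  qed
  moreover have "(A *\<^sub>v 0\<^sub>v n) \<bullet>c (0\<^sub>v n :: complex vec) = 0"
    unfolding mult_mat_zero_vec[OF A] by (rule cscalar_prod_zero_left) simp
  ultimately show "\<bar>Im ((A *\<^sub>v x) \<bullet>c x)\<bar> \<le> tan \<theta> * Re ((A *\<^sub>v x) \<bullet>c x)"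
    "x \<noteq> 0\<^sub>v n \<longrightarrow> 0 < Re ((A *\<^sub>v x) \<bullet>c x)"
    by (cases "x = 0\<^sub>v n"; auto)+
qed

lemma sectorial_inj:
  assumes X: "sectorial n T X" and x: "x \<in> carrier_vec n" and z: "X *\<^sub>v x = 0\<^sub>v n"
  shows "x = 0\<^sub>v n"
proof (rule ccontr)
  assume "x \<noteq> 0\<^sub>v n"
  then have "0 < Re ((X *\<^sub>v x) \<bullet>c x)" by (rule sectorialD(3)[OF X x])
  then show False unfolding z cscalar_prod_zero_left[OF x] by simp
qed

text \<open>With \<open>y = minv X x\<close>, the form of the inverse at \<open>x\<close> is the
  complex conjugate of the form of \<open>X\<close> at \<open>y\<close>, and the sector is symmetric
  under conjugation.\<close>

lemma sectorial_minv:
  assumes X: "sectorial n T X"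
  shows "minv X \<in> carrier_mat n n" "X * minv X = 1\<^sub>m n" "minv X * X = 1\<^sub>m n" "sectorial n T (minv X)"
proof -
  note inv = minv_inverse[OF sectorialD(1)[OF X] sectorial_inj[OF X]]
  show 1: "minv X \<in> carrier_mat n n" and 2: "X * minv X = 1\<^sub>m n" and "minv X * X = 1\<^sub>m n" by (rule inv; assumption)+
  show "sectorial n T (minv X)"
    unfolding sectorial_def
  proof (intro conjI ballI 1)
    fix x :: "complex vec" assume x: "x \<in> carrier_vec n"
    let ?y = "minv X *\<^sub>v x"
    have y: "?y \<in> carrier_vec n" using 1 x by simp
    have Xy: "X *\<^sub>v ?y = x" using x by (simp add: assoc_mult_mat_vec[OF sectorialD(1)[OF X] 1 x, symmetric] 2)
    have "?y \<bullet>c x = cnj ((X *\<^sub>v ?y) \<bullet>c ?y)" unfolding Xy using cscalar_prod_commute[OF x y] by simp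
    moreover have "?y \<noteq> 0\<^sub>v n" if "x \<noteq> 0\<^sub>v n" using Xy that mult_mat_zero_vec[OF sectorialD(1)[OF X]] by metis
    ultimately show "\<bar>Im (?y \<bullet>c x)\<bar> \<le> T * Re (?y \<bullet>c x)" "x \<noteq> 0\<^sub>v n \<longrightarrow> 0 < Re (?y \<bullet>c x)"
      using sectorialD(2,3)[OF X y] by auto
  qed
qed

lemma herm_part_carrier: "X \<in> carrier_mat n n \<Longrightarrow> herm_part X \<in> carrier_mat n n"
  by (simp add: herm_part_def)

lemma herm_part_hermitian:
  assumes X: "X \<in> carrier_mat n n" shows "hermitian (herm_part X)"
proof -
  note H = herm_part_carrier[OF X]
  have e: "herm_part X $$ (i,j) = (X $$ (i,j) + cnj (X $$ (j,i))) / 2" if "i < n" "j < n" for i j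
    using that X by (simp add: herm_part_def mat_adjoint_index[OF X])
  have "mat_adjoint (herm_part X) = herm_part X"
    by (rule eq_matI) (use H in \<open>auto simp: mat_adjoint_index[OF H] e add.commute\<close>)
  then show ?thesis using H by (simp add: hermitian_def)
qed

lemma herm_part_form:
  assumes X: "X \<in> carrier_mat n n" and u: "u \<in> carrier_vec n" and v: "v \<in> carrier_vec n"
  shows "(herm_part X *\<^sub>v u) \<bullet>c v = ((X *\<^sub>v u) \<bullet>c v + u \<bullet>c (X *\<^sub>v v)) / 2"
proof -
  note X' = mat_adjoint_carrier[OF X]
  have "herm_part X *\<^sub>v u = (1/2) \<cdot>\<^sub>v (X *\<^sub>v u + mat_adjoint X *\<^sub>v u)"
    unfolding herm_part_def using X X' u
    by (simp add: smult_mat_vec[of _ n n] add_mult_distrib_mat_vec[of _ n n])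
  then show ?thesis
    using X X' u v mult_mat_vec_carrier[OF X' u] mult_mat_vec_carrier[OF X u]
    by (simp add: cscalar_prod_smult_left[of _ n] cscalar_prod_add_left[of _ n] adjoint_cscalar_prod'[OF X])
qed

lemma herm_part_quadratic_form:
  assumes X: "X \<in> carrier_mat n n" and u: "u \<in> carrier_vec n"
  shows "(herm_part X *\<^sub>v u) \<bullet>c u = of_real (Re ((X *\<^sub>v u) \<bullet>c u))"
proof -
  have "u \<bullet>c (X *\<^sub>v u) = cnj ((X *\<^sub>v u) \<bullet>c u)"
    using cscalar_prod_commute[of "X *\<^sub>v u" n u] X u by simp
  then show ?thesis unfolding herm_part_form[OF X u u] by (simp add: complex_eq_iff)
qed

lemma sectorial_pd_herm_part:
  assumes X: "sectorial n T X" shows "pd (herm_part X)"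
  unfolding pd_def
  using herm_part_hermitian[OF sectorialD(1)[OF X]] herm_part_carrier[OF sectorialD(1)[OF X]]
    herm_part_quadratic_form[OF sectorialD(1)[OF X]] sectorialD(3)[OF X] by auto

text \<open>Diagonalize real and imaginary part simultaneously: the form of \<open>X\<close> becomes
  \<open>\<Sum> (1 + i \<tau>\<^sub>k) c\<^sub>k cnj d\<^sub>k\<close> with \<open>\<bar>\<tau>\<^sub>k\<bar> \<le> T\<close>.\<close>

lemma sectorial_cauchy_schwarz:
  assumes X: "sectorial n T X" and u: "u \<in> carrier_vec n" and v: "v \<in> carrier_vec n"
  shows "(cmod ((X *\<^sub>v u) \<bullet>c v))^2 \<le> (1 + T^2) * Re ((X *\<^sub>v u) \<bullet>c u) * Re ((X *\<^sub>v v) \<bullet>c v)"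
proof -
  note Xc = sectorialD(1)[OF X]
  let ?P = "herm_part X"
  define Q where "Q = herm_part ((- \<i>) \<cdot>\<^sub>m X)"
  have iX: "(- \<i>) \<cdot>\<^sub>m X \<in> carrier_mat n n" using Xc by simp
  have Qform: "(Q *\<^sub>v a) \<bullet>c b = (- \<i> * ((X *\<^sub>v a) \<bullet>c b) + \<i> * (a \<bullet>c (X *\<^sub>v b))) / 2"
    if "a \<in> carrier_vec n" "b \<in> carrier_vec n" for a b
    unfolding Q_def herm_part_form[OF iX that] using that Xc
    by (simp add: smult_mat_vec[OF Xc] cscalar_prod_smult_left[of _ n] cscalar_prod_smult_right[of _ n])
  have split: "(X *\<^sub>v a) \<bullet>c b = (?P *\<^sub>v a) \<bullet>c b + \<i> * ((Q *\<^sub>v a) \<bullet>c b)"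
    if "a \<in> carrier_vec n" "b \<in> carrier_vec n" for a b
    unfolding Qform[OF that] herm_part_form[OF Xc that] by (simp add: field_simps)
  obtain W V t where W: "W \<in> carrier_mat n n" and V: "V \<in> carrier_mat n n" and WV: "W * V = 1\<^sub>m n" "V * W = 1\<^sub>m n"
    and Pf: "\<And>x y. x \<in> carrier_vec n \<Longrightarrow> y \<in> carrier_vec n \<Longrightarrow>
       (?P *\<^sub>v x) \<bullet>c y = (\<Sum>i<n. (W *\<^sub>v x) $ i * cnj ((W *\<^sub>v y) $ i))"
    and Qf: "\<And>x y. x \<in> carrier_vec n \<Longrightarrow> y \<in> carrier_vec n \<Longrightarrow>
       (Q *\<^sub>v x) \<bullet>c y = (\<Sum>i<n. of_real (t i) * (W *\<^sub>v x) $ i * cnj ((W *\<^sub>v y) $ i))"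
    by (rule simultaneous_diagonalization[OF herm_part_carrier[OF Xc] sectorial_pd_herm_part[OF X]
        herm_part_carrier[OF iX] herm_part_hermitian[OF iX]]) (unfold Q_def, blast)
  have form: "(X *\<^sub>v a) \<bullet>c b = (\<Sum>i<n. ((1 + \<i> * of_real (t i)) * (W *\<^sub>v a) $ i) * cnj ((W *\<^sub>v b) $ i))"
    if "a \<in> carrier_vec n" "b \<in> carrier_vec n" for a b
    unfolding split[OF that] Pf[OF that] Qf[OF that] sum_distrib_left sum.distrib[symmetric]
    by (rule sum.cong) (simp_all add: algebra_simps del: index_mult_mat_vec)
  have re: "Re ((X *\<^sub>v a) \<bullet>c a) = (\<Sum>i<n. (cmod ((W *\<^sub>v a) $ i))^2)" if a: "a \<in> carrier_vec n" for a
  proof -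
    have "of_real (Re ((X *\<^sub>v a) \<bullet>c a)) = (\<Sum>i<n. (W *\<^sub>v a) $ i * cnj ((W *\<^sub>v a) $ i))"
      unfolding herm_part_quadratic_form[OF Xc a, symmetric] by (rule Pf[OF a a])
    also have "\<dots> = of_real (\<Sum>i<n. (cmod ((W *\<^sub>v a) $ i))^2)"
      by (simp add: complex_norm_square[symmetric] del: complex_mult_cnj index_mult_mat_vec)
    finally show ?thesis by (simp only: of_real_eq_iff)
  qed
  \<comment> \<open>The form at the \<open>i\<close>-th column of \<open>V\<close> is exactly
    \<open>1 + i t\<close>, with \<open>t\<close> the entry in question, so the sector condition
    bounds its imaginary part.\<close>
  have tb: "(t i)^2 \<le> T^2" if i: "i < n" for i
  proof -
    let ?x = "V *\<^sub>v unit_vec n i"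
    have x: "?x \<in> carrier_vec n" using V by simp
    have Wx: "W *\<^sub>v ?x = unit_vec n i" by (simp add: assoc_mult_mat_vec[OF W V, symmetric] WV)
    have "(X *\<^sub>v ?x) \<bullet>c ?x = (\<Sum>k<n. if k = i then 1 + \<i> * of_real (t i) else 0)"
      unfolding form[OF x x] Wx by (rule sum.cong) (use i in auto)
    then have "(X *\<^sub>v ?x) \<bullet>c ?x = 1 + \<i> * of_real (t i)" using i by simp
    then have "\<bar>t i\<bar> \<le> T" using sectorialD(2)[OF X x] by simp
    then have "\<bar>t i\<bar> \<le> \<bar>T\<bar>" by linarith
    then show ?thesis by (simp only: abs_le_square_iff)
  qed
  have "(cmod ((X *\<^sub>v u) \<bullet>c v))^2 \<le> (\<Sum>i<n. (cmod ((1 + \<i> * of_real (t i)) * (W *\<^sub>v u) $ i))^2) * (\<Sum>i<n. (cmod (cnj ((W *\<^sub>v v) $ i)))^2)"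
    unfolding form[OF u v] by (rule cauchy_schwarz_sum_cmod)
  also have "(\<Sum>i<n. (cmod (cnj ((W *\<^sub>v v) $ i)))^2) = Re ((X *\<^sub>v v) \<bullet>c v)" unfolding re[OF v] by simp
  finally have 1: "(cmod ((X *\<^sub>v u) \<bullet>c v))^2 \<le>
      (\<Sum>i<n. (cmod ((1 + \<i> * of_real (t i)) * (W *\<^sub>v u) $ i))^2) * Re ((X *\<^sub>v v) \<bullet>c v)" .
  have "(\<Sum>i<n. (cmod ((1 + \<i> * of_real (t i)) * (W *\<^sub>v u) $ i))^2) \<le> (1 + T^2) * Re ((X *\<^sub>v u) \<bullet>c u)"
    unfolding re[OF u] sum_distrib_left
  proof (rule sum_mono)
    fix i assume "i \<in> {..<n}"
    then have "(t i)^2 \<le> T^2" using tb by simp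
    moreover have "(cmod (1 + \<i> * of_real (t i)))^2 = 1 + (t i)^2" by (simp add: cmod_power2)
    ultimately show "(cmod ((1 + \<i> * of_real (t i)) * (W *\<^sub>v u) $ i))^2 \<le> (1 + T^2) * (cmod ((W *\<^sub>v u) $ i))^2"
      by (simp add: norm_mult power_mult_distrib mult_right_mono del: index_mult_mat_vec)
  qed
  from mult_right_mono[OF this sectorial_nonneg[OF X v]] 1 show ?thesis by linarith
qed

text \<open>Two versions, according to which argument carries the factor \<open>1 + T^2\<close>. The
  first yields the upper estimate in \<open>mean_bounds_herm_part\<close>, the second the lower
  estimate in \<open>mean_bounds_inverse\<close>.\<close>

lemma sectorial_am_gm:
  assumes X: "sectorial n T X" and u: "u \<in> carrier_vec n" and v: "v \<in> carrier_vec n"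
  shows "cmod ((X *\<^sub>v u) \<bullet>c v) \<le> (Re ((X *\<^sub>v u) \<bullet>c u) + (1 + T^2) * Re ((X *\<^sub>v v) \<bullet>c v)) / 2"
    and "cmod ((X *\<^sub>v u) \<bullet>c v) \<le> ((1 + T^2) * Re ((X *\<^sub>v u) \<bullet>c u) + Re ((X *\<^sub>v v) \<bullet>c v)) / 2"
proof -
  define p where "p = Re ((X *\<^sub>v u) \<bullet>c u)"
  define q where "q = Re ((X *\<^sub>v v) \<bullet>c v)"
  have pq: "0 \<le> p" "0 \<le> q" using sectorial_nonneg[OF X] u v by (auto simp: p_def q_def)
  have k: "0 \<le> 1 + T^2" by (simp add: add_nonneg_nonneg)
  have le: "c \<le> (a + b) / 2" if "c^2 \<le> a * b" "0 \<le> a" "0 \<le> b" for a b c :: real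
  proof (rule power2_le_imp_le)
    have "0 \<le> (a - b)^2" by simp
    then have "4 * (a * b) \<le> (a + b)^2" by (simp add: power2_eq_square algebra_simps)
    then show "c^2 \<le> ((a + b) / 2)^2" using that by (simp add: power_divide)
  qed (use that in simp)
  note cs = sectorial_cauchy_schwarz[OF X u v, folded p_def q_def]
  show "cmod ((X *\<^sub>v u) \<bullet>c v) \<le> (Re ((X *\<^sub>v u) \<bullet>c u) + (1 + T^2) * Re ((X *\<^sub>v v) \<bullet>c v)) / 2"
    unfolding p_def[symmetric] q_def[symmetric] by (rule le) (use cs pq k in \<open>simp_all add: mult_ac\<close>)
  show "cmod ((X *\<^sub>v u) \<bullet>c v) \<le> ((1 + T^2) * Re ((X *\<^sub>v u) \<bullet>c u) + Re ((X *\<^sub>v v) \<bullet>c v)) / 2"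
    unfolding p_def[symmetric] q_def[symmetric] by (rule le) (use cs pq k in simp_all)
qed

section \<open>Spectra, principal square roots and operator means of sectorial matrices\<close>

lemma char_poly_root_eigenvector:
  fixes X :: "complex mat"
  assumes X: "X \<in> carrier_mat n n" and z: "poly (char_poly X) z = 0"
  obtains u where "u \<in> carrier_vec n" "u \<noteq> 0\<^sub>v n" "X *\<^sub>v u = z \<cdot>\<^sub>v u"
proof -
  have "eigenvalue X z" using z eigenvalue_root_char_poly[OF X] by simp
  then show ?thesis using that X unfolding eigenvalue_def eigenvector_def by auto
qed

lemma sectorial_spectrum:
  assumes X: "sectorial n T X" and z: "poly (char_poly X) z = 0"
  shows "z \<in> slit_plane"
proof -
  note Xc = sectorialD(1)[OF X]
  obtain u where u: "u \<in> carrier_vec n" "u \<noteq> 0\<^sub>v n" "X *\<^sub>v u = z \<cdot>\<^sub>v u" by (rule char_poly_root_eigenvector[OF Xc z])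
  have "(X *\<^sub>v u) \<bullet>c u = z * of_real (vnorm2 u)"
    unfolding u(3) using u(1) cscalar_prod_self[OF u(1)] by (simp add: cscalar_prod_smult_left[of _ n])
  then have "0 < Re z * vnorm2 u" using sectorialD(3)[OF X u(1,2)] by simp
  then have "0 < Re z" using vnorm2_pos[OF u(1,2)] by (simp add: zero_less_mult_iff)
  then show ?thesis unfolding slit_plane_def by auto
qed

lemma msqrt_square:
  assumes X: "sectorial n T X"
  shows "msqrt X \<in> carrier_mat n n" "msqrt X * msqrt X = X"
    "minv (msqrt X) \<in> carrier_mat n n" "msqrt X * minv (msqrt X) = 1\<^sub>m n" "minv (msqrt X) * msqrt X = 1\<^sub>m n"
proof -
  note Xc = sectorialD(1)[OF X]
  show S: "msqrt X \<in> carrier_mat n n" using Xc by (simp add: msqrt_def)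
  have sp: "slit_plane = - \<real>\<^sub>\<le>\<^sub>0" unfolding slit_plane_def nonpos_Reals_def by auto
  have "csqrt holomorphic_on slit_plane" unfolding sp by (rule holomorphic_on_csqrt)
  from mat_fun_mult[OF Xc open_slit_plane this this sectorial_spectrum[OF X]]
  have "msqrt X * msqrt X = mat_fun (\<lambda>z. csqrt z * csqrt z) X" by (simp add: msqrt_def)
  also have "(\<lambda>z. csqrt z * csqrt z) = poly [:0, 1:]" by (simp add: fun_eq_iff flip: power2_eq_square)
  also have "mat_fun (poly [:0, 1:]) X = X" using Xc by (simp add: mat_fun_poly poly_mat_X[OF Xc]) auto
  finally show SS: "msqrt X * msqrt X = X" .
  have inj: "x = 0\<^sub>v n" if "x \<in> carrier_vec n" "msqrt X *\<^sub>v x = 0\<^sub>v n" for x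
  proof (rule sectorial_inj[OF X that(1)])
    have "X *\<^sub>v x = msqrt X *\<^sub>v (msqrt X *\<^sub>v x)"
      using assoc_mult_mat_vec[OF S S that(1)] SS by simp
    then show "X *\<^sub>v x = 0\<^sub>v n" using that mult_mat_zero_vec[OF S] by simp
  qed
  show "minv (msqrt X) \<in> carrier_mat n n" "msqrt X * minv (msqrt X) = 1\<^sub>m n" "minv (msqrt X) * msqrt X = 1\<^sub>m n"
    by (rule minv_inverse[OF S inj]; assumption)+
qed

text \<open>The core need not be sectorial itself. But an eigenvalue \<open>l \<le> 0\<close> would
  mean \<open>B u = l A u\<close> for some nonzero \<open>u\<close>, which is incompatible with the
  positive real parts of both forms at \<open>u\<close>.\<close>

lemma mean_core_spectrum:
  assumes A: "sectorial n T A" and B: "sectorial n T B"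
    and z: "poly (char_poly (minv (msqrt A) * B * minv (msqrt A))) z = 0"
  shows "z \<in> slit_plane"
proof (rule ccontr)
  assume "z \<notin> slit_plane"
  then obtain l where l: "z = of_real l" "l \<le> 0" unfolding slit_plane_def by auto
  note Bc = sectorialD(1)[OF B] and S = msqrt_square[OF A]
  let ?S = "msqrt A" and ?Si = "minv (msqrt A)"
  have C: "?Si * B * ?Si \<in> carrier_mat n n" using S(3) Bc by (intro mult_carrier_mat[of _ n n]) auto
  obtain x where x: "x \<in> carrier_vec n" "x \<noteq> 0\<^sub>v n" "(?Si * B * ?Si) *\<^sub>v x = z \<cdot>\<^sub>v x"
    by (rule char_poly_root_eigenvector[OF C z])
  define u where "u = ?Si *\<^sub>v x"
  have u: "u \<in> carrier_vec n" using S(3) x by (simp add: u_def)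
  have Su: "?S *\<^sub>v u = x" unfolding u_def using x by (simp add: assoc_mult_mat_vec[OF S(1,3) x(1), symmetric] S(4))
  have u0: "u \<noteq> 0\<^sub>v n" using Su x mult_mat_zero_vec[OF S(1)] by metis
  have Cx: "(?Si * B * ?Si) *\<^sub>v x = ?Si *\<^sub>v (B *\<^sub>v u)"
    unfolding u_def using S(3) Bc x(1) by (simp add: assoc_mult_mat_vec[of _ n n _ n] mult_carrier_mat[of _ n n])
  have Bu: "B *\<^sub>v u \<in> carrier_vec n" using Bc u by simp
  have "B *\<^sub>v u = ?S *\<^sub>v (?Si *\<^sub>v (B *\<^sub>v u))"
    using Bu by (simp add: assoc_mult_mat_vec[OF S(1,3) Bu, symmetric] S(4))
  also have "\<dots> = ?S *\<^sub>v (z \<cdot>\<^sub>v x)" using Cx x(3) by simp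
  also have "\<dots> = z \<cdot>\<^sub>v (?S *\<^sub>v (?S *\<^sub>v u))" unfolding Su by (rule mult_mat_vec[OF S(1) x(1)])
  also have "?S *\<^sub>v (?S *\<^sub>v u) = A *\<^sub>v u" using assoc_mult_mat_vec[OF S(1,1) u] S(2) by simp
  finally have "(B *\<^sub>v u) \<bullet>c u = of_real l * ((A *\<^sub>v u) \<bullet>c u)"
    using l u sectorialD(1)[OF A] by (simp add: cscalar_prod_smult_left[of _ n])
  then have "Re ((B *\<^sub>v u) \<bullet>c u) = l * Re ((A *\<^sub>v u) \<bullet>c u)" by simp
  moreover have "0 < Re ((B *\<^sub>v u) \<bullet>c u)" "0 < Re ((A *\<^sub>v u) \<bullet>c u)"
    using sectorialD(3)[OF A u u0] sectorialD(3)[OF B u u0] by auto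
  ultimately show False using l by (simp add: zero_less_mult_iff)
qed

lemma mean_core_carrier:
  assumes "sectorial n T A" "sectorial n T B"
  shows "minv (msqrt A) * B * minv (msqrt A) \<in> carrier_mat n n"
  using msqrt_square(3)[OF assms(1)] sectorialD(1)[OF assms(2)] by (intro mult_carrier_mat[of _ n n]) auto

lemma mean_carrier:
  assumes "sectorial n T A" "sectorial n T B"
  shows "mean g A B \<in> carrier_mat n n"
  unfolding mean_def using msqrt_square(1)[OF assms(1)] mat_fun_carrier[OF mean_core_carrier[OF assms]]
  by (intro mult_carrier_mat[of _ n n]) auto

text \<open>The mean with representing function \<open>harm_rep s\<close> is \<open>((1 - s) A\<^sup>-\<^sup>1 + s B\<^sup>-\<^sup>1)\<^sup>-\<^sup>1\<close>; here \<open>a = A\<^sup>-\<^sup>1 Z x\<close> and \<open>b = B\<^sup>-\<^sup>1 Z x\<close>.\<close>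

lemma harm_mean_decomposition:
  assumes A: "sectorial n T A" and B: "sectorial n T B" and s: "0 \<le> s" "s \<le> 1" and x: "x \<in> carrier_vec n"
  obtains a b where "a \<in> carrier_vec n" "b \<in> carrier_vec n"
    "A *\<^sub>v a = mean (harm_rep s) A B *\<^sub>v x" "B *\<^sub>v b = mean (harm_rep s) A B *\<^sub>v x"
    "x = of_real (1 - s) \<cdot>\<^sub>v a + of_real s \<cdot>\<^sub>v b"
proof -
  note Ac = sectorialD(1)[OF A] and Bc = sectorialD(1)[OF B] and S = msqrt_square[OF A]
  let ?S = "msqrt A" and ?Si = "minv (msqrt A)"
  define C where "C = ?Si * B * ?Si"
  have C: "C \<in> carrier_mat n n" unfolding C_def by (rule mean_core_carrier[OF A B])
  have spec: "\<And>z. poly (char_poly C) z = 0 \<Longrightarrow> z \<in> slit_plane" unfolding C_def by (rule mean_core_spectrum[OF A B])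
  \<comment> \<open>\<open>d\<close> is the denominator of \<open>harm_rep s\<close>; it has no zero
    on the spectrum of the core, so \<open>R\<close> is the inverse of \<open>D = d(C)\<close> and
    \<open>harm_rep s\<close> of the core is \<open>C * R\<close>.\<close>
  define d where "d = [:complex_of_real s, of_real (1 - s):]"
  have pd: "poly d z = (1 - of_real s) * z + of_real s" for z by (simp add: d_def algebra_simps)
  define R where "R = mat_fun (\<lambda>z. 1 / poly d z) C"
  define D where "D = poly_mat d C"
  have R: "R \<in> carrier_mat n n" and D: "D \<in> carrier_mat n n" using C by (auto simp: R_def D_def)
  have hR: "(\<lambda>z. 1 / poly d z) holomorphic_on slit_plane"
    unfolding pd using harm_denom_nonzero[OF _ s] by (intro holomorphic_intros) auto
  have hp: "poly p holomorphic_on slit_plane" for p by (rule holomorphic_intros)+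
  have DR: "D * R = 1\<^sub>m n"
  proof -
    have "D * R = mat_fun (\<lambda>z. poly d z * (1 / poly d z)) C"
      using mat_fun_mult[OF C open_slit_plane hp hR spec, of d] by (simp add: D_def R_def mat_fun_poly[OF C])
    also have "\<dots> = mat_fun (poly 1) C"
      by (rule mat_fun_cong[OF open_slit_plane _ spec]) (use harm_denom_nonzero[OF _ s] in \<open>simp add: pd\<close>)
    also have "\<dots> = 1\<^sub>m n" by (simp add: mat_fun_poly[OF C] poly_mat_1[OF C])
    finally show ?thesis .
  qed
  have HC: "mat_fun (harm_rep s) C = C * R"
  proof -
    have "C = mat_fun (poly [:0, 1:]) C" using C by (simp add: mat_fun_poly poly_mat_X[OF C]) auto
    then have "C * R = mat_fun (\<lambda>z. poly [:0, 1:] z * (1 / poly d z)) C"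
      using mat_fun_mult[OF C open_slit_plane hp hR spec, of "[:0, 1:]"] by (simp only: R_def)
    also have "(\<lambda>z. poly [:0, 1:] z * (1 / poly d z)) = harm_rep s" by (simp add: fun_eq_iff harm_rep_def pd)
    finally show ?thesis by simp
  qed
  define y where "y = R *\<^sub>v (?S *\<^sub>v x)"
  have Sx: "?S *\<^sub>v x \<in> carrier_vec n" using S(1) x by simp
  have y: "y \<in> carrier_vec n" using R Sx by (simp add: y_def)
  have Cy: "C *\<^sub>v y \<in> carrier_vec n" using C y by simp
  have CR: "C * R \<in> carrier_mat n n" using C R by (rule mult_carrier_mat)
  have SCR: "?S * (C * R) \<in> carrier_mat n n" using S(1) CR by (rule mult_carrier_mat)
  have Zx: "mean (harm_rep s) A B *\<^sub>v x = ?S *\<^sub>v (C *\<^sub>v y)"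
    unfolding mean_def C_def[symmetric] HC assoc_mult_mat_vec[OF SCR S(1) x] assoc_mult_mat_vec[OF S(1) CR Sx]
      assoc_mult_mat_vec[OF C R Sx] y_def ..
  define a where "a = ?Si *\<^sub>v (C *\<^sub>v y)"
  define b where "b = ?Si *\<^sub>v y"
  have a: "a \<in> carrier_vec n" and b: "b \<in> carrier_vec n" using S(3) Cy y by (auto simp: a_def b_def)
  have SSi: "?S *\<^sub>v (?Si *\<^sub>v w) = w" and SiS: "?Si *\<^sub>v (?S *\<^sub>v w) = w" if "w \<in> carrier_vec n" for w
    using that by (simp_all add: assoc_mult_mat_vec[OF S(1,3) that, symmetric] assoc_mult_mat_vec[OF S(3,1) that, symmetric] S(4,5))
  have "A *\<^sub>v a = ?S *\<^sub>v (?S *\<^sub>v a)" using assoc_mult_mat_vec[OF S(1,1) a] S(2) by simp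
  then have Aa: "A *\<^sub>v a = mean (harm_rep s) A B *\<^sub>v x" unfolding Zx a_def SSi[OF Cy] .
  have "C *\<^sub>v y = ?Si *\<^sub>v (B *\<^sub>v b)"
    unfolding C_def b_def using S(3) Bc y by (simp add: assoc_mult_mat_vec[of _ n n _ n] mult_carrier_mat[of _ n n])
  then have "?S *\<^sub>v (C *\<^sub>v y) = B *\<^sub>v b" using SSi[of "B *\<^sub>v b"] Bc b by simp
  then have Bb: "B *\<^sub>v b = mean (harm_rep s) A B *\<^sub>v x" unfolding Zx by simp
  have "D *\<^sub>v y = ?S *\<^sub>v x" unfolding y_def using Sx by (simp add: assoc_mult_mat_vec[OF D R Sx, symmetric] DR)
  moreover have "D *\<^sub>v y = of_real (1 - s) \<cdot>\<^sub>v (C *\<^sub>v y) + of_real s \<cdot>\<^sub>v y"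
  proof -
    have "D = of_real s \<cdot>\<^sub>m 1\<^sub>m n + of_real (1 - s) \<cdot>\<^sub>m C"
      unfolding D_def d_def poly_mat_pCons[OF C, of "of_real s"] poly_mat_const[OF C]
      using C by (simp add: mult_smult_distrib[of _ n n _ n])
    then have "D *\<^sub>v y = of_real s \<cdot>\<^sub>v y + of_real (1 - s) \<cdot>\<^sub>v (C *\<^sub>v y)"
      using lincomb_mat_vec[OF one_carrier_mat C y] y by simp
    then show ?thesis using Cy y by (simp add: comm_add_vec[of _ n])
  qed
  ultimately have "?S *\<^sub>v x = of_real (1 - s) \<cdot>\<^sub>v (C *\<^sub>v y) + of_real s \<cdot>\<^sub>v y" by simp
  then have "?Si *\<^sub>v (?S *\<^sub>v x) = of_real (1 - s) \<cdot>\<^sub>v a + of_real s \<cdot>\<^sub>v b"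
    unfolding a_def b_def using S(3) Cy y
    by (simp add: mult_add_distrib_mat_vec[of _ n n] mult_mat_vec[of _ n n])
  then have "x = of_real (1 - s) \<cdot>\<^sub>v a + of_real s \<cdot>\<^sub>v b" unfolding SiS[OF x] .
  then show ?thesis using that[OF a b Aa Bb] by simp
qed

lemma mat_fun_lincomb:
  assumes X: "X \<in> carrier_mat n n" and S: "open S" "f holomorphic_on S" "g holomorphic_on S"
    and spec: "\<And>z. poly (char_poly X) z = 0 \<Longrightarrow> z \<in> S"
  shows "mat_fun (\<lambda>z. a * f z + b * g z) X = a \<cdot>\<^sub>m mat_fun f X + b \<cdot>\<^sub>m mat_fun g X"
proof -
  obtain p q where p: "interpolates f X p" and q: "interpolates g X q" using interpolates_exists[OF X] by meson
  have "interpolates (\<lambda>z. a * f z + b * g z) X (Polynomial.smult a p + Polynomial.smult b q)"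
    unfolding interpolates_def
  proof (intro allI impI)
    fix z i assume i: "i < Polynomial.order z (char_poly X)"
    then have z: "z \<in> S" using spec order_root[of "char_poly X" z] by (metis not_less0)
    have "(deriv ^^ i) (\<lambda>z. a * f z + b * g z) z = (deriv ^^ i) (\<lambda>z. a * f z) z + (deriv ^^ i) (\<lambda>z. b * g z) z"
      by (rule higher_deriv_add[OF _ _ S(1) z]) (intro holomorphic_intros S)+
    also have "\<dots> = a * (deriv ^^ i) f z + b * (deriv ^^ i) g z"
      using higher_deriv_cmult[OF S(2) z S(1)] higher_deriv_cmult[OF S(3) z S(1)] by simp
    also have "\<dots> = (deriv ^^ i) (poly (Polynomial.smult a p + Polynomial.smult b q)) z"
      using p q i unfolding interpolates_def by (simp add: higher_deriv_poly higher_pderiv_add higher_pderiv_smult)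
    finally show "(deriv ^^ i) (poly (Polynomial.smult a p + Polynomial.smult b q)) z = (deriv ^^ i) (\<lambda>z. a * f z + b * g z) z" ..
  qed
  from mat_fun_eq[OF X this] show ?thesis
    by (simp add: poly_mat_add[OF X] poly_mat_smult[OF X] mat_fun_eq[OF X p] mat_fun_eq[OF X q])
qed

text \<open>The form of the mean at \<open>x\<close> as a function of the middle factor
  \<open>Y\<close> alone. It is linear in \<open>Y\<close>, which is the kind of functional that
  \<open>mat_fun_functional\<close> controls.\<close>

definition mean_form :: "complex mat \<Rightarrow> complex mat \<Rightarrow> complex vec \<Rightarrow> complex mat \<Rightarrow> complex" where
  "mean_form A B x Y = (msqrt A *\<^sub>v (Y *\<^sub>v (msqrt A *\<^sub>v x))) \<bullet>c x"

lemma mean_form_mat_fun: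
  assumes A: "sectorial n T A" and B: "sectorial n T B" and x: "x \<in> carrier_vec n"
  shows "(mean g A B *\<^sub>v x) \<bullet>c x = mean_form A B x (mat_fun g (minv (msqrt A) * B * minv (msqrt A)))"
proof -
  note S = msqrt_square(1)[OF A]
  have Y: "mat_fun g (minv (msqrt A) * B * minv (msqrt A)) \<in> carrier_mat n n" by (rule mat_fun_carrier[OF mean_core_carrier[OF A B]])
  have Sx: "msqrt A *\<^sub>v x \<in> carrier_vec n" using S x by simp
  show ?thesis
    unfolding mean_form_def mean_def assoc_mult_mat_vec[OF mult_carrier_mat[OF S Y] S x] assoc_mult_mat_vec[OF S Y Sx] ..
qed

lemma mean_form_lincomb:
  assumes A: "sectorial n T A" and x: "x \<in> carrier_vec n" and Y: "Y \<in> carrier_mat n n" and Z: "Z \<in> carrier_mat n n"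
  shows "mean_form A B x (a \<cdot>\<^sub>m Y + b \<cdot>\<^sub>m Z) = a * mean_form A B x Y + b * mean_form A B x Z"
proof -
  note S = msqrt_square(1)[OF A]
  have Sx: "msqrt A *\<^sub>v x \<in> carrier_vec n" using S x by simp
  show ?thesis unfolding mean_form_def lincomb_mat_vec[OF Y Z Sx]
    using S Sx Y Z x
    by (simp add: mult_add_distrib_mat_vec[of _ n n] mult_mat_vec[of _ n n] lincomb_cscalar_prod(1)[of _ n])
qed

text \<open>The transfer principle: an inequality that is real linear in \<open>g\<close>, involving
  the form of the mean at one vector and finitely many values on the positive axis, holds for every
  operator mean once it holds for harmonic means. Mixing uses linearity, limits use the continuity
  of the functional calculus.\<close>

theorem op_mean_functional_nonneg:
  fixes e t :: "nat \<Rightarrow> real" and p q :: real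
  assumes A: "sectorial n T A" and B: "sectorial n T B" and x: "x \<in> carrier_vec n"
    and t: "\<And>i. i < N \<Longrightarrow> 0 < t i"
    and harm_rep: "\<And>s. 0 \<le> s \<Longrightarrow> s \<le> 1 \<Longrightarrow> 0 \<le> p * Re ((mean (harm_rep s) A B *\<^sub>v x) \<bullet>c x)
        + q * Im ((mean (harm_rep s) A B *\<^sub>v x) \<bullet>c x) + (\<Sum>i<N. e i * (t i / ((1 - s) * t i + s)))"
    and g: "op_mean_fun g"
  shows "0 \<le> p * Re ((mean g A B *\<^sub>v x) \<bullet>c x) + q * Im ((mean g A B *\<^sub>v x) \<bullet>c x)
     + (\<Sum>i<N. e i * Re (g (of_real (t i))))"
proof -
  define C where "C = minv (msqrt A) * B * minv (msqrt A)"
  have C: "C \<in> carrier_mat n n" unfolding C_def by (rule mean_core_carrier[OF A B])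
  have spec: "\<And>z. poly (char_poly C) z = 0 \<Longrightarrow> z \<in> slit_plane" unfolding C_def by (rule mean_core_spectrum[OF A B])
  define \<phi> where "\<phi> = mean_form A B x"
  have ph: "(mean g A B *\<^sub>v x) \<bullet>c x = \<phi> (mat_fun g C)" for g
    unfolding \<phi>_def C_def by (rule mean_form_mat_fun[OF A B x])
  define L where "L = (\<lambda>g. p * Re (\<phi> (mat_fun g C)) + q * Im (\<phi> (mat_fun g C)) + (\<Sum>i<N. e i * Re (g (complex_of_real (t i)))))"
  have Lhull: "0 \<le> L f" if "f \<in> harm_hull" for f
    using that
  proof (induct rule: harm_hull.induct)
    case (harm_rep s)
    then show ?case using assms(5)[of s] unfolding L_def ph[symmetric] harm_of_real by simp
  next
    case (mix f g r)
    have m: "mat_fun (\<lambda>z. of_real (1 - r) * f z + of_real r * g z) C = of_real (1 - r) \<cdot>\<^sub>m mat_fun f C + of_real r \<cdot>\<^sub>m mat_fun g C"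
      by (rule mat_fun_lincomb[OF C open_slit_plane harm_hull_holomorphic[OF mix(1)] harm_hull_holomorphic[OF mix(3)] spec])
    have m': "\<phi> (mat_fun (\<lambda>z. of_real (1 - r) * f z + of_real r * g z) C) = of_real (1 - r) * \<phi> (mat_fun f C) + of_real r * \<phi> (mat_fun g C)"
      unfolding m \<phi>_def by (rule mean_form_lincomb[OF A x mat_fun_carrier[OF C] mat_fun_carrier[OF C]])
    have "L (\<lambda>z. of_real (1 - r) * f z + of_real r * g z) = (1 - r) * L f + r * L g"
      unfolding L_def m' by (simp add: algebra_simps sum.distrib sum_distrib_left sum_subtractf)
    then show ?case using mix by simp
  qed
  obtain F where F: "\<And>k :: nat. F k \<in> harm_hull"
    and U: "\<And>K. compact K \<Longrightarrow> K \<subseteq> slit_plane \<Longrightarrow> uniform_limit K F g sequentially"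
    by (rule op_mean_fun_approx[OF g]) blast
  have pt: "(\<lambda>k. F k z) \<longlonglongrightarrow> g z" if "z \<in> slit_plane" for z
    using tendsto_uniform_limitI[OF U[of "{z}"], of z] that by simp
  \<comment> \<open>The core may fail to be diagonalizable, so derivatives must converge as well;
    this is why the approximation is locally uniform on an open complex domain.\<close>
  have dr: "(\<lambda>k. (deriv ^^ i) (F k) z) \<longlonglongrightarrow> (deriv ^^ i) g z" if z: "z \<in> slit_plane" for i z
  proof -
    obtain r where r: "0 < r" "cball z r \<subseteq> slit_plane" using open_slit_plane z by (meson open_contains_cball)
    have "uniform_limit (ball z r) F g sequentially"
      by (rule uniform_limit_on_subset[OF U[OF compact_cball r(2)] ball_subset_cball])
    moreover have "\<forall>\<^sub>F k in sequentially. F k holomorphic_on ball z r"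
      using holomorphic_on_subset[OF harm_hull_holomorphic[OF F] order_trans[OF ball_subset_cball r(2)]] by simp
    ultimately show ?thesis using r(1) by (intro higher_deriv_complex_uniform_limit[where A = "ball z r"]) auto
  qed
  have one: "\<phi> (Y + Z) = \<phi> Y + \<phi> Z" "\<phi> (c \<cdot>\<^sub>m Y) = c * \<phi> Y" if "Y \<in> carrier_mat n n" "Z \<in> carrier_mat n n" for Y Z c
  proof -
    show "\<phi> (Y + Z) = \<phi> Y + \<phi> Z" using mean_form_lincomb[OF A x that, of B 1 1] by (simp add: \<phi>_def)
    have "0 \<cdot>\<^sub>m Y = 0\<^sub>m n n" using that by auto
    then have "c \<cdot>\<^sub>m Y + 0 \<cdot>\<^sub>m Y = c \<cdot>\<^sub>m Y" using that by simp
    then show "\<phi> (c \<cdot>\<^sub>m Y) = c * \<phi> Y" using mean_form_lincomb[OF A x that(1,1), of B c 0] by (simp add: \<phi>_def)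
  qed
  from mat_fun_functional[OF C, of \<phi>, OF one(1) one(2)[OF _ zero_carrier_mat]]
  obtain a where a: "\<And>f. \<phi> (mat_fun f C) = (\<Sum>z | poly (char_poly C) z = 0.
      \<Sum>i<Polynomial.order z (char_poly C). (deriv ^^ i) f z * a z i)" by blast
  have "(\<lambda>k. \<phi> (mat_fun (F k) C)) \<longlonglongrightarrow> \<phi> (mat_fun g C)"
    unfolding a by (intro tendsto_intros dr) (auto intro: spec)
  then have "(\<lambda>k. L (F k)) \<longlonglongrightarrow> L g"
    unfolding L_def by (intro tendsto_intros pt) (auto intro: of_real_in_slit_plane t)
  then have "0 \<le> L g" by (rule LIMSEQ_le_const) (use Lhull[OF F] in auto)
  then show ?thesis unfolding L_def ph .
qed

section \<open>Scalar inequalities behind the constant \<open>K\<close>\<close>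

text \<open>Each approximating function lies below a line through \<open>(1, 1)\<close> with one
  slope \<open>a\<close> for both arguments. The product of the line values at \<open>t\<close> and
  \<open>1 / t\<close> is largest for \<open>a = 1/2\<close>, where it equals the right hand
  side.\<close>

lemma op_mean_product_bound:
  assumes g: "op_mean_fun g" and t: "0 < t"
  shows "Re (g (of_real t)) * Re (g (of_real (1 / t))) \<le> (1 + t)^2 / (4 * t)"
proof -
  have arith: "((1 - a) + a * t) * ((1 - a) + a * (1 / t)) \<le> (1 + t)^2 / (4 * t)" for a
  proof -
    have "(1 + t)^2 / (4 * t) - ((1 - a) + a * t) * ((1 - a) + a * (1 / t)) = (1 - 2 * a)^2 * (1 - t)^2 / (4 * t)"
      using t by (simp add: divide_simps) (simp add: power2_eq_square algebra_simps)
    also have "\<dots> \<ge> 0" using t by simp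
    finally show ?thesis by simp
  qed
  obtain F where F: "\<And>k :: nat. F k \<in> harm_hull"
    and U: "\<And>K. compact K \<Longrightarrow> K \<subseteq> slit_plane \<Longrightarrow> uniform_limit K F g sequentially"
    by (rule op_mean_fun_approx[OF g]) blast
  have pt: "(\<lambda>k. F k (of_real x)) \<longlonglongrightarrow> g (of_real x)" if "0 < x" for x
    using tendsto_uniform_limitI[OF U[of "{of_real x}"], of "of_real x"] of_real_in_slit_plane[OF that] by simp
  have "(\<lambda>k. Re (F k (of_real t)) * Re (F k (of_real (1 / t)))) \<longlonglongrightarrow> Re (g (of_real t)) * Re (g (of_real (1 / t)))"
    using t by (intro tendsto_intros pt) auto
  then show ?thesis
  proof (rule LIMSEQ_le_const2, intro exI allI impI)
    fix k :: nat
    obtain a where a: "0 \<le> a" "a \<le> 1" "\<And>x. x > 0 \<Longrightarrow> 0 < Re (F k (of_real x)) \<and> Re (F k (of_real x)) \<le> (1 - a) + a * x"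
      using harm_hull_bounds[OF F] by blast
    have "Re (F k (of_real t)) * Re (F k (of_real (1 / t))) \<le> ((1 - a) + a * t) * ((1 - a) + a * (1 / t))"
      using a(3)[of t] a(3)[of "1 / t"] t by (intro mult_mono) auto
    also note arith[of a]
    finally show "Re (F k (of_real t)) * Re (F k (of_real (1 / t))) \<le> (1 + t)^2 / (4 * t)" .
  qed
qed

text \<open>The left hand side is invariant under \<open>t -> 1 / t\<close> and takes the
  Kantorovich value at both ends of the interval; the factored inequality in the proof expresses
  that \<open>t\<close> lies between these ends.\<close>

lemma kantorovich_bound:
  fixes t m M :: real
  assumes m: "0 < m" "m \<le> M" and t: "m / M \<le> t" "t \<le> M / m"
  shows "(1 + t)^2 / (4 * t) \<le> (M + m)^2 / (4 * m * M)"
proof -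
  have M: "0 < M" using m by simp
  have t0: "0 < t" using t(1) divide_pos_pos[OF m(1) M] by linarith
  have "0 \<le> (M * t - m) * (M - m * t)"
    using t m M by (intro mult_nonneg_nonneg) (simp_all add: field_simps)
  then have "m * M * (1 + t)^2 \<le> t * (M + m)^2" by (simp add: power2_eq_square algebra_simps)
  then show ?thesis using t0 m M by (simp add: divide_simps) (simp add: mult_ac)
qed

text \<open>The scalar variational principle: the harmonic mean of 1 and \<open>t\<close> gives the
  least value of \<open>(1 - s) |a|^2 + s t |b|^2\<close> among all \<open>a\<close>,
  \<open>b\<close> with a prescribed weighted sum.\<close>

lemma harm_scalar_ineq:
  fixes a b :: complex and s t :: real
  assumes t: "0 < t" and s: "0 \<le> s" "s \<le> 1"
  shows "(cmod (of_real (1 - s) * a + of_real s * b))^2 * (t / ((1 - s) * t + s)) \<le> (1 - s) * (cmod a)^2 + s * (t * (cmod b)^2)"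
proof -
  have d: "0 < (1 - s) * t + s" by (rule harm_pos[OF t s])
  have "cmod (of_real (1 - s) * a + of_real s * b) \<le> cmod (of_real (1 - s) * a) + cmod (of_real s * b)"
    by (rule norm_triangle_ineq)
  also have "\<dots> = (1 - s) * cmod a + s * cmod b" using s by (simp only: norm_mult norm_of_real)
  finally have "(cmod (of_real (1 - s) * a + of_real s * b))^2 * t \<le> ((1 - s) * cmod a + s * cmod b)^2 * t"
    using t by (intro mult_right_mono power_mono) auto
  also have "((1 - s) * (cmod a)^2 + s * (t * (cmod b)^2)) * ((1 - s) * t + s) - ((1 - s) * cmod a + s * cmod b)^2 * t
      = s * (1 - s) * (t * cmod b - cmod a)^2" by (simp add: power2_eq_square algebra_simps)
  then have "((1 - s) * cmod a + s * cmod b)^2 * t \<le> ((1 - s) * (cmod a)^2 + s * (t * (cmod b)^2)) * ((1 - s) * t + s)"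
  proof -
    have "0 \<le> s * (1 - s) * (t * cmod b - cmod a)^2" using s by (intro mult_nonneg_nonneg) auto
    with \<open>_ = s * (1 - s) * (t * cmod b - cmod a)^2\<close> show ?thesis by linarith
  qed
  finally show ?thesis using d by (simp add: divide_le_eq)
qed

section \<open>Comparison with a simultaneously diagonalized positive definite pair\<close>

text \<open>The numbers \<open>q i x\<close> are squared coordinates in which a positive definite
  reference pair becomes the identity and the diagonal matrix of \<open>t\<close>; the sum is the
  form at \<open>x\<close> of the harmonic mean of this pair. As \<open>q\<close> and
  \<open>t\<close> do not depend on \<open>s\<close>, both inequalities are linear in the
  representing function and pass to all operator means.\<close>

definition mean_bounds :: "nat \<Rightarrow> real \<Rightarrow> real \<Rightarrow> complex mat \<Rightarrow> complex mat \<Rightarrow> (nat \<Rightarrow> complex vec \<Rightarrow> real) \<Rightarrow> (nat \<Rightarrow> real) \<Rightarrow> bool" where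
  "mean_bounds n \<alpha> \<beta> A B q t \<longleftrightarrow> (\<forall>i<n. 0 < t i) \<and>
     (\<forall>x \<in> carrier_vec n. (\<forall>i<n. 0 \<le> q i x) \<and> (x \<noteq> 0\<^sub>v n \<longrightarrow> (\<exists>i<n. 0 < q i x)) \<and>
       (\<forall>s. 0 \<le> s \<longrightarrow> s \<le> 1 \<longrightarrow>
          \<alpha> * (\<Sum>i<n. q i x * (t i / ((1 - s) * t i + s))) \<le> Re ((mean (harm_rep s) A B *\<^sub>v x) \<bullet>c x) \<and>
          Re ((mean (harm_rep s) A B *\<^sub>v x) \<bullet>c x) \<le> \<beta> * (\<Sum>i<n. q i x * (t i / ((1 - s) * t i + s)))))"

lemma mean_bounds_op_mean:
  assumes A: "sectorial n T A" and B: "sectorial n T B" and mb: "mean_bounds n \<alpha> \<beta> A B q t"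
    and g: "op_mean_fun g" and x: "x \<in> carrier_vec n"
  shows "\<alpha> * (\<Sum>i<n. q i x * Re (g (of_real (t i)))) \<le> Re ((mean g A B *\<^sub>v x) \<bullet>c x)"
    and "Re ((mean g A B *\<^sub>v x) \<bullet>c x) \<le> \<beta> * (\<Sum>i<n. q i x * Re (g (of_real (t i))))"
proof -
  have t: "\<And>i. i < n \<Longrightarrow> 0 < t i" using mb by (simp add: mean_bounds_def)
  have b: "\<alpha> * (\<Sum>i<n. q i x * (t i / ((1 - s) * t i + s))) \<le> Re ((mean (harm_rep s) A B *\<^sub>v x) \<bullet>c x)"
     "Re ((mean (harm_rep s) A B *\<^sub>v x) \<bullet>c x) \<le> \<beta> * (\<Sum>i<n. q i x * (t i / ((1 - s) * t i + s)))"
    if "0 \<le> s" "s \<le> 1" for s using mb x that unfolding mean_bounds_def by blast+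
  have "0 \<le> 1 * Re ((mean g A B *\<^sub>v x) \<bullet>c x) + 0 * Im ((mean g A B *\<^sub>v x) \<bullet>c x) + (\<Sum>i<n. (- \<alpha> * q i x) * Re (g (of_real (t i))))"
  proof (rule op_mean_functional_nonneg[OF A B x t _ g])
    fix s :: real assume "0 \<le> s" "s \<le> 1"
    from b(1)[OF this] show "0 \<le> 1 * Re ((mean (harm_rep s) A B *\<^sub>v x) \<bullet>c x) + 0 * Im ((mean (harm_rep s) A B *\<^sub>v x) \<bullet>c x)
        + (\<Sum>i<n. (- \<alpha> * q i x) * (t i / ((1 - s) * t i + s)))"
      by (simp only: sum_distrib_left mult_minus_left sum_negf mult.assoc)
  qed
  then show "\<alpha> * (\<Sum>i<n. q i x * Re (g (of_real (t i)))) \<le> Re ((mean g A B *\<^sub>v x) \<bullet>c x)"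
    by (simp only: sum_distrib_left mult_minus_left sum_negf mult.assoc)
  have "0 \<le> (-1) * Re ((mean g A B *\<^sub>v x) \<bullet>c x) + 0 * Im ((mean g A B *\<^sub>v x) \<bullet>c x) + (\<Sum>i<n. (\<beta> * q i x) * Re (g (of_real (t i))))"
  proof (rule op_mean_functional_nonneg[OF A B x t _ g])
    fix s :: real assume "0 \<le> s" "s \<le> 1"
    from b(2)[OF this] show "0 \<le> (-1) * Re ((mean (harm_rep s) A B *\<^sub>v x) \<bullet>c x) + 0 * Im ((mean (harm_rep s) A B *\<^sub>v x) \<bullet>c x)
        + (\<Sum>i<n. (\<beta> * q i x) * (t i / ((1 - s) * t i + s)))"
      by (simp only: sum_distrib_left mult.assoc)
  qed
  then show "Re ((mean g A B *\<^sub>v x) \<bullet>c x) \<le> \<beta> * (\<Sum>i<n. q i x * Re (g (of_real (t i))))"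
    by (simp only: sum_distrib_left mult.assoc)
qed

text \<open>As \<open>z\<close> equals both \<open>A a\<close> and \<open>B b\<close>, its pairing
  may use \<open>A\<close> on one part and \<open>B\<close> on the other. The vectors
  \<open>w\<close> and \<open>w'\<close> are free, so \<open>x\<close> can be tested in a
  decomposition other than its own.\<close>

lemma harm_mean_form:
  assumes A: "sectorial n T A" and B: "sectorial n T B"
    and a: "a \<in> carrier_vec n" and b: "b \<in> carrier_vec n" and w: "w \<in> carrier_vec n" and w': "w' \<in> carrier_vec n"
    and eq: "A *\<^sub>v a = z" "B *\<^sub>v b = z"
  shows "z \<bullet>c (of_real (1 - s) \<cdot>\<^sub>v w + of_real s \<cdot>\<^sub>v w')
    = of_real (1 - s) * ((A *\<^sub>v a) \<bullet>c w) + of_real s * ((B *\<^sub>v b) \<bullet>c w')"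
proof -
  have "z \<in> carrier_vec n" using eq(1)[symmetric] sectorialD(1)[OF A] a by simp
  then show ?thesis using lincomb_cscalar_prod(2)[OF w w'] eq by simp
qed

text \<open>The sector bound is a pair of linear inequalities, one for each sign of the imaginary
  part, and transfers. Strict positivity would be lost in a limit, so it is taken from the lower
  comparison bound.\<close>

lemma sectorial_mean:
  assumes A: "sectorial n T A" and B: "sectorial n T B" and mb: "mean_bounds n \<alpha> \<beta> A B q t" and \<alpha>: "0 < \<alpha>"
    and g: "op_mean_fun g"
  shows "sectorial n T (mean g A B)"
  unfolding sectorial_def
proof (intro conjI ballI impI)
  show "mean g A B \<in> carrier_mat n n" by (rule mean_carrier[OF A B])
  fix x :: "complex vec" assume x: "x \<in> carrier_vec n"
  have t: "\<And>i. i < n \<Longrightarrow> 0 < t i" using mb by (simp add: mean_bounds_def)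
  have h: "\<bar>Im ((mean (harm_rep s) A B *\<^sub>v x) \<bullet>c x)\<bar> \<le> T * Re ((mean (harm_rep s) A B *\<^sub>v x) \<bullet>c x)" if s: "0 \<le> s" "s \<le> 1" for s
  proof -
    obtain a b where a: "a \<in> carrier_vec n" and b: "b \<in> carrier_vec n"
      and eq: "A *\<^sub>v a = mean (harm_rep s) A B *\<^sub>v x" "B *\<^sub>v b = mean (harm_rep s) A B *\<^sub>v x"
      and xx: "x = of_real (1 - s) \<cdot>\<^sub>v a + of_real s \<cdot>\<^sub>v b"
      by (rule harm_mean_decomposition[OF A B s x]) blast
    have e: "(mean (harm_rep s) A B *\<^sub>v x) \<bullet>c x = of_real (1 - s) * ((A *\<^sub>v a) \<bullet>c a) + of_real s * ((B *\<^sub>v b) \<bullet>c b)"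
      using harm_mean_form[OF A B a b a b eq, of s] xx by simp
    have "\<bar>Im ((mean (harm_rep s) A B *\<^sub>v x) \<bullet>c x)\<bar> \<le> (1 - s) * \<bar>Im ((A *\<^sub>v a) \<bullet>c a)\<bar> + s * \<bar>Im ((B *\<^sub>v b) \<bullet>c b)\<bar>"
      unfolding e using s abs_triangle_ineq[of "(1 - s) * Im ((A *\<^sub>v a) \<bullet>c a)" "s * Im ((B *\<^sub>v b) \<bullet>c b)"]
      by (simp add: abs_mult)
    also have "\<dots> \<le> (1 - s) * (T * Re ((A *\<^sub>v a) \<bullet>c a)) + s * (T * Re ((B *\<^sub>v b) \<bullet>c b))"
      using s sectorialD(2)[OF A a] sectorialD(2)[OF B b] by (intro add_mono mult_left_mono) auto
    also have "\<dots> = T * Re ((mean (harm_rep s) A B *\<^sub>v x) \<bullet>c x)" unfolding e by (simp add: algebra_simps)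
    finally show ?thesis .
  qed
  have "0 \<le> T * Re ((mean g A B *\<^sub>v x) \<bullet>c x) + r * Im ((mean g A B *\<^sub>v x) \<bullet>c x) + (\<Sum>i<n. 0 * Re (g (of_real (t i))))"
    if "r = 1 \<or> r = -1" for r
  proof (rule op_mean_functional_nonneg[OF A B x t _ g])
    fix s :: real assume "0 \<le> s" "s \<le> 1"
    from h[OF this] show "0 \<le> T * Re ((mean (harm_rep s) A B *\<^sub>v x) \<bullet>c x) + r * Im ((mean (harm_rep s) A B *\<^sub>v x) \<bullet>c x)
        + (\<Sum>i<n. 0 * (t i / ((1 - s) * t i + s)))" using that by (auto simp: abs_le_iff)
  qed
  from this[of 1] this[of "-1"] show "\<bar>Im ((mean g A B *\<^sub>v x) \<bullet>c x)\<bar> \<le> T * Re ((mean g A B *\<^sub>v x) \<bullet>c x)"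
    by (simp add: abs_le_iff)
  assume x0: "x \<noteq> 0\<^sub>v n"
  have qn: "\<And>i. i < n \<Longrightarrow> 0 \<le> q i x" and "\<exists>i<n. 0 < q i x" using mb x x0 by (auto simp: mean_bounds_def)
  then obtain i where i: "i < n" "0 < q i x" by blast
  have gp: "0 < Re (g (of_real (t i)))" if "i < n" for i using g t[OF that] by (simp add: op_mean_fun_def)
  have "0 < (\<Sum>i<n. q i x * Re (g (of_real (t i))))"
    by (rule sum_pos2[of _ i]) (use i qn gp in \<open>auto intro!: mult_nonneg_nonneg simp: less_imp_le\<close>)
  then have "0 < \<alpha> * (\<Sum>i<n. q i x * Re (g (of_real (t i))))" using \<alpha> by simp
  also note mean_bounds_op_mean(1)[OF A B mb g x]
  finally show "0 < Re ((mean g A B *\<^sub>v x) \<bullet>c x)" .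
qed

lemma sv_le_of_sectorial':
  assumes X: "sectorial n T X" and Y: "Y \<in> carrier_mat n n"
    and le: "\<And>u. u \<in> carrier_vec n \<Longrightarrow> Re ((X *\<^sub>v u) \<bullet>c u) \<le> C * Re ((Y *\<^sub>v u) \<bullet>c u)"
    and C: "0 \<le> C" and j: "1 \<le> j" "j \<le> n"
  shows "sv X j \<le> (1 + T^2) * C * sv Y j"
  by (rule sv_le_of_sectorial[OF sectorialD(1)[OF X] Y sectorial_cauchy_schwarz[OF X] sectorial_nonneg[OF X] le C _ j])
    (auto intro: add_nonneg_nonneg)

text \<open>Both means are compared with the same diagonal reference, where the assumption relates
  them termwise. Entering the reference costs \<open>\<beta>\<close>, leaving it
  \<open>1 / \<alpha>\<close>, and the passage to singular values \<open>1 + T^2\<close>.\<close>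

lemma sv_mean_le:
  assumes A: "sectorial n T A" and B: "sectorial n T B" and mb: "mean_bounds n \<alpha> \<beta> A B q t" and \<alpha>: "0 < \<alpha>" "0 \<le> \<beta>"
    and g: "op_mean_fun g1" "op_mean_fun g2" and K: "0 \<le> K"
    and le: "\<And>i. i < n \<Longrightarrow> Re (g1 (of_real (t i))) \<le> K * Re (g2 (of_real (t i)))"
    and j: "1 \<le> j" "j \<le> n"
  shows "sv (mean g1 A B) j \<le> (1 + T^2) * (\<beta> / \<alpha> * K) * sv (mean g2 A B) j"
proof (rule sv_le_of_sectorial'[OF sectorial_mean[OF A B mb \<alpha>(1) g(1)] mean_carrier[OF A B] _ _ j])
  show "0 \<le> \<beta> / \<alpha> * K" using \<alpha> K by simp
  fix x :: "complex vec" assume x: "x \<in> carrier_vec n"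
  have q: "\<And>i. i < n \<Longrightarrow> 0 \<le> q i x" using mb x by (simp add: mean_bounds_def)
  have "Re ((mean g1 A B *\<^sub>v x) \<bullet>c x) \<le> \<beta> * (\<Sum>i<n. q i x * Re (g1 (of_real (t i))))"
    by (rule mean_bounds_op_mean(2)[OF A B mb g(1) x])
  also have "\<dots> \<le> \<beta> * (\<Sum>i<n. q i x * (K * Re (g2 (of_real (t i)))))"
    using \<alpha> q le by (intro mult_left_mono sum_mono) auto
  also have "\<dots> = \<beta> / \<alpha> * K * (\<alpha> * (\<Sum>i<n. q i x * Re (g2 (of_real (t i)))))"
    using \<alpha> by (simp add: sum_distrib_left mult_ac)
  also have "\<dots> \<le> \<beta> / \<alpha> * K * Re ((mean g2 A B *\<^sub>v x) \<bullet>c x)"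
    using mean_bounds_op_mean(1)[OF A B mb g(2) x] \<alpha> K by (intro mult_left_mono) auto
  finally show "Re ((mean g1 A B *\<^sub>v x) \<bullet>c x) \<le> \<beta> / \<alpha> * K * Re ((mean g2 A B *\<^sub>v x) \<bullet>c x)" .
qed

lemma mat_vec_nonzero_entry:
  fixes W V :: "complex mat"
  assumes "W \<in> carrier_mat n n" "V \<in> carrier_mat n n" "V * W = 1\<^sub>m n" "x \<in> carrier_vec n" "x \<noteq> 0\<^sub>v n"
  shows "\<exists>i<n. (W *\<^sub>v x) $ i \<noteq> 0"
proof (rule ccontr)
  assume "\<not> ?thesis"
  then have "W *\<^sub>v x = 0\<^sub>v n" using assms by (intro eq_vecI) (auto simp del: index_mult_mat_vec)
  then have "V *\<^sub>v (W *\<^sub>v x) = 0\<^sub>v n" using mult_mat_zero_vec[OF assms(2)] by simp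
  then show False using assms assoc_mult_mat_vec[OF assms(2,1,4)] by simp
qed

text \<open>At the \<open>i\<close>-th column of \<open>V\<close> the real parts of the forms are 1
  and \<open>t i\<close>. The bounds confine its squared norm to \<open>[1/M, 1/m]\<close> and hence
  \<open>t i\<close> to \<open>[m/M, M/m]\<close>. Since \<open>m\<close> and \<open>M\<close> are
  quantified within the last clause, the diagonalization can be fixed before any bounds are
  assumed.\<close>

lemma herm_part_diagonalization:
  assumes A: "sectorial n T A" and B: "sectorial n T B"
  obtains W V t where "W \<in> carrier_mat n n" "V \<in> carrier_mat n n" "W * V = 1\<^sub>m n" "V * W = 1\<^sub>m n"
    "\<And>x. x \<in> carrier_vec n \<Longrightarrow> Re ((A *\<^sub>v x) \<bullet>c x) = (\<Sum>i<n. (cmod ((W *\<^sub>v x) $ i))^2)"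
    "\<And>x. x \<in> carrier_vec n \<Longrightarrow> Re ((B *\<^sub>v x) \<bullet>c x) = (\<Sum>i<n. t i * (cmod ((W *\<^sub>v x) $ i))^2)"
    "\<And>i. i < n \<Longrightarrow> 0 < t i"
    "\<And>m M i. 0 < m \<Longrightarrow> m \<le> M \<Longrightarrow>
       (\<And>x. x \<in> carrier_vec n \<Longrightarrow> m * vnorm2 x \<le> Re ((A *\<^sub>v x) \<bullet>c x) \<and> Re ((A *\<^sub>v x) \<bullet>c x) \<le> M * vnorm2 x) \<Longrightarrow>
       (\<And>x. x \<in> carrier_vec n \<Longrightarrow> m * vnorm2 x \<le> Re ((B *\<^sub>v x) \<bullet>c x) \<and> Re ((B *\<^sub>v x) \<bullet>c x) \<le> M * vnorm2 x) \<Longrightarrow>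
       i < n \<Longrightarrow> m / M \<le> t i \<and> t i \<le> M / m"
proof -
  note Ac = sectorialD(1)[OF A] and Bc = sectorialD(1)[OF B]
  obtain W V t where W: "W \<in> carrier_mat n n" and V: "V \<in> carrier_mat n n" and WV: "W * V = 1\<^sub>m n" "V * W = 1\<^sub>m n"
    and Pf: "\<And>x y. x \<in> carrier_vec n \<Longrightarrow> y \<in> carrier_vec n \<Longrightarrow>
       (herm_part A *\<^sub>v x) \<bullet>c y = (\<Sum>i<n. (W *\<^sub>v x) $ i * cnj ((W *\<^sub>v y) $ i))"
    and Qf: "\<And>x y. x \<in> carrier_vec n \<Longrightarrow> y \<in> carrier_vec n \<Longrightarrow>
       (herm_part B *\<^sub>v x) \<bullet>c y = (\<Sum>i<n. of_real (t i) * (W *\<^sub>v x) $ i * cnj ((W *\<^sub>v y) $ i))"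
    by (rule simultaneous_diagonalization[OF herm_part_carrier[OF Ac] sectorial_pd_herm_part[OF A]
        herm_part_carrier[OF Bc] herm_part_hermitian[OF Bc]]) blast
  have rA: "Re ((A *\<^sub>v x) \<bullet>c x) = (\<Sum>i<n. (cmod ((W *\<^sub>v x) $ i))^2)" if x: "x \<in> carrier_vec n" for x
  proof -
    have "complex_of_real (Re ((A *\<^sub>v x) \<bullet>c x)) = of_real (\<Sum>i<n. (cmod ((W *\<^sub>v x) $ i))^2)"
      unfolding herm_part_quadratic_form[OF Ac x, symmetric] Pf[OF x x]
      by (simp add: complex_norm_square[symmetric] del: complex_mult_cnj index_mult_mat_vec)
    then show ?thesis by (simp only: of_real_eq_iff)
  qed
  have rB: "Re ((B *\<^sub>v x) \<bullet>c x) = (\<Sum>i<n. t i * (cmod ((W *\<^sub>v x) $ i))^2)" if x: "x \<in> carrier_vec n" for x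
  proof -
    have "complex_of_real (Re ((B *\<^sub>v x) \<bullet>c x)) = of_real (\<Sum>i<n. t i * (cmod ((W *\<^sub>v x) $ i))^2)"
      unfolding herm_part_quadratic_form[OF Bc x, symmetric] Qf[OF x x]
      by (simp add: complex_norm_square[symmetric] mult.assoc del: complex_mult_cnj index_mult_mat_vec)
    then show ?thesis by (simp only: of_real_eq_iff)
  qed
  have basis: "V *\<^sub>v unit_vec n i \<in> carrier_vec n" "V *\<^sub>v unit_vec n i \<noteq> 0\<^sub>v n"
    "Re ((A *\<^sub>v (V *\<^sub>v unit_vec n i)) \<bullet>c (V *\<^sub>v unit_vec n i)) = 1"
    "Re ((B *\<^sub>v (V *\<^sub>v unit_vec n i)) \<bullet>c (V *\<^sub>v unit_vec n i)) = t i" if i: "i < n" for i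
  proof -
    let ?x = "V *\<^sub>v unit_vec n i"
    show x: "?x \<in> carrier_vec n" using V by simp
    have Wx: "W *\<^sub>v ?x = unit_vec n i" by (simp add: assoc_mult_mat_vec[OF W V, symmetric] WV)
    have sums: "(\<Sum>k<n. (cmod (unit_vec n i $ k))^2) = (\<Sum>k<n. if k = i then 1 else 0)"
      "(\<Sum>k<n. t k * (cmod (unit_vec n i $ k))^2) = (\<Sum>k<n. if k = i then t i else 0)"
      by (rule sum.cong; use i in force)+
    show e: "Re ((A *\<^sub>v ?x) \<bullet>c ?x) = 1" unfolding rA[OF x] Wx sums using i by simp
    show "Re ((B *\<^sub>v ?x) \<bullet>c ?x) = t i" unfolding rB[OF x] Wx sums using i by simp
    show "?x \<noteq> 0\<^sub>v n"
    proof
      assume z: "?x = 0\<^sub>v n"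
      show False using e unfolding z mult_mat_zero_vec[OF Ac] by (simp add: cscalar_prod_zero_left[of _ n])
    qed
  qed
  show ?thesis
  proof (rule that[OF W V WV rA rB])
    fix i assume i: "i < n"
    show "0 < t i" using sectorialD(3)[OF B basis(1,2)[OF i]] basis(4)[OF i] by simp
  next
    fix m M :: real and i
    assume m: "0 < m" "m \<le> M" and i: "i < n"
      and bA: "\<And>x. x \<in> carrier_vec n \<Longrightarrow> m * vnorm2 x \<le> Re ((A *\<^sub>v x) \<bullet>c x) \<and> Re ((A *\<^sub>v x) \<bullet>c x) \<le> M * vnorm2 x"
      and bB: "\<And>x. x \<in> carrier_vec n \<Longrightarrow> m * vnorm2 x \<le> Re ((B *\<^sub>v x) \<bullet>c x) \<and> Re ((B *\<^sub>v x) \<bullet>c x) \<le> M * vnorm2 x"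
    define \<nu> where "\<nu> = vnorm2 (V *\<^sub>v unit_vec n i)"
    have a: "m * \<nu> \<le> 1" "1 \<le> M * \<nu>" and b: "m * \<nu> \<le> t i" "t i \<le> M * \<nu>"
      using bA[OF basis(1)[OF i]] bB[OF basis(1)[OF i]] basis(3,4)[OF i] by (auto simp: \<nu>_def)
    have M: "0 < M" using m by simp
    have "1 / M \<le> \<nu>" "\<nu> \<le> 1 / m" using a m M by (simp_all add: field_simps)
    then have "m * (1 / M) \<le> m * \<nu>" "M * \<nu> \<le> M * (1 / m)" using m M by (auto intro!: mult_left_mono simp del: times_divide_eq_right)
    then show "m / M \<le> t i \<and> t i \<le> M / m" using b by simp
  qed
qed

text \<open>The form of the reference harmonic mean at \<open>x\<close> is a minimum over
  decompositions \<open>x = (1 - s) a + s b\<close>. The decomposition coming from the complex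
  harmonic mean is one competitor, which gives the lower bound; pairing the mean with the optimal
  decomposition gives the upper bound.\<close>

theorem mean_bounds_herm_part:
  assumes A: "sectorial n T A" and B: "sectorial n T B"
    and W: "W \<in> carrier_mat n n" and V: "V \<in> carrier_mat n n" and WV: "W * V = 1\<^sub>m n" "V * W = 1\<^sub>m n"
    and rA: "\<And>x. x \<in> carrier_vec n \<Longrightarrow> Re ((A *\<^sub>v x) \<bullet>c x) = (\<Sum>i<n. (cmod ((W *\<^sub>v x) $ i))^2)"
    and rB: "\<And>x. x \<in> carrier_vec n \<Longrightarrow> Re ((B *\<^sub>v x) \<bullet>c x) = (\<Sum>i<n. t i * (cmod ((W *\<^sub>v x) $ i))^2)"
    and t: "\<And>i. i < n \<Longrightarrow> 0 < t i"
  shows "mean_bounds n 1 (1 + T^2) A B (\<lambda>i x. (cmod ((W *\<^sub>v x) $ i))^2) t"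
  unfolding mean_bounds_def
proof (intro conjI ballI allI impI)
  fix x :: "complex vec" assume x: "x \<in> carrier_vec n"
  show "\<exists>i<n. 0 < (cmod ((W *\<^sub>v x) $ i))^2" if "x \<noteq> 0\<^sub>v n"
    using mat_vec_nonzero_entry[OF W V WV(2) x that] by auto
  fix s :: real assume s: "0 \<le> s" "s \<le> 1"
  obtain a b where a: "a \<in> carrier_vec n" and b: "b \<in> carrier_vec n"
    and eq: "A *\<^sub>v a = mean (harm_rep s) A B *\<^sub>v x" "B *\<^sub>v b = mean (harm_rep s) A B *\<^sub>v x"
    and xx: "x = of_real (1 - s) \<cdot>\<^sub>v a + of_real s \<cdot>\<^sub>v b"
    by (rule harm_mean_decomposition[OF A B s x]) blast
  define \<rho> where "\<rho> = Re ((mean (harm_rep s) A B *\<^sub>v x) \<bullet>c x)"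
  define k where "k = (\<lambda>i. t i / ((1 - s) * t i + s))"
  define N where "N = (\<Sum>i<n. (cmod ((W *\<^sub>v x) $ i))^2 * k i)"
  have e: "(mean (harm_rep s) A B *\<^sub>v x) \<bullet>c x = of_real (1 - s) * ((A *\<^sub>v a) \<bullet>c a) + of_real s * ((B *\<^sub>v b) \<bullet>c b)"
    using harm_mean_form[OF A B a b a b eq, of s] xx by simp
  have \<rho>: "\<rho> = (1 - s) * Re ((A *\<^sub>v a) \<bullet>c a) + s * Re ((B *\<^sub>v b) \<bullet>c b)" unfolding \<rho>_def e by simp
  have Wx: "(W *\<^sub>v x) $ i = of_real (1 - s) * (W *\<^sub>v a) $ i + of_real s * (W *\<^sub>v b) $ i" if "i < n" for i
  proof -
    have "W *\<^sub>v x = of_real (1 - s) \<cdot>\<^sub>v (W *\<^sub>v a) + of_real s \<cdot>\<^sub>v (W *\<^sub>v b)"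
      unfolding xx using W a b by (simp add: mult_add_distrib_mat_vec[of _ n n] mult_mat_vec[of _ n n])
    then show ?thesis using that W a b by (simp del: index_mult_mat_vec)
  qed
  have "N \<le> (\<Sum>i<n. (1 - s) * (cmod ((W *\<^sub>v a) $ i))^2 + s * (t i * (cmod ((W *\<^sub>v b) $ i))^2))"
    unfolding N_def k_def
  proof (rule sum_mono)
    fix i assume "i \<in> {..<n}"
    then have i: "i < n" by simp
    show "(cmod ((W *\<^sub>v x) $ i))^2 * (t i / ((1 - s) * t i + s)) \<le> (1 - s) * (cmod ((W *\<^sub>v a) $ i))^2 + s * (t i * (cmod ((W *\<^sub>v b) $ i))^2)"
      unfolding Wx[OF i] by (rule harm_scalar_ineq[OF t[OF i] s])
  qed
  also have "\<dots> = \<rho>" unfolding \<rho> rA[OF a] rB[OF b] sum_distrib_left sum.distrib ..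
  finally have "N \<le> \<rho>" .
  then show "1 * (\<Sum>i<n. (cmod ((W *\<^sub>v x) $ i))^2 * (t i / ((1 - s) * t i + s))) \<le> Re ((mean (harm_rep s) A B *\<^sub>v x) \<bullet>c x)"
    unfolding N_def k_def \<rho>_def by simp
  \<comment> \<open>The optimal decomposition. With \<open>P\<close>, \<open>Q\<close> the real
    parts of \<open>A\<close>, \<open>B\<close> and \<open>H\<close> their harmonic mean,
    \<open>a'\<close> is the inverse of \<open>P\<close> applied to \<open>H x\<close>, and
    \<open>b'\<close> is the inverse of \<open>Q\<close> applied to \<open>H x\<close>.\<close>
  define a' where "a' = V *\<^sub>v vec n (\<lambda>i. of_real (k i) * (W *\<^sub>v x) $ i)"
  define b' where "b' = V *\<^sub>v vec n (\<lambda>i. of_real (k i / t i) * (W *\<^sub>v x) $ i)"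
  have a': "a' \<in> carrier_vec n" and b': "b' \<in> carrier_vec n" using V by (auto simp: a'_def b'_def)
  have WVv: "W *\<^sub>v (V *\<^sub>v y) = y" and VWv: "V *\<^sub>v (W *\<^sub>v y) = y" if "y \<in> carrier_vec n" for y
    using that by (simp_all add: assoc_mult_mat_vec[OF W V that, symmetric] assoc_mult_mat_vec[OF V W that, symmetric] WV)
  have Wa': "(W *\<^sub>v a') $ i = of_real (k i) * (W *\<^sub>v x) $ i" "(W *\<^sub>v b') $ i = of_real (k i / t i) * (W *\<^sub>v x) $ i"
    if "i < n" for i unfolding a'_def b'_def using that by (subst WVv; simp del: index_mult_mat_vec)+
  have d: "0 < (1 - s) * t i + s" if "i < n" for i by (rule harm_pos[OF t[OF that] s])
  have kk: "(1 - s) * k i + s * (k i / t i) = 1" if "i < n" for i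
  proof -
    have "(1 - s) * k i + s * (k i / t i) = ((1 - s) * t i + s) / ((1 - s) * t i + s)"
      unfolding add_divide_distrib[of "(1 - s) * t i" s] using t[OF that] by (simp add: k_def)
    then show ?thesis using d[OF that] by simp
  qed
  have x': "of_real (1 - s) \<cdot>\<^sub>v a' + of_real s \<cdot>\<^sub>v b' = x"
  proof -
    have "W *\<^sub>v (of_real (1 - s) \<cdot>\<^sub>v a' + of_real s \<cdot>\<^sub>v b') = W *\<^sub>v x"
    proof (rule eq_vecI)
      fix i assume "i < dim_vec (W *\<^sub>v x)"
      then have i: "i < n" using W by simp
      have "(W *\<^sub>v (of_real (1 - s) \<cdot>\<^sub>v a' + of_real s \<cdot>\<^sub>v b')) $ i = of_real (1 - s) * (W *\<^sub>v a') $ i + of_real s * (W *\<^sub>v b') $ i"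
        using W a' b' i by (simp add: mult_add_distrib_mat_vec[of _ n n] mult_mat_vec[of _ n n] del: index_mult_mat_vec)
      also have "\<dots> = of_real ((1 - s) * k i + s * (k i / t i)) * (W *\<^sub>v x) $ i"
        unfolding Wa'[OF i] by (simp add: algebra_simps del: index_mult_mat_vec)
      finally show "(W *\<^sub>v (of_real (1 - s) \<cdot>\<^sub>v a' + of_real s \<cdot>\<^sub>v b')) $ i = (W *\<^sub>v x) $ i" unfolding kk[OF i] by simp
    qed simp
    then show ?thesis using VWv a' b' x by (metis add_carrier_vec smult_carrier_vec)
  qed
  have N': "(1 - s) * Re ((A *\<^sub>v a') \<bullet>c a') + s * Re ((B *\<^sub>v b') \<bullet>c b') = N"
    unfolding rA[OF a'] rB[OF b'] sum_distrib_left sum.distrib[symmetric] N_def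
  proof (rule sum.cong)
    fix i assume "i \<in> {..<n}"
    then have i: "i < n" by simp
    define w where "w = (cmod ((W *\<^sub>v x) $ i))^2"
    have "(1 - s) * (k i^2 * w) + s * (t i * ((k i / t i)^2 * w)) = ((1 - s) * k i + s * (k i / t i)) * (w * k i)"
      using t[OF i] by (simp add: power2_eq_square field_simps)
    then show "(1 - s) * (cmod ((W *\<^sub>v a') $ i))^2 + s * (t i * (cmod ((W *\<^sub>v b') $ i))^2) = (cmod ((W *\<^sub>v x) $ i))^2 * k i"
      unfolding Wa'[OF i] norm_mult norm_of_real power_mult_distrib power2_abs w_def[symmetric] kk[OF i] by simp
  qed simp
  \<comment> \<open>The weight \<open>1 + T^2\<close> is put on the primed vectors, whose forms add
    up to \<open>N\<close>. The other half of the estimate reproduces \<open>\<rho>\<close> and is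
    absorbed on the left.\<close>
  have "\<rho> \<le> cmod ((mean (harm_rep s) A B *\<^sub>v x) \<bullet>c x)" unfolding \<rho>_def by (rule complex_Re_le_cmod)
  also have "(mean (harm_rep s) A B *\<^sub>v x) \<bullet>c x = of_real (1 - s) * ((A *\<^sub>v a) \<bullet>c a') + of_real s * ((B *\<^sub>v b) \<bullet>c b')"
    using harm_mean_form[OF A B a b a' b' eq, of s] x' by simp
  also have "cmod \<dots> \<le> cmod (of_real (1 - s) * ((A *\<^sub>v a) \<bullet>c a')) + cmod (of_real s * ((B *\<^sub>v b) \<bullet>c b'))"
    by (rule norm_triangle_ineq)
  also have "\<dots> = (1 - s) * cmod ((A *\<^sub>v a) \<bullet>c a') + s * cmod ((B *\<^sub>v b) \<bullet>c b')"
    using s by (simp only: norm_mult norm_of_real)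
  also have "\<dots> \<le> (1 - s) * ((Re ((A *\<^sub>v a) \<bullet>c a) + (1 + T^2) * Re ((A *\<^sub>v a') \<bullet>c a')) / 2)
      + s * ((Re ((B *\<^sub>v b) \<bullet>c b) + (1 + T^2) * Re ((B *\<^sub>v b') \<bullet>c b')) / 2)"
    using s by (intro add_mono mult_left_mono sectorial_am_gm(1)[OF A a a'] sectorial_am_gm(1)[OF B b b']) auto
  also have "\<dots> = (\<rho> + (1 + T^2) * N) / 2" unfolding \<rho> N'[symmetric] by (simp add: field_simps)
  finally have "\<rho> \<le> (1 + T^2) * N" by simp
  then show "Re ((mean (harm_rep s) A B *\<^sub>v x) \<bullet>c x) \<le> (1 + T^2) * (\<Sum>i<n. (cmod ((W *\<^sub>v x) $ i))^2 * (t i / ((1 - s) * t i + s)))"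
    unfolding N_def k_def \<rho>_def .
qed (use t in auto)

text \<open>Here the reference pair is \<open>P = (Re A\<^sup>-\<^sup>1)\<^sup>-\<^sup>1\<close>, \<open>Q = (Re B\<^sup>-\<^sup>1)\<^sup>-\<^sup>1\<close>, so that \<open>Re (Z\<^sup>-\<^sup>1)\<close> is exactly the inverse of
  the harmonic mean of \<open>P\<close> and \<open>Q\<close> when \<open>Z\<close> is a harmonic mean of \<open>A\<close> and \<open>B\<close>.\<close>

theorem mean_bounds_inverse:
  assumes A: "sectorial n T A" and B: "sectorial n T B"
    and W: "W \<in> carrier_mat n n" and V: "V \<in> carrier_mat n n" and WV: "W * V = 1\<^sub>m n" "V * W = 1\<^sub>m n"
    and rA: "\<And>x. x \<in> carrier_vec n \<Longrightarrow> Re ((minv A *\<^sub>v x) \<bullet>c x) = (\<Sum>i<n. (cmod ((W *\<^sub>v x) $ i))^2)"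
    and rB: "\<And>x. x \<in> carrier_vec n \<Longrightarrow> Re ((minv B *\<^sub>v x) \<bullet>c x) = (\<Sum>i<n. t i * (cmod ((W *\<^sub>v x) $ i))^2)"
    and t: "\<And>i. i < n \<Longrightarrow> 0 < t i"
  shows "mean_bounds n (1 / (1 + T^2)) 1 A B (\<lambda>i x. (cmod ((mat_adjoint V *\<^sub>v x) $ i))^2) (\<lambda>i. 1 / t i)"
  unfolding mean_bounds_def
proof (intro conjI ballI allI impI)
  note V' = mat_adjoint_carrier[OF V] and W' = mat_adjoint_carrier[OF W]
  note Ai = sectorial_minv[OF A] and Bi = sectorial_minv[OF B]
  have kap: "0 < 1 + T^2" by (simp add: add_pos_nonneg)
  fix x :: "complex vec" assume x: "x \<in> carrier_vec n"
  \<comment> \<open>Coordinates dual to those of \<open>W\<close>: the pairing of \<open>x\<close>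
    with \<open>u\<close> is the standard product of \<open>c\<close> with
    \<open>W u\<close>.\<close>
  define c where "c = mat_adjoint V *\<^sub>v x"
  have c: "c \<in> carrier_vec n" using V' x by (simp add: c_def)
  have xu: "x \<bullet>c u = (\<Sum>i<n. c $ i * cnj ((W *\<^sub>v u) $ i))" if u: "u \<in> carrier_vec n" for u
  proof -
    have Wu: "W *\<^sub>v u \<in> carrier_vec n" using W u by simp
    have "V *\<^sub>v (W *\<^sub>v u) = u" using u by (simp add: assoc_mult_mat_vec[OF V W u, symmetric] WV)
    then have "x \<bullet>c u = c \<bullet>c (W *\<^sub>v u)" using adjoint_cscalar_prod'[OF V x Wu] by (simp add: c_def)
    then show ?thesis using cscalar_prod_sum[OF Wu] by simp
  qed
  show "\<exists>i<n. 0 < (cmod ((mat_adjoint V *\<^sub>v x) $ i))^2" if x0: "x \<noteq> 0\<^sub>v n"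
  proof (rule ccontr)
    assume "\<not> ?thesis"
    then have "x \<bullet>c x = 0" unfolding xu[OF x] c_def by (intro sum.neutral) auto
    then show False using x x0 conjugate_square_eq_0_vec[of x n] by simp
  qed
  fix s :: real assume s: "0 \<le> s" "s \<le> 1"
  obtain a b where a: "a \<in> carrier_vec n" and b: "b \<in> carrier_vec n"
    and eq: "A *\<^sub>v a = mean (harm_rep s) A B *\<^sub>v x" "B *\<^sub>v b = mean (harm_rep s) A B *\<^sub>v x"
    and xx: "x = of_real (1 - s) \<cdot>\<^sub>v a + of_real s \<cdot>\<^sub>v b"
    by (rule harm_mean_decomposition[OF A B s x]) blast
  define y where "y = mean (harm_rep s) A B *\<^sub>v x"
  have y: "y \<in> carrier_vec n" unfolding y_def by (rule mult_mat_vec_carrier[OF mean_carrier[OF A B] x])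
  have ay: "a = minv A *\<^sub>v y"
    unfolding y_def eq(1)[symmetric] using a
    by (simp add: assoc_mult_mat_vec[OF Ai(1) sectorialD(1)[OF A] a, symmetric] Ai(3))
  have by': "b = minv B *\<^sub>v y"
    unfolding y_def eq(2)[symmetric] using b
    by (simp add: assoc_mult_mat_vec[OF Bi(1) sectorialD(1)[OF B] b, symmetric] Bi(3))
  \<comment> \<open>Diagonal entries, in the coordinates of \<open>W\<close>, of the real part of
    \<open>(1 - s) A^-1 + s B^-1\<close>. Their reciprocals are the scalar harmonic means of 1 and
    \<open>1 / t i\<close>, which explains the parameters \<open>1 / t i\<close>.\<close>
  define d where "d = (\<lambda>i. (1 - s) + s * t i)"
  have d: "0 < d i" if "i < n" for i
    using harm_pos[of "1 / t i" s] t[OF that] s unfolding d_def by (cases "s = 1") (auto intro: add_pos_nonneg)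
  define \<rho> where "\<rho> = Re (y \<bullet>c x)"
  define N where "N = (\<Sum>i<n. (cmod (c $ i))^2 / d i)"
  have xw: "x \<bullet>c w = of_real (1 - s) * ((minv A *\<^sub>v y) \<bullet>c w) + of_real s * ((minv B *\<^sub>v y) \<bullet>c w)"
    if w: "w \<in> carrier_vec n" for w
    using lincomb_cscalar_prod(1)[OF a b w, of "of_real (1 - s)" "of_real s"] xx ay by' by simp
  have \<rho>x: "\<rho> = Re (x \<bullet>c y)" unfolding \<rho>_def using cscalar_prod_commute[OF x y] by (metis complex_cnj(1) cnj.simps(1))
  have \<rho>y: "\<rho> = (1 - s) * Re ((minv A *\<^sub>v y) \<bullet>c y) + s * Re ((minv B *\<^sub>v y) \<bullet>c y)"
    unfolding \<rho>x xw[OF y] by simp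
  have form: "(1 - s) * Re ((minv A *\<^sub>v w) \<bullet>c w) + s * Re ((minv B *\<^sub>v w) \<bullet>c w) = (\<Sum>i<n. d i * (cmod ((W *\<^sub>v w) $ i))^2)"
    if w: "w \<in> carrier_vec n" for w
    unfolding rA[OF w] rB[OF w] sum_distrib_left sum.distrib[symmetric] d_def
    by (rule sum.cong) (simp_all add: algebra_simps del: index_mult_mat_vec)
  have NN: "(\<Sum>i<n. (cmod ((mat_adjoint V *\<^sub>v x) $ i))^2 * (1 / t i / ((1 - s) * (1 / t i) + s))) = N"
    unfolding N_def c_def[symmetric]
  proof (rule sum.cong)
    fix i assume "i \<in> {..<n}"
    then have i: "i < n" by simp
    have "(1 - s) * (1 / t i) + s = d i / t i" using t[OF i] by (simp add: d_def field_simps)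
    then show "(cmod (c $ i))^2 * (1 / t i / ((1 - s) * (1 / t i) + s)) = (cmod (c $ i))^2 / d i" using t[OF i] by simp
  qed simp
  \<comment> \<open>\<open>w = H x\<close> for the harmonic mean \<open>H\<close> of the reference
    pair; both its pairing with \<open>x\<close> and the real part of the inverse form at
    \<open>w\<close> equal \<open>N\<close>, so the estimate below closes up.\<close>
  define w where "w = V *\<^sub>v vec n (\<lambda>i. c $ i / of_real (d i))"
  have w: "w \<in> carrier_vec n" using V by (simp add: w_def)
  have Ww: "(W *\<^sub>v w) $ i = c $ i / of_real (d i)" if "i < n" for i
  proof -
    have "W *\<^sub>v w = vec n (\<lambda>i. c $ i / of_real (d i))"
      unfolding w_def by (simp add: assoc_mult_mat_vec[OF W V, symmetric] WV)
    then show ?thesis using that by simp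
  qed
  have "x \<bullet>c w = of_real N"
    unfolding xu[OF w] N_def of_real_sum
    by (rule sum.cong) (simp_all add: Ww complex_norm_square[symmetric] del: complex_mult_cnj index_mult_mat_vec)
  then have "N \<le> cmod (x \<bullet>c w)" by (simp add: abs_le_iff)
  also have "\<dots> \<le> cmod (of_real (1 - s) * ((minv A *\<^sub>v y) \<bullet>c w)) + cmod (of_real s * ((minv B *\<^sub>v y) \<bullet>c w))"
    unfolding xw[OF w] by (rule norm_triangle_ineq)
  also have "\<dots> = (1 - s) * cmod ((minv A *\<^sub>v y) \<bullet>c w) + s * cmod ((minv B *\<^sub>v y) \<bullet>c w)"
    using s by (simp only: norm_mult norm_of_real)
  also have "\<dots> \<le> (1 - s) * (((1 + T^2) * Re ((minv A *\<^sub>v y) \<bullet>c y) + Re ((minv A *\<^sub>v w) \<bullet>c w)) / 2)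
      + s * (((1 + T^2) * Re ((minv B *\<^sub>v y) \<bullet>c y) + Re ((minv B *\<^sub>v w) \<bullet>c w)) / 2)"
    using s by (intro add_mono mult_left_mono sectorial_am_gm(2)[OF Ai(4) y w] sectorial_am_gm(2)[OF Bi(4) y w]) auto
  also have "\<dots> = ((1 + T^2) * \<rho> + ((1 - s) * Re ((minv A *\<^sub>v w) \<bullet>c w) + s * Re ((minv B *\<^sub>v w) \<bullet>c w))) / 2"
    unfolding \<rho>y by (simp add: field_simps)
  also have "(1 - s) * Re ((minv A *\<^sub>v w) \<bullet>c w) + s * Re ((minv B *\<^sub>v w) \<bullet>c w) = N"
    unfolding form[OF w] N_def
  proof (rule sum.cong)
    fix i assume "i \<in> {..<n}"
    then have i: "i < n" by simp
    show "d i * (cmod ((W *\<^sub>v w) $ i))^2 = (cmod (c $ i))^2 / d i"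
      unfolding Ww[OF i] using d[OF i] by (simp add: norm_divide power2_eq_square)
  qed simp
  finally have "N \<le> (1 + T^2) * \<rho>" by simp
  then have "1 / (1 + T^2) * N \<le> \<rho>" using kap by (simp add: divide_le_eq mult.commute)
  then show "1 / (1 + T^2) * (\<Sum>i<n. (cmod ((mat_adjoint V *\<^sub>v x) $ i))^2 * (1 / t i / ((1 - s) * (1 / t i) + s)))
      \<le> Re ((mean (harm_rep s) A B *\<^sub>v x) \<bullet>c x)"
    unfolding NN \<rho>_def y_def .
  \<comment> \<open>Termwise AM-GM with weight \<open>d i\<close>. Only diagonal forms are involved
    here, so no sector constant is lost in this direction.\<close>
  have "\<rho> \<le> (\<Sum>i<n. ((cmod (c $ i))^2 / d i + d i * (cmod ((W *\<^sub>v y) $ i))^2) / 2)"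
    unfolding \<rho>x xu[OF y] Re_sum
  proof (rule sum_mono)
    fix i assume "i \<in> {..<n}"
    then have i: "i < n" by simp
    define p where "p = cmod (c $ i)"
    define q where "q = cmod ((W *\<^sub>v y) $ i)"
    have "Re (c $ i * cnj ((W *\<^sub>v y) $ i)) \<le> cmod (c $ i * cnj ((W *\<^sub>v y) $ i))" by (rule complex_Re_le_cmod)
    also have "\<dots> = p * q" by (simp add: norm_mult p_def q_def del: index_mult_mat_vec)
    also have "p * q \<le> (p^2 / d i + d i * q^2) / 2"
    proof -
      have "0 \<le> (p - d i * q)^2 / d i" using d[OF i] by simp
      also have "\<dots> = p^2 / d i + d i * q^2 - 2 * (p * q)" using d[OF i] by (simp add: power2_eq_square field_simps)
      finally show ?thesis by simp
    qed
    finally show "Re (c $ i * cnj ((W *\<^sub>v y) $ i)) \<le> ((cmod (c $ i))^2 / d i + d i * (cmod ((W *\<^sub>v y) $ i))^2) / 2"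
      by (simp only: p_def q_def)
  qed
  also have "\<dots> = (N + \<rho>) / 2" unfolding \<rho>y form[OF y] N_def by (simp only: sum.distrib sum_divide_distrib[symmetric])
  finally have "\<rho> \<le> N" by simp
  then show "Re ((mean (harm_rep s) A B *\<^sub>v x) \<bullet>c x)
      \<le> 1 * (\<Sum>i<n. (cmod ((mat_adjoint V *\<^sub>v x) $ i))^2 * (1 / t i / ((1 - s) * (1 / t i) + s)))"
    unfolding NN \<rho>_def y_def by simp
qed (use t in auto)

section \<open>Loewner bounds as bounds on forms, and the three inequalities\<close>

lemma loewner_le_form:
  assumes le: "loewner_le X Y" and X: "X \<in> carrier_mat n n" and Y: "Y \<in> carrier_mat n n" and x: "x \<in> carrier_vec n"
  shows "Re ((X *\<^sub>v x) \<bullet>c x) \<le> Re ((Y *\<^sub>v x) \<bullet>c x)"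
proof -
  have "0 \<le> Re (((Y - X) *\<^sub>v x) \<bullet>c x)" using le x Y X unfolding loewner_le_def psd_def by auto
  also have "((Y - X) *\<^sub>v x) \<bullet>c x = (Y *\<^sub>v x) \<bullet>c x - (X *\<^sub>v x) \<bullet>c x"
    unfolding minus_mult_distrib_mat_vec[OF Y X x] cscalar_prod_sum[OF x]
    using X Y by (simp add: left_diff_distrib sum_subtractf del: index_mult_mat_vec)
  finally show ?thesis by simp
qed

lemma loewner_bounds_form:
  assumes X: "X \<in> carrier_mat n n" and x: "x \<in> carrier_vec n"
    and "loewner_le (of_real m \<cdot>\<^sub>m 1\<^sub>m n) (herm_part X)" "loewner_le (herm_part X) (of_real M \<cdot>\<^sub>m 1\<^sub>m n)"
  shows "m * vnorm2 x \<le> Re ((X *\<^sub>v x) \<bullet>c x) \<and> Re ((X *\<^sub>v x) \<bullet>c x) \<le> M * vnorm2 x"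
proof -
  have c: "Re (((of_real r \<cdot>\<^sub>m 1\<^sub>m n) *\<^sub>v x) \<bullet>c x) = r * vnorm2 x" for r
    using x by (simp add: mult_scalar_mat_vec cscalar_prod_smult_left[of _ n] cscalar_prod_self[OF x])
  show ?thesis
    using loewner_le_form[OF assms(3) _ herm_part_carrier[OF X] x] loewner_le_form[OF assms(4) herm_part_carrier[OF X] _ x]
    by (simp add: c herm_part_quadratic_form[OF X x])
qed

lemma sv_nonneg:
  assumes "X \<in> carrier_mat n n" "1 \<le> j" "j \<le> n"
  shows "0 \<le> sv X j"
proof -
  obtain U t where "\<And>i. i < n \<Longrightarrow> 0 \<le> t i" "\<And>j. 1 \<le> j \<Longrightarrow> j \<le> n \<Longrightarrow> sv X j = sqrt (t (j - 1))"
    by (rule sv_diagonalization[OF assms(1)]) blast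
  then show ?thesis using assms by simp
qed


theorem theorem3p4:
  fixes n :: nat and \<theta> m M :: real and A B :: "complex mat"
    and \<sigma> \<sigma>1 \<sigma>2 :: "complex \<Rightarrow> complex"
  defines "K \<equiv> (M + m)^2 / (4 * m * M)"
  assumes "0 \<le> \<theta>" and "\<theta> < pi / 2"
    and "A \<in> sector n \<theta>" and "B \<in> sector n \<theta>"
    and "op_mean_fun \<sigma>" and "op_mean_fun \<sigma>1" and "op_mean_fun \<sigma>2"
    and "mean_le (adjoint_mean \<sigma>) \<sigma>1" and "mean_le \<sigma>1 \<sigma>"
    and "mean_le (adjoint_mean \<sigma>) \<sigma>2" and "mean_le \<sigma>2 \<sigma>"
    and "0 < m" and "m \<le> M"
  shows
    "(loewner_le (of_real m \<cdot>\<^sub>m 1\<^sub>m n) (herm_part A) \<and> loewner_le (herm_part A) (of_real M \<cdot>\<^sub>m 1\<^sub>m n) \<and>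
      loewner_le (of_real m \<cdot>\<^sub>m 1\<^sub>m n) (herm_part B) \<and> loewner_le (herm_part B) (of_real M \<cdot>\<^sub>m 1\<^sub>m n)
      \<longrightarrow> (\<forall>j \<in> {1..n}. sv (mean \<sigma>1 A B) j \<le> (1 / cos \<theta>)^4 * K * sv (mean \<sigma>2 A B) j))
   \<and> (loewner_le (of_real m \<cdot>\<^sub>m 1\<^sub>m n) (herm_part (minv A)) \<and> loewner_le (herm_part (minv A)) (of_real M \<cdot>\<^sub>m 1\<^sub>m n) \<and>
      loewner_le (of_real m \<cdot>\<^sub>m 1\<^sub>m n) (herm_part (minv B)) \<and> loewner_le (herm_part (minv B)) (of_real M \<cdot>\<^sub>m 1\<^sub>m n)
      \<longrightarrow> (\<forall>j \<in> {1..n}. sv (mean \<sigma>1 A B) j \<le> (1 / cos \<theta>)^6 * K * sv (mean \<sigma>2 A B) j))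
   \<and> (\<forall>v \<tau>. 0 \<le> v \<and> v \<le> 1 \<and> op_mean_fun \<tau> \<and> mean_le (harm_fun v) \<tau> \<and> mean_le \<tau> (arith_fun v) \<and>
      loewner_le (of_real m \<cdot>\<^sub>m 1\<^sub>m n) (herm_part A) \<and> loewner_le (herm_part A) (of_real M \<cdot>\<^sub>m 1\<^sub>m n) \<and>
      loewner_le (of_real m \<cdot>\<^sub>m 1\<^sub>m n) (herm_part B) \<and> loewner_le (herm_part B) (of_real M \<cdot>\<^sub>m 1\<^sub>m n)
      \<longrightarrow> (\<forall>j \<in> {1..n}. sv (of_real v \<cdot>\<^sub>m A + of_real (1 - v) \<cdot>\<^sub>m B) j
                          \<le> (1 / cos \<theta>)^2 * K * sv (mean \<tau> A B) j))"
proof -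
  define T where "T = tan \<theta>"
  have A: "sectorial n T A" and B: "sectorial n T B" unfolding T_def using assms(4,5) by (auto intro: sector_imp_sectorial)
  note Ac = sectorialD(1)[OF A] and Bc = sectorialD(1)[OF B] and Ai = sectorial_minv[OF A] and Bi = sectorial_minv[OF B]
  note g = \<open>op_mean_fun \<sigma>\<close> \<open>op_mean_fun \<sigma>1\<close> \<open>op_mean_fun \<sigma>2\<close>
  have m: "0 < m" "m \<le> M" by fact+
  have c0: "0 < cos \<theta>" using assms(2,3) by (intro cos_gt_zero_pi) auto
  define \<kappa> where "\<kappa> = 1 + T^2"
  have \<kappa>: "1 \<le> \<kappa>" by (simp add: \<kappa>_def)
  have sec: "(1 / cos \<theta>)^2 = \<kappa>"
    using tan_sec[of \<theta>] c0 by (simp add: \<kappa>_def T_def power_divide inverse_eq_divide)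
  have sec4: "(1 / cos \<theta>)^4 = \<kappa> * \<kappa>" and sec6: "(1 / cos \<theta>)^6 = \<kappa> * (\<kappa> * \<kappa>)"
    unfolding sec[symmetric] power_add[symmetric] by simp_all
  have K0: "0 \<le> K" using m by (simp add: K_def)
  \<comment> \<open>\<open>\<sigma>1\<close> is at most \<open>\<sigma>\<close>, and
    \<open>\<sigma>2\<close> is at least the adjoint of \<open>\<sigma>\<close>, whose value at
    \<open>t\<close> is the reciprocal of \<open>\<sigma>\<close> at \<open>1 / t\<close>. The
    quotient is thus bounded by the product estimated in
    \<open>op_mean_product_bound\<close>.\<close>
  have ratio: "Re (\<sigma>1 (of_real t)) \<le> K * Re (\<sigma>2 (of_real t))" if t: "m / M \<le> t" "t \<le> M / m" for t
  proof -
    have t0: "0 < t" using t(1) divide_pos_pos[of m M] m by linarith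
    have pos: "0 < Re (g (of_real x))" "g (of_real x) = of_real (Re (g (of_real x)))"
      if "op_mean_fun g" "0 < x" for g x using that by (auto simp: op_mean_fun_def)
    define r where "r = Re (\<sigma> (of_real (1 / t)))"
    have r: "0 < r" unfolding r_def using pos(1)[OF g(1), of "1 / t"] t0 by simp
    have "adjoint_mean \<sigma> (of_real t) = inverse (\<sigma> (of_real (1 / t)))"
      by (simp add: adjoint_mean_def inverse_eq_divide)
    also have "\<sigma> (of_real (1 / t)) = of_real r" unfolding r_def by (rule pos(2)[OF g(1)]) (use t0 in simp)
    finally have "Re (adjoint_mean \<sigma> (of_real t)) = 1 / r" by (simp add: inverse_eq_divide)
    then have s2: "1 / r \<le> Re (\<sigma>2 (of_real t))" using assms(11) t0 unfolding mean_le_def by metis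
    have "Re (\<sigma>1 (of_real t)) \<le> Re (\<sigma> (of_real t))" using assms(10) t0 unfolding mean_le_def by blast
    moreover have "Re (\<sigma> (of_real t)) * r \<le> K"
      using op_mean_product_bound[OF g(1) t0] kantorovich_bound[OF m t] unfolding r_def K_def by linarith
    then have "Re (\<sigma> (of_real t)) \<le> K * (1 / r)" using r by (simp add: pos_le_divide_eq)
    moreover have "K * (1 / r) \<le> K * Re (\<sigma>2 (of_real t))" using s2 K0 by (rule mult_left_mono)
    ultimately show ?thesis by linarith
  qed
  obtain W V t where W: "W \<in> carrier_mat n n" and V: "V \<in> carrier_mat n n" and WV: "W * V = 1\<^sub>m n" "V * W = 1\<^sub>m n"
    and rA: "\<And>x. x \<in> carrier_vec n \<Longrightarrow> Re ((A *\<^sub>v x) \<bullet>c x) = (\<Sum>i<n. (cmod ((W *\<^sub>v x) $ i))^2)"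
    and rB: "\<And>x. x \<in> carrier_vec n \<Longrightarrow> Re ((B *\<^sub>v x) \<bullet>c x) = (\<Sum>i<n. t i * (cmod ((W *\<^sub>v x) $ i))^2)"
    and t: "\<And>i. i < n \<Longrightarrow> 0 < t i"
    and tb: "\<And>m M i. 0 < m \<Longrightarrow> m \<le> M \<Longrightarrow>
     (\<And>x. x \<in> carrier_vec n \<Longrightarrow> m * vnorm2 x \<le> Re ((A *\<^sub>v x) \<bullet>c x) \<and> Re ((A *\<^sub>v x) \<bullet>c x) \<le> M * vnorm2 x) \<Longrightarrow>
     (\<And>x. x \<in> carrier_vec n \<Longrightarrow> m * vnorm2 x \<le> Re ((B *\<^sub>v x) \<bullet>c x) \<and> Re ((B *\<^sub>v x) \<bullet>c x) \<le> M * vnorm2 x) \<Longrightarrow>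
     i < n \<Longrightarrow> m / M \<le> t i \<and> t i \<le> M / m"
    by (rule herm_part_diagonalization[OF A B]) blast
  note mb = mean_bounds_herm_part[OF A B W V WV rA rB t]
  have tmM: "m / M \<le> t i" "t i \<le> M / m"
    if bd: "loewner_le (of_real m \<cdot>\<^sub>m 1\<^sub>m n) (herm_part A)" "loewner_le (herm_part A) (of_real M \<cdot>\<^sub>m 1\<^sub>m n)"
      "loewner_le (of_real m \<cdot>\<^sub>m 1\<^sub>m n) (herm_part B)" "loewner_le (herm_part B) (of_real M \<cdot>\<^sub>m 1\<^sub>m n)"
      and i: "i < n" for i
    using tb[OF m loewner_bounds_form[OF Ac _ bd(1,2)] loewner_bounds_form[OF Bc _ bd(3,4)] i] by auto
  have part1: "sv (mean \<sigma>1 A B) j \<le> (1 / cos \<theta>)^4 * K * sv (mean \<sigma>2 A B) j"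
    if bd: "loewner_le (of_real m \<cdot>\<^sub>m 1\<^sub>m n) (herm_part A)" "loewner_le (herm_part A) (of_real M \<cdot>\<^sub>m 1\<^sub>m n)"
      "loewner_le (of_real m \<cdot>\<^sub>m 1\<^sub>m n) (herm_part B)" "loewner_le (herm_part B) (of_real M \<cdot>\<^sub>m 1\<^sub>m n)"
      and j: "1 \<le> j" "j \<le> n"
    for j
  proof -
    have "sv (mean \<sigma>1 A B) j \<le> (1 + T^2) * ((1 + T^2) / 1 * K) * sv (mean \<sigma>2 A B) j"
      by (rule sv_mean_le[OF A B mb _ _ g(2,3) K0 ratio[OF tmM[OF bd]] j]) (auto intro: add_nonneg_nonneg)
    then show "sv (mean \<sigma>1 A B) j \<le> (1 / cos \<theta>)^4 * K * sv (mean \<sigma>2 A B) j"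
      unfolding sec4 \<kappa>_def[symmetric] by (simp add: mult.assoc)
  qed
  have part3: "sv (of_real v \<cdot>\<^sub>m A + of_real (1 - v) \<cdot>\<^sub>m B) j \<le> (1 / cos \<theta>)^2 * K * sv (mean \<tau> A B) j"
    if bd: "loewner_le (of_real m \<cdot>\<^sub>m 1\<^sub>m n) (herm_part A)" "loewner_le (herm_part A) (of_real M \<cdot>\<^sub>m 1\<^sub>m n)"
      "loewner_le (of_real m \<cdot>\<^sub>m 1\<^sub>m n) (herm_part B)" "loewner_le (herm_part B) (of_real M \<cdot>\<^sub>m 1\<^sub>m n)"
      and j: "1 \<le> j" "j \<le> n"
      and v: "0 \<le> v" "v \<le> 1" "op_mean_fun \<tau>" "mean_le (harm_fun v) \<tau>"
    for j v \<tau>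
  proof -
    let ?X = "of_real v \<cdot>\<^sub>m A + of_real (1 - v) \<cdot>\<^sub>m B"
    have Xf: "(?X *\<^sub>v x) \<bullet>c x = of_real v * ((A *\<^sub>v x) \<bullet>c x) + of_real (1 - v) * ((B *\<^sub>v x) \<bullet>c x)"
      if x: "x \<in> carrier_vec n" for x
      unfolding lincomb_mat_vec[OF Ac Bc x] using Ac Bc x by (intro lincomb_cscalar_prod(1)[of _ n]) auto
    have X: "sectorial n T ?X"
      unfolding sectorial_def
    proof (intro conjI ballI impI)
      show "?X \<in> carrier_mat n n" using Ac Bc by simp
      fix x :: "complex vec" assume x: "x \<in> carrier_vec n"
      have "\<bar>v * Im ((A *\<^sub>v x) \<bullet>c x) + (1 - v) * Im ((B *\<^sub>v x) \<bullet>c x)\<bar> \<le> v * \<bar>Im ((A *\<^sub>v x) \<bullet>c x)\<bar> + (1 - v) * \<bar>Im ((B *\<^sub>v x) \<bullet>c x)\<bar>"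
        using v abs_triangle_ineq[of "v * Im ((A *\<^sub>v x) \<bullet>c x)" "(1 - v) * Im ((B *\<^sub>v x) \<bullet>c x)"] by (simp add: abs_mult)
      also have "\<dots> \<le> v * (T * Re ((A *\<^sub>v x) \<bullet>c x)) + (1 - v) * (T * Re ((B *\<^sub>v x) \<bullet>c x))"
        using v sectorialD(2)[OF A x] sectorialD(2)[OF B x] by (intro add_mono mult_left_mono) auto
      finally show "\<bar>Im ((?X *\<^sub>v x) \<bullet>c x)\<bar> \<le> T * Re ((?X *\<^sub>v x) \<bullet>c x)"
        unfolding Xf[OF x] by (simp add: algebra_simps)
      assume x0: "x \<noteq> 0\<^sub>v n"
      have "0 < v * Re ((A *\<^sub>v x) \<bullet>c x) + (1 - v) * Re ((B *\<^sub>v x) \<bullet>c x)"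
        using v sectorialD(3)[OF A x x0] sectorialD(3)[OF B x x0] by (cases "v = 0") (auto intro: add_pos_nonneg)
      then show "0 < Re ((?X *\<^sub>v x) \<bullet>c x)" unfolding Xf[OF x] by simp
    qed
    \<comment> \<open>The real part of the arithmetic mean is diagonal in the reference coordinates,
      so only the lower comparison bound with constant 1 is used, and \<open>1 + T^2\<close> occurs
      once.\<close>
    have "sv ?X j \<le> (1 + T^2) * K * sv (mean \<tau> A B) j"
    proof (rule sv_le_of_sectorial'[OF X mean_carrier[OF A B] _ K0 j])
      fix x :: "complex vec" assume x: "x \<in> carrier_vec n"
      have "Re ((?X *\<^sub>v x) \<bullet>c x) = (\<Sum>i<n. (cmod ((W *\<^sub>v x) $ i))^2 * (v + (1 - v) * t i))"
      proof -
        have "Re ((?X *\<^sub>v x) \<bullet>c x) = v * (\<Sum>i<n. (cmod ((W *\<^sub>v x) $ i))^2) + (1 - v) * (\<Sum>i<n. t i * (cmod ((W *\<^sub>v x) $ i))^2)"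
          unfolding Xf[OF x] rA[OF x, symmetric] rB[OF x, symmetric] by simp
        also have "\<dots> = (\<Sum>i<n. (cmod ((W *\<^sub>v x) $ i))^2 * (v + (1 - v) * t i))"
          unfolding sum_distrib_left sum.distrib[symmetric]
          by (rule sum.cong) (simp_all add: algebra_simps del: index_mult_mat_vec)
        finally show ?thesis .
      qed
      also have "\<dots> \<le> (\<Sum>i<n. (cmod ((W *\<^sub>v x) $ i))^2 * (K * Re (\<tau> (of_real (t i)))))"
      proof (intro sum_mono mult_left_mono)
        fix i assume "i \<in> {..<n}"
        then have i: "i < n" by simp
        \<comment> \<open>At \<open>t i\<close> the arithmetic function has the value
          \<open>p\<close> and the harmonic function the value \<open>1 / h\<close>, so the ratio to
          be bounded by \<open>K\<close> is \<open>p * h\<close>.\<close>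
        define p where "p = v + (1 - v) * t i"
        define h where "h = v + (1 - v) * (1 / t i)"
        have h0: "0 < h" unfolding h_def using v(1,2) t[OF i] by (cases "v = 0") (auto intro: add_pos_nonneg)
        have "harm_fun v (of_real (t i)) = of_real (1 / h)" by (simp add: harm_fun_def h_def inverse_eq_divide)
        then have "1 / h \<le> Re (\<tau> (of_real (t i)))" using v(4) t[OF i] unfolding mean_le_def by (metis Re_complex_of_real)
        then have "K * (1 / h) \<le> K * Re (\<tau> (of_real (t i)))" using K0 by (rule mult_left_mono)
        moreover have "p * h \<le> K"
        proof -
          have "(1 + t i)^2 / (4 * t i) - p * h = (1 - 2 * v)^2 * (1 - t i)^2 / (4 * t i)"
            using t[OF i] by (simp add: p_def h_def divide_simps) (simp add: power2_eq_square algebra_simps)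
          also have "\<dots> \<ge> 0" using t[OF i] by simp
          finally show ?thesis using kantorovich_bound[OF m tmM[OF bd i]] unfolding K_def by linarith
        qed
        then have "p \<le> K * (1 / h)" using h0 by (simp add: pos_le_divide_eq)
        ultimately show "v + (1 - v) * t i \<le> K * Re (\<tau> (of_real (t i)))" unfolding p_def by linarith
      qed simp
      also have "\<dots> = K * (1 * (\<Sum>i<n. (cmod ((W *\<^sub>v x) $ i))^2 * Re (\<tau> (of_real (t i)))))"
        by (simp add: sum_distrib_left mult_ac del: index_mult_mat_vec)
      also have "\<dots> \<le> K * Re ((mean \<tau> A B *\<^sub>v x) \<bullet>c x)"
        using mean_bounds_op_mean(1)[OF A B mb v(3) x] K0 by (rule mult_left_mono)
      finally show "Re ((?X *\<^sub>v x) \<bullet>c x) \<le> K * Re ((mean \<tau> A B *\<^sub>v x) \<bullet>c x)" .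
    qed
    then show "sv ?X j \<le> (1 / cos \<theta>)^2 * K * sv (mean \<tau> A B) j" unfolding sec \<kappa>_def .
  qed
  have part2: "sv (mean \<sigma>1 A B) j \<le> (1 / cos \<theta>)^6 * K * sv (mean \<sigma>2 A B) j"
    if bd: "loewner_le (of_real m \<cdot>\<^sub>m 1\<^sub>m n) (herm_part (minv A))" "loewner_le (herm_part (minv A)) (of_real M \<cdot>\<^sub>m 1\<^sub>m n)"
      "loewner_le (of_real m \<cdot>\<^sub>m 1\<^sub>m n) (herm_part (minv B))" "loewner_le (herm_part (minv B)) (of_real M \<cdot>\<^sub>m 1\<^sub>m n)"
      and j: "1 \<le> j" "j \<le> n"
    for j
  proof -
    obtain W V t where W: "W \<in> carrier_mat n n" and V: "V \<in> carrier_mat n n" and WV: "W * V = 1\<^sub>m n" "V * W = 1\<^sub>m n"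
      and rA: "\<And>x. x \<in> carrier_vec n \<Longrightarrow> Re ((minv A *\<^sub>v x) \<bullet>c x) = (\<Sum>i<n. (cmod ((W *\<^sub>v x) $ i))^2)"
      and rB: "\<And>x. x \<in> carrier_vec n \<Longrightarrow> Re ((minv B *\<^sub>v x) \<bullet>c x) = (\<Sum>i<n. t i * (cmod ((W *\<^sub>v x) $ i))^2)"
      and t: "\<And>i. i < n \<Longrightarrow> 0 < t i"
      and tb: "\<And>m M i. 0 < m \<Longrightarrow> m \<le> M \<Longrightarrow>
       (\<And>x. x \<in> carrier_vec n \<Longrightarrow> m * vnorm2 x \<le> Re ((minv A *\<^sub>v x) \<bullet>c x) \<and> Re ((minv A *\<^sub>v x) \<bullet>c x) \<le> M * vnorm2 x) \<Longrightarrow>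
       (\<And>x. x \<in> carrier_vec n \<Longrightarrow> m * vnorm2 x \<le> Re ((minv B *\<^sub>v x) \<bullet>c x) \<and> Re ((minv B *\<^sub>v x) \<bullet>c x) \<le> M * vnorm2 x) \<Longrightarrow>
       i < n \<Longrightarrow> m / M \<le> t i \<and> t i \<le> M / m"
      by (rule herm_part_diagonalization[OF Ai(4) Bi(4)]) blast
    note mb = mean_bounds_inverse[OF A B W V WV rA rB t]
    \<comment> \<open>The interval from \<open>m / M\<close> to \<open>M / m\<close> is symmetric
      under inversion, so the reciprocals required by \<open>mean_bounds_inverse\<close> obey the
      same bounds.\<close>
    have tmM: "m / M \<le> 1 / t i" "1 / t i \<le> M / m" if i: "i < n" for i
    proof -
      have "m / M \<le> t i" "t i \<le> M / m"
        using tb[OF m loewner_bounds_form[OF Ai(1) _ bd(1,2)] loewner_bounds_form[OF Bi(1) _ bd(3,4)] i] by auto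
      then show "m / M \<le> 1 / t i" "1 / t i \<le> M / m" using m t[OF i] by (simp_all add: field_simps)
    qed
    have k0: "0 < 1 / (1 + T^2)" by (simp add: add_pos_nonneg)
    have "sv (mean \<sigma>1 A B) j \<le> (1 + T^2) * (1 / (1 / (1 + T^2)) * K) * sv (mean \<sigma>2 A B) j"
      by (rule sv_mean_le[OF A B mb k0 _ g(2,3) K0 ratio[OF tmM] j]) auto
    \<comment> \<open>The comparison yields the fourth power of sec; since
      \<open>1 \<le> \<kappa>\<close> and singular values are nonnegative, it implies the stated
      bound with the sixth power.\<close>
    also have "\<dots> = 1 * (\<kappa> * \<kappa> * K * sv (mean \<sigma>2 A B) j)" unfolding \<kappa>_def[symmetric] by (simp add: mult.assoc)
    also have "\<dots> \<le> \<kappa> * (\<kappa> * \<kappa> * K * sv (mean \<sigma>2 A B) j)"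
      using \<kappa> K0 sv_nonneg[OF mean_carrier[OF A B] j] by (intro mult_right_mono mult_nonneg_nonneg) auto
    finally show ?thesis unfolding sec6 by (simp add: mult.assoc)
  qed
  show ?thesis
  proof (intro conjI impI allI ballI)
    fix j assume h: "loewner_le (of_real m \<cdot>\<^sub>m 1\<^sub>m n) (herm_part A) \<and> loewner_le (herm_part A) (of_real M \<cdot>\<^sub>m 1\<^sub>m n) \<and>
      loewner_le (of_real m \<cdot>\<^sub>m 1\<^sub>m n) (herm_part B) \<and> loewner_le (herm_part B) (of_real M \<cdot>\<^sub>m 1\<^sub>m n)" and j: "j \<in> {1..n}"
    show "sv (mean \<sigma>1 A B) j \<le> (1 / cos \<theta>)^4 * K * sv (mean \<sigma>2 A B) j"
      using part1 h j by auto
  next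
    fix j assume h: "loewner_le (of_real m \<cdot>\<^sub>m 1\<^sub>m n) (herm_part (minv A)) \<and> loewner_le (herm_part (minv A)) (of_real M \<cdot>\<^sub>m 1\<^sub>m n) \<and>
      loewner_le (of_real m \<cdot>\<^sub>m 1\<^sub>m n) (herm_part (minv B)) \<and> loewner_le (herm_part (minv B)) (of_real M \<cdot>\<^sub>m 1\<^sub>m n)" and j: "j \<in> {1..n}"
    show "sv (mean \<sigma>1 A B) j \<le> (1 / cos \<theta>)^6 * K * sv (mean \<sigma>2 A B) j"
      using part2 h j by auto
  next
    fix v \<tau> j
    assume h: "0 \<le> v \<and> v \<le> 1 \<and> op_mean_fun \<tau> \<and> mean_le (harm_fun v) \<tau> \<and> mean_le \<tau> (arith_fun v) \<and>
      loewner_le (of_real m \<cdot>\<^sub>m 1\<^sub>m n) (herm_part A) \<and> loewner_le (herm_part A) (of_real M \<cdot>\<^sub>m 1\<^sub>m n) \<and>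
      loewner_le (of_real m \<cdot>\<^sub>m 1\<^sub>m n) (herm_part B) \<and> loewner_le (herm_part B) (of_real M \<cdot>\<^sub>m 1\<^sub>m n)" and j: "j \<in> {1..n}"
    show "sv (of_real v \<cdot>\<^sub>m A + of_real (1 - v) \<cdot>\<^sub>m B) j \<le> (1 / cos \<theta>)^2 * K * sv (mean \<tau> A B) j"
      using part3 h j by auto
  qed
qed

end
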